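(* Assume the observation scheme (O) and the condition (I) on the initial value described in the context, and let $\sigma$ be constant. For any $y\in[\delta,1-\delta]$ the estimator $$\hat\sigma_y^2=\frac{\sqrt{\pi\vartheta_2}}{n\sqrt{\Delta_n}}\sum_{i=1}^n(\Delta_iX)^2(y)\exp(y\,\vartheta_1/\vartheta_2)$$ obeys, as $n\to\infty$, the central limit theorem $$n^{1/2}\big(\hat\sigma_y^2-\sigma^2\big)\stackrel{d}{\rightarrow}\mathcal N\big(0,\pi\Gamma\sigma^4\big),$$ with Gaussian limit law, where $\Gamma$ is the numerical constant $$\Gamma=\frac1\pi\sum_{r=0}^\infty I(r)^2+\frac2\pi,\qquad I(r)=2\sqrt{r+1}-\sqrt{r+2}-\sqrt r$$ (numerically $\Gamma\approx0.75$).
   Context: Model. Let $\vartheta=(\vartheta_0,\vartheta_1,\vartheta_2)$ with $\vartheta_0,\vartheta_1\in\mathbb R$, $\vartheta_2>0$, and $A_\vartheta=\vartheta_0+\vartheta_1\frac{\partial}{\partial y}+\vartheta_2\frac{\partial^2}{\partial y^2}$ on $[0,1]$ with zero Dirichlet boundary conditions. For $k\ge1$ put $e_k(y)=\sqrt2\,\sin(\pi k y)\exp(-\tfrac{\vartheta_1}{2\vartheta_2}y)$, $y\in[0,1]$, and $\lambda_k=-\vartheta_0+\tfrac{\vartheta_1^2}{4\vartheta_2}+\pi^2k^2\vartheta_2$; the $e_k$ are eigenfunctions of $A_\vartheta$ with eigenvalues $-\lambda_k$. They form an orthonormal basis of $H_\vartheta=\{f:[0,1]\to\mathbb R:\|f\|_\vartheta<\infty\}$,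 $\langle f,g\rangle_\vartheta=\int_0^1e^{y\vartheta_1/\vartheta_2}f(y)g(y)\,dy$, $\|f\|_\vartheta^2=\langle f,f\rangle_\vartheta$, and $A_\vartheta$ is self-adjoint on $H_\vartheta$. Let $(W^k)_{k\ge1}$ be independent standard Brownian motions and $\xi$ an $H_\vartheta$-valued random variable independent of $(W^k)_{k\ge1}$. $X$ is the (time-space continuous version of the) mild solution of $dX_t(y)=A_\vartheta X_t(y)\,dt+\sigma\,dB_t(y)$ on $[0,1]$ with $X_0=\xi$, $X_t(0)=X_t(1)=0$ and cylindrical Brownian motion $B$ given by $\langle B_t,f\rangle_\vartheta=\sum_{k\ge1}\langle f,e_k\rangle_\vartheta W^k_t$, that is, $$X_t(y)=\sum_{k\ge1}x_k(t)e_k(y),\qquad x_k(t)=e^{-\lambda_kt}\langle\xi,e_k\rangle_\vartheta+\int_0^te^{-\lambda_k(t-s)}\sigma\,dW^k_s.$$ (O) Observations: $X$ is observed at times $t_i=i\Delta_n$, $i=0,\dots,n$, with $n\Delta_n=1$, $n\to\infty$; here at one fixed spatial point $y\in[\delta,1-\delta]$, where $\delta>0$ is fixed. (I) Initial value: (i) either $\mathbb E[\langle\xi,e_k\rangle_\vartheta]=0$ for all $k\ge1$ and $\sup_k\lambda_k\mathbb E[\langle\xi,e_k\rangle_\vartheta^2]<\infty$, or $\mathbb E[\|A_\vartheta^{1/2}\xi\|_\vartheta^2]<\infty$ (where $\langle A_\vartheta^{1/2}\xi,e_k\rangle_\vartheta^2=\lambda_k\langle\xi,e_k\rangle_\vartheta^2$);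 (ii) $(\langle\xi,e_k\rangle_\vartheta)_{k\ge1}$ are independent. Notation: $\Delta_iX(y)=X_{i\Delta_n}(y)-X_{(i-1)\Delta_n}(y)$, $(\Delta_iX)^2(y)=(\Delta_iX(y))^2$. *)

theory Defs
  imports "HOL-Probability.Probability"
begin

subsection \<open>The weighted space and the eigensystem\<close>

definition H_inner :: "real \<Rightarrow> real \<Rightarrow> (real \<Rightarrow> real) \<Rightarrow> (real \<Rightarrow> real) \<Rightarrow> real" where
  "H_inner \<theta>1 \<theta>2 f g = (LBINT y:{0..1}. exp (y * \<theta>1 / \<theta>2) * f y * g y)"

definition H_norm :: "real \<Rightarrow> real \<Rightarrow> (real \<Rightarrow> real) \<Rightarrow> real" where
  "H_norm \<theta>1 \<theta>2 f = sqrt (H_inner \<theta>1 \<theta>2 f f)"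

text \<open>Elements are functions rather than almost-everywhere classes; values outside
  \<open>[0,1]\<close> are irrelevant. Integrability of the weighted square has to be required
  explicitly because the Bochner integral of a non-integrable function is \<open>0\<close>.\<close>

definition H_space :: "real \<Rightarrow> real \<Rightarrow> (real \<Rightarrow> real) set" where
  "H_space \<theta>1 \<theta>2 = {f. set_borel_measurable lborel {0..1} f \<and>
     set_integrable lborel {0..1} (\<lambda>y. exp (y * \<theta>1 / \<theta>2) * (f y)\<^sup>2)}"

text \<open>The Borel sigma-algebra of the topology induced by the (semi)norm.\<close>

definition H_borel :: "real \<Rightarrow> real \<Rightarrow> (real \<Rightarrow> real) measure" where
  "H_borel \<theta>1 \<theta>2 = sigma (H_space \<theta>1 \<theta>2)
     {U. U \<subseteq> H_space \<theta>1 \<theta>2 \<and>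
         (\<forall>f\<in>U. \<exists>\<epsilon>>0. \<forall>g\<in>H_space \<theta>1 \<theta>2. H_norm \<theta>1 \<theta>2 (\<lambda>y. g y - f y) < \<epsilon> \<longrightarrow> g \<in> U)}"

definition eigfun :: "real \<Rightarrow> real \<Rightarrow> nat \<Rightarrow> real \<Rightarrow> real" where
  "eigfun \<theta>1 \<theta>2 k y = sqrt 2 * sin (pi * real k * y) * exp (- (\<theta>1 / (2 * \<theta>2)) * y)"

definition eigval :: "real \<Rightarrow> real \<Rightarrow> real \<Rightarrow> nat \<Rightarrow> real" where
  "eigval \<theta>0 \<theta>1 \<theta>2 k = - \<theta>0 + \<theta>1\<^sup>2 / (4 * \<theta>2) + pi\<^sup>2 * (real k)\<^sup>2 * \<theta>2"

definition H_coeff :: "real \<Rightarrow> real \<Rightarrow> (real \<Rightarrow> real) \<Rightarrow> nat \<Rightarrow> real" where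
  "H_coeff \<theta>1 \<theta>2 f k = H_inner \<theta>1 \<theta>2 f (eigfun \<theta>1 \<theta>2 k)"

subsection \<open>Brownian motion and the Wiener integral\<close>

definition brownian_motion :: "'w measure \<Rightarrow> (real \<Rightarrow> 'w \<Rightarrow> real) \<Rightarrow> bool" where
  "brownian_motion M W \<longleftrightarrow>
     (\<forall>t\<ge>0. W t \<in> borel_measurable M) \<and>
     (AE \<omega> in M. W 0 \<omega> = 0) \<and>
     (\<forall>s t. 0 \<le> s \<and> s < t \<longrightarrow>
        distributed M lborel (\<lambda>\<omega>. W t \<omega> - W s \<omega>) (normal_density 0 (sqrt (t - s)))) \<and>
     (\<forall>m (\<tau> :: nat \<Rightarrow> real). 0 \<le> \<tau> 0 \<and> (\<forall>j<m. \<tau> j \<le> \<tau> (Suc j)) \<longrightarrow>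
        prob_space.indep_vars M (\<lambda>_. borel)
          (\<lambda>j \<omega>. W (\<tau> (Suc j)) \<omega> - W (\<tau> j) \<omega>) {..<m}) \<and>
     (AE \<omega> in M. continuous_on {0..} (\<lambda>t. W t \<omega>))"

definition is_partition :: "real \<Rightarrow> nat \<Rightarrow> (nat \<Rightarrow> real) \<Rightarrow> bool" where
  "is_partition t m \<tau> \<longleftrightarrow> \<tau> 0 = 0 \<and> \<tau> m = t \<and> (\<forall>j<m. \<tau> j \<le> \<tau> (Suc j))"

definition step_fun :: "nat \<Rightarrow> (nat \<Rightarrow> real) \<Rightarrow> (nat \<Rightarrow> real) \<Rightarrow> real \<Rightarrow> real" where
  "step_fun m \<tau> c s = (\<Sum>j<m. c j * indicator {\<tau> j<..\<tau> (Suc j)} s)"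

definition step_integral ::
  "(real \<Rightarrow> 'w \<Rightarrow> real) \<Rightarrow> nat \<Rightarrow> (nat \<Rightarrow> real) \<Rightarrow> (nat \<Rightarrow> real) \<Rightarrow> 'w \<Rightarrow> real" where
  "step_integral W m \<tau> c \<omega> = (\<Sum>j<m. c j * (W (\<tau> (Suc j)) \<omega> - W (\<tau> j) \<omega>))"

text \<open>\<open>J\<close> is a version of the stochastic integral over \<open>[0,t]\<close> of the deterministic
  function \<open>f\<close> against \<open>W\<close>: the mean-square limit of the integrals of step functions that
  converge to \<open>f\<close> in \<open>L\<^sup>2([0,t])\<close>. By the Ito isometry \<open>J\<close> is unique up to null sets and
  does not depend on the approximating sequence.\<close>

definition is_wiener_integral ::
  "'w measure \<Rightarrow> (real \<Rightarrow> 'w \<Rightarrow> real) \<Rightarrow> real \<Rightarrow> (real \<Rightarrow> real) \<Rightarrow> ('w \<Rightarrow> real) \<Rightarrow> bool" where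
  "is_wiener_integral M W t f J \<longleftrightarrow> J \<in> borel_measurable M \<and>
     (\<exists>m \<tau> c. (\<forall>p::nat. is_partition t (m p) (\<tau> p)) \<and>
        (\<lambda>p. \<integral>\<^sup>+s\<in>{0..t}. ennreal ((f s - step_fun (m p) (\<tau> p) (c p) s)\<^sup>2) \<partial>lborel)
          \<longlonglongrightarrow> 0 \<and>
        (\<lambda>p. \<integral>\<^sup>+\<omega>. ennreal ((J \<omega> - step_integral W (m p) (\<tau> p) (c p) \<omega>)\<^sup>2) \<partial>M)
          \<longlonglongrightarrow> 0)"

subsection \<open>The model\<close>

text \<open>Here \<open>k\<close> ranges over the integers \<open>\<ge> 1\<close>; \<open>W 0\<close> is unused.\<close>

definition driving_noise ::
  "'w measure \<Rightarrow> real \<Rightarrow> real \<Rightarrow> (nat \<Rightarrow> real \<Rightarrow> 'w \<Rightarrow> real) \<Rightarrow> ('w \<Rightarrow> real \<Rightarrow> real) \<Rightarrow> bool" where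
  "driving_noise M \<theta>1 \<theta>2 W \<xi> \<longleftrightarrow>
     (\<forall>k\<ge>1. brownian_motion M (W k)) \<and>
     prob_space.indep_vars M (\<lambda>_. PiM {0..} (\<lambda>_. borel))
       (\<lambda>k \<omega>. restrict (\<lambda>t. W k t \<omega>) {0..}) {1..} \<and>
     \<xi> \<in> measurable M (H_borel \<theta>1 \<theta>2) \<and>
     prob_space.indep_set M
       (sets (vimage_algebra (space M) \<xi> (H_borel \<theta>1 \<theta>2)))
       (sets (vimage_algebra (space M)
          (\<lambda>\<omega>. restrict (\<lambda>(k, t). W k t \<omega>) ({1..} \<times> {0..}))
          (PiM ({1..} \<times> {0..}) (\<lambda>_. borel))))"

text \<open>\<open>J k t\<close> is the stochastic convolution in the \<open>k\<close>-th coordinate, so that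
  \<open>exp (- \<lambda>\<^sub>k t) \<langle>\<xi>, e\<^sub>k\<rangle> + J k t\<close> is the coordinate process \<open>x\<^sub>k\<close>. The last clause
  selects the time-space continuous version.\<close>

definition mild_solution ::
  "'w measure \<Rightarrow> real \<Rightarrow> real \<Rightarrow> real \<Rightarrow> real \<Rightarrow> (nat \<Rightarrow> real \<Rightarrow> 'w \<Rightarrow> real) \<Rightarrow>
   ('w \<Rightarrow> real \<Rightarrow> real) \<Rightarrow> (real \<Rightarrow> real \<Rightarrow> 'w \<Rightarrow> real) \<Rightarrow> bool" where
  "mild_solution M \<theta>0 \<theta>1 \<theta>2 \<sigma> W \<xi> X \<longleftrightarrow>
     (\<forall>t\<ge>0. \<forall>y\<in>{0..1}. X t y \<in> borel_measurable M) \<and>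
     (\<exists>J. (\<forall>k\<ge>1. \<forall>t\<ge>0. is_wiener_integral M (W k) t
               (\<lambda>s. exp (- eigval \<theta>0 \<theta>1 \<theta>2 k * (t - s)) * \<sigma>) (J k t)) \<and>
          (\<forall>t\<ge>0. \<forall>y\<in>{0..1}. AE \<omega> in M.
             (\<lambda>j. let k = Suc j in
                (exp (- eigval \<theta>0 \<theta>1 \<theta>2 k * t) * H_coeff \<theta>1 \<theta>2 (\<xi> \<omega>) k + J k t \<omega>)
                  * eigfun \<theta>1 \<theta>2 k y) sums X t y \<omega>)) \<and>
     (AE \<omega> in M. continuous_on ({0..} \<times> {0..1}) (\<lambda>(t, y). X t y \<omega>))"

text \<open>Second moments are taken as extended nonnegative integrals. Since \<open>ennreal\<close> maps
  negative reals to \<open>0\<close>, the (at most finitely many) modes with \<open>\<lambda>\<^sub>k \<le> 0\<close> do not contribute to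
  either bound; in the first alternative such modes cannot affect finiteness of the supremum, and
  in the second this is the weakest reading of \<open>E \<parallel>A\<^sup>1\<^sup>/\<^sup>2 \<xi>\<parallel>\<^sup>2 < \<infinity>\<close>, with
  \<open>\<parallel>A\<^sup>1\<^sup>/\<^sup>2 \<xi>\<parallel>\<^sup>2 = (\<Sum>k\<ge>1. \<lambda>\<^sub>k \<langle>\<xi>, e\<^sub>k\<rangle>\<^sup>2)\<close>. If all \<open>\<lambda>\<^sub>k\<close> are positive nothing is cut off.\<close>

definition initial_condition ::
  "'w measure \<Rightarrow> real \<Rightarrow> real \<Rightarrow> real \<Rightarrow> ('w \<Rightarrow> real \<Rightarrow> real) \<Rightarrow> bool" where
  "initial_condition M \<theta>0 \<theta>1 \<theta>2 \<xi> \<longleftrightarrow>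
     ((\<forall>k\<ge>1. integrable M (\<lambda>\<omega>. H_coeff \<theta>1 \<theta>2 (\<xi> \<omega>) k) \<and>
              (\<integral>\<omega>. H_coeff \<theta>1 \<theta>2 (\<xi> \<omega>) k \<partial>M) = 0) \<and>
      (SUP k\<in>{1..}. ennreal (eigval \<theta>0 \<theta>1 \<theta>2 k) *
         (\<integral>\<^sup>+\<omega>. ennreal ((H_coeff \<theta>1 \<theta>2 (\<xi> \<omega>) k)\<^sup>2) \<partial>M)) < \<infinity>
      \<or>
      (\<integral>\<^sup>+\<omega>. (\<Sum>j. ennreal (eigval \<theta>0 \<theta>1 \<theta>2 (Suc j) *
         (H_coeff \<theta>1 \<theta>2 (\<xi> \<omega>) (Suc j))\<^sup>2)) \<partial>M) < \<infinity>) \<and>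
     prob_space.indep_vars M (\<lambda>_. borel) (\<lambda>k \<omega>. H_coeff \<theta>1 \<theta>2 (\<xi> \<omega>) k) {1..}"

subsection \<open>The estimator and its limit law\<close>

definition mesh :: "nat \<Rightarrow> real" where
  "mesh n = 1 / real n"

definition increment ::
  "(real \<Rightarrow> real \<Rightarrow> 'w \<Rightarrow> real) \<Rightarrow> nat \<Rightarrow> nat \<Rightarrow> real \<Rightarrow> 'w \<Rightarrow> real" where
  "increment X n i y \<omega> = X (real i * mesh n) y \<omega> - X ((real i - 1) * mesh n) y \<omega>"

definition sigma2_hat ::
  "real \<Rightarrow> real \<Rightarrow> (real \<Rightarrow> real \<Rightarrow> 'w \<Rightarrow> real) \<Rightarrow> nat \<Rightarrow> real \<Rightarrow> 'w \<Rightarrow> real" where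
  "sigma2_hat \<theta>1 \<theta>2 X n y \<omega> = sqrt (pi * \<theta>2) / (real n * sqrt (mesh n)) *
     (\<Sum>i=1..n. (increment X n i y \<omega>)\<^sup>2 * exp (y * \<theta>1 / \<theta>2))"

definition I_const :: "nat \<Rightarrow> real" where
  "I_const r = 2 * sqrt (real r + 1) - sqrt (real r + 2) - sqrt (real r)"

definition Gamma_const :: real where
  "Gamma_const = 1 / pi * (\<Sum>r. (I_const r)\<^sup>2) + 2 / pi"

text \<open>The normal law with mean \<open>\<mu>\<close> and \<^emph>\<open>variance\<close> \<open>v\<close>, a point mass if \<open>v = 0\<close>.
  (\<^const>\<open>normal_density\<close> is parametrised by the standard deviation.)\<close>

definition normal_law :: "real \<Rightarrow> real \<Rightarrow> real measure" where
  "normal_law \<mu> v =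
     (if v = 0 then return borel \<mu> else density lborel (normal_density \<mu> (sqrt v)))"

end

(* Write y-normalised increments as Delta_i = Z_i + A_i, where Z comes from the stochastic convolutions
   and A from the initial value.  Z is a centred Gaussian vector whose covariance is, up to a factor, the
   sum of a Toeplitz part D(|i - j|) and a Hankel part D(i + j + 1), D being a second difference of
   G(x) = sum_k 2 sin^2(pi k y) (1 - exp(-lambda_k x)) / lambda_k.  Because the heat kernel on the diagonal
   is 1 / (2 sqrt(pi theta_2 u)) + O(sqrt u), one has G(x) = sqrt(x / (pi theta_2)) + O(x^(3/2)), and this is
   precise enough for the bias; monotonicity of the second differences of 1 - exp(-lambda x) bounds the row
   sums of the covariance matrix C.

   If N is a standard normal vector, |Z|^2 and N^T C N have the same Laplace transform, hence the same law.
   Gaussian integration by parts turns M(t) = E[N N^T exp(i t N^T C N)] into M = phi + 2 i t C M, so the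
   centred characteristic function satisfies phi' = -2 t tr(C^2) phi + O(t^2 tr(C^3)): the limit is normal
   as soon as the row sums of C tend to 0 and tr(C^2) converges.

   The initial value only enters through second moments of order 1 / lambda_k.  In the cross term
   sum_i A_i Z_i one sums over modes and applies Cauchy-Schwarz mode by mode, the first increment being
   treated separately. *)

theory Submission
  imports Defs "HOL-Real_Asymp.Real_Asymp"
begin

section \<open>Quadratic forms in Gaussian vectors\<close>

text \<open>The cross term is the delicate point. The squares of the A_i add up to order n^(-1/2),
  those of the Z_i to order n^(1/2), so Cauchy-Schwarz over i only gives O(1). The row sums help:
  sum b_i Z_i has second moment at most const n^(-1/2) |b|^2. So a mode of rate lambda contributes
  order n^(-3/4) exp(-lambda/n), and about sqrt n modes are active, leaving n^(-1/4). The first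
  increment lacks the factor exp(-lambda/n).

  Finitely many rates lambda_k may be negative or zero, and second moments of these initial
  coefficients need not be controlled. The estimates therefore split at an index K0: low modes
  perturb the covariances by O(n^(-2)) per lag, and their initial coefficients are handled path by
  path.

  Origin of the variance: with s = sqrt(pi theta_2) the centred characteristic function tends to
  exp(-t^2 s^2 lim tr(C^2)), so the variance is 2 s^2 lim tr(C^2). The diagonal of C contributes 2
  sigma^4, the pairs at lag r + 1 contribute I(r)^2 sigma^4.\<close>

lemma integrable_std_normal_abs_power:
  "integrable std_normal_distribution (\<lambda>x. \<bar>x\<bar> ^ k)"
  by (subst integrable_density) (auto simp: integrable_std_normal_moment_abs)

lemma std_normal_density_times_abs_power_tendsto:
  "((\<lambda>x. std_normal_density x * \<bar>x\<bar> ^ k) \<longlongrightarrow> 0) at_top"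
  unfolding std_normal_density_def by real_asymp

text \<open>Stein's identity E[u f(u)] = E[f'(u)] for f(u) = (p + q u) exp(i (\<alpha> u^2 + \<beta>
  u + \<gamma>)). A quadratic form in a Gaussian vector has such a phase in each single coordinate,
  and the linear prefactor accommodates a second factor x_j, whether or not j is that
  coordinate.\<close>

lemma stein_quadratic_phase:
  fixes p q \<alpha> \<beta> \<gamma> :: real
  defines "E \<equiv> \<lambda>u. iexp (\<alpha> * u\<^sup>2 + \<beta> * u + \<gamma>)"
  shows "(CLINT u|std_normal_distribution. of_real (u * (p + q * u)) * E u) =
     (CLINT u|std_normal_distribution.
        (of_real q + \<i> * of_real ((p + q * u) * (2 * \<alpha> * u + \<beta>))) * E u)"
proof -
  let ?N = std_normal_distribution
  define A where "A = (\<lambda>u. of_real (u * (p + q * u)) * E u)"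
  define B where "B = (\<lambda>u. (of_real q + \<i> * of_real ((p + q * u) * (2 * \<alpha> * u + \<beta>))) * E u)"
  \<comment> \<open>The derivative of \<open>\<Phi>\<close> is the density times
    \<open>B u - A u\<close>, and \<open>\<Phi>\<close> vanishes at both ends of the line; so the
    integrals of \<open>A\<close> and \<open>B\<close> coincide.\<close>
  define \<Phi> where "\<Phi> = (\<lambda>u. std_normal_density u *\<^sub>R (of_real (p + q * u) * E u))"
  have [measurable]: "E \<in> borel_measurable borel" unfolding E_def by measurable
  have nE: "norm (E u) = 1" for u unfolding E_def by simp
  have [measurable]: "A \<in> borel_measurable borel" "B \<in> borel_measurable borel"
    unfolding A_def B_def by measurable
  have intA: "integrable ?N A"
  proof (rule Bochner_Integration.integrable_bound)
    show "integrable ?N (\<lambda>u. \<bar>p\<bar> * \<bar>u\<bar>^1 + \<bar>q\<bar> * \<bar>u\<bar>^2)"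
      using integrable_std_normal_abs_power[of 1] integrable_std_normal_abs_power[of 2]
      by (intro Bochner_Integration.integrable_add integrable_mult_right) auto
    have "\<bar>u * (p + q * u)\<bar> \<le> \<bar>p\<bar> * \<bar>u\<bar> ^ 1 + \<bar>q\<bar> * u\<^sup>2" for u
    proof -
      have "\<bar>u * (p + q * u)\<bar> = \<bar>p * u + q * u\<^sup>2\<bar>"
        by (simp add: algebra_simps power2_eq_square)
      also have "\<dots> \<le> \<bar>p * u\<bar> + \<bar>q * u\<^sup>2\<bar>" by (rule abs_triangle_ineq)
      finally show ?thesis by (simp add: abs_mult)
    qed
    then show "AE u in ?N. norm (A u) \<le> norm (\<bar>p\<bar> * \<bar>u\<bar>^1 + \<bar>q\<bar> * \<bar>u\<bar>^2)"
      by (auto simp: A_def norm_mult nE simp del: of_real_mult of_real_add)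
  qed simp
  have intB: "integrable ?N B"
  proof (rule Bochner_Integration.integrable_bound)
    let ?b = "\<lambda>u::real. \<bar>q\<bar> * \<bar>u\<bar>^0 + (\<bar>p*\<beta>\<bar> * \<bar>u\<bar>^0 + \<bar>2*\<alpha>*p+q*\<beta>\<bar> * \<bar>u\<bar>^1 + \<bar>2*\<alpha>*q\<bar> * \<bar>u\<bar>^2)"
    show "integrable ?N ?b"
      using integrable_std_normal_abs_power[of 1] integrable_std_normal_abs_power[of 2]
        integrable_std_normal_abs_power[of 0]
      by (intro Bochner_Integration.integrable_add integrable_mult_right) auto
    have b: "norm (of_real q + \<i> * of_real ((p + q * u) * (2 * \<alpha> * u + \<beta>))) \<le> ?b u" for u
    proof -
      have "norm (of_real q + \<i> * of_real ((p + q * u) * (2 * \<alpha> * u + \<beta>))) \<le>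
        norm (of_real q :: complex) + norm (\<i> * of_real ((p + q * u) * (2 * \<alpha> * u + \<beta>)))"
        by (rule norm_triangle_ineq)
      also have "\<dots> = \<bar>q\<bar> + \<bar>(p + q * u) * (2 * \<alpha> * u + \<beta>)\<bar>"
        by (simp add: norm_mult del: of_real_mult of_real_add)
      also have "\<bar>(p + q * u) * (2 * \<alpha> * u + \<beta>)\<bar> = \<bar>p * \<beta> + ((2*\<alpha>*p+q*\<beta>) * u + (2*\<alpha>*q) * u^2)\<bar>"
        by (simp add: algebra_simps power2_eq_square)
      also have "\<dots> \<le> \<bar>p * \<beta>\<bar> + (\<bar>(2*\<alpha>*p+q*\<beta>) * u\<bar> + \<bar>(2*\<alpha>*q) * u^2\<bar>)" by linarith
      finally show ?thesis by (simp add: abs_mult power_abs del: of_real_mult of_real_add)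
    qed
    then have "norm (B u) \<le> ?b u" for u
      unfolding B_def norm_mult nE mult_1_right by simp
    then show "AE u in ?N. norm (B u) \<le> norm (?b u)"
      by (intro AE_I2) (smt (verit, best) real_norm_def)
  qed simp
  have der: "(\<Phi> has_vector_derivative (std_normal_density u *\<^sub>R (B u - A u))) (at u)" for u
  proof -
    have 1: "(std_normal_density has_real_derivative (- u * std_normal_density u)) (at u)"
      unfolding std_normal_density_def
      by (auto intro!: derivative_eq_intros simp: field_simps)
    have 2: "(E has_vector_derivative (\<i> * of_real (2 * \<alpha> * u + \<beta>) * E u)) (at u)"
    proof -
      have p: "((\<lambda>u. \<alpha> * u\<^sup>2 + \<beta> * u + \<gamma>) has_vector_derivative (2 * \<alpha> * u + \<beta>)) (at u)"
        unfolding has_real_derivative_iff_has_vector_derivative[symmetric]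
        by (auto intro!: derivative_eq_intros simp: field_simps)
      from vector_diff_chain_at[OF p has_vector_derivative_iexp]
      show ?thesis by (simp add: E_def o_def scaleR_conv_of_real mult_ac)
    qed
    have 3: "((\<lambda>u. complex_of_real (p + q * u)) has_vector_derivative of_real q) (at u)"
      by (auto intro!: derivative_eq_intros)
    show ?thesis
      unfolding \<Phi>_def
      by (rule has_vector_derivative_eq_rhs[OF has_vector_derivative_scaleR[OF 1
            has_vector_derivative_mult[OF 3 2]]])
        (simp add: A_def B_def scaleR_conv_of_real algebra_simps)
  qed
  have lim: "(\<Phi> \<longlongrightarrow> 0) at_top" "(\<Phi> \<longlongrightarrow> 0) at_bot"
  proof -
    have b: "norm (\<Phi> u) \<le> \<bar>p\<bar> * (std_normal_density u * \<bar>u\<bar>^0) + \<bar>q\<bar> * (std_normal_density u * \<bar>u\<bar>^1)" for u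
    proof -
      have "norm (\<Phi> u) = std_normal_density u * \<bar>p + q * u\<bar>"
        by (simp add: \<Phi>_def norm_mult nE del: of_real_mult of_real_add)
      also have "\<dots> \<le> std_normal_density u * (\<bar>p\<bar> + \<bar>q\<bar> * \<bar>u\<bar>)"
        by (intro mult_left_mono) (auto simp: abs_mult[symmetric])
      finally show ?thesis by (simp add: algebra_simps)
    qed
    have t: "((\<lambda>u. \<bar>p\<bar> * (std_normal_density u * \<bar>u\<bar>^0) + \<bar>q\<bar> * (std_normal_density u * \<bar>u\<bar>^1)) \<longlongrightarrow> 0) at_top"
      using std_normal_density_times_abs_power_tendsto[of 0] std_normal_density_times_abs_power_tendsto[of 1]
      by (intro tendsto_add_zero tendsto_mult_right_zero) auto
    show "(\<Phi> \<longlongrightarrow> 0) at_top"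
      by (rule Lim_null_comparison[OF _ t]) (use b in auto)
    have t': "((\<lambda>u. \<bar>p\<bar> * (std_normal_density u * \<bar>u\<bar>^0) + \<bar>q\<bar> * (std_normal_density u * \<bar>u\<bar>^1)) \<longlongrightarrow> 0) at_bot"
      using t by (simp add: filterlim_at_bot_mirror std_normal_density_def)
    show "(\<Phi> \<longlongrightarrow> 0) at_bot"
      by (rule Lim_null_comparison[OF _ t']) (use b in auto)
  qed
  define g where "g = (\<lambda>u. std_normal_density u *\<^sub>R (B u - A u))"
  have int: "integrable lborel g"
    unfolding g_def
    by (rule integrable_density[THEN iffD1, rotated 3, OF Bochner_Integration.integrable_diff[OF intB intA]]) auto
  have "interval_lebesgue_integral lborel (-(\<infinity>::ereal)) (\<infinity>::ereal) g = (0::complex) - (0::complex)"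
  proof (rule interval_integral_FTC_integrable[where F = \<Phi>])
    have "isCont E u" for u
      unfolding E_def by (rule isCont_o2[OF _ isCont_iexp]) simp
    moreover have "isCont std_normal_density u" for u
      unfolding std_normal_density_def by simp
    ultimately show "isCont g u" for u
      unfolding g_def A_def B_def by simp
    show "set_integrable lborel (einterval (-\<infinity>) \<infinity>) g"
      using int by (simp add: set_integrable_def)
    show "((\<Phi> \<circ> real_of_ereal) \<longlongrightarrow> 0) (at_right (-\<infinity>))" "((\<Phi> \<circ> real_of_ereal) \<longlongrightarrow> 0) (at_left \<infinity>)"
      using lim by (simp_all add: ereal_tendsto_simps)
  qed (simp_all add: der g_def)
  then have "integral\<^sup>L lborel g = 0"
    by (simp add: interval_lebesgue_integral_def set_lebesgue_integral_def)
  then have "(CLINT u|?N. B u - A u) = 0"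
    by (subst integral_density) (auto simp: g_def)
  then have "integral\<^sup>L ?N A = integral\<^sup>L ?N B"
    using intA intB by simp
  then show ?thesis unfolding A_def B_def .
qed

section \<open>Gaussian integration by parts for quadratic phases in several variables\<close>

definition quad_form :: "'i set \<Rightarrow> ('i \<Rightarrow> 'i \<Rightarrow> real) \<Rightarrow> ('i \<Rightarrow> real) \<Rightarrow> real" where
  "quad_form I C x = (\<Sum>i\<in>I. \<Sum>j\<in>I. C i j * x i * x j)"

abbreviation gauss_PiM :: "'i set \<Rightarrow> ('i \<Rightarrow> real) measure" where
  "gauss_PiM I \<equiv> Pi\<^sub>M I (\<lambda>_. std_normal_distribution)"

lemma prob_space_std_normal: "prob_space std_normal_distribution"
  by (rule prob_space_normal_density) simp

lemma product_sigma_finite_std_normal: "product_sigma_finite (\<lambda>_. std_normal_distribution)"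
  by (simp add: product_sigma_finite_def prob_space_imp_sigma_finite prob_space_std_normal)

lemma prob_space_gauss: "prob_space (gauss_PiM I)"
  by (rule prob_space_PiM) (simp add: prob_space_std_normal)

lemma integrable_gauss_component:
  assumes "i \<in> I" and "integrable std_normal_distribution f"
  shows "integrable (gauss_PiM I) (\<lambda>x. f (x i) :: real)"
proof -
  have "integrable (distr (gauss_PiM I) std_normal_distribution (\<lambda>x. x i)) f"
    using assms by (subst distr_PiM_component) (auto simp: prob_space_std_normal)
  then show ?thesis
    using assms by (subst (asm) integrable_distr_eq) auto
qed

lemma measurable_gauss_component:
  "i \<in> I \<Longrightarrow> (\<lambda>x. x i) \<in> borel_measurable (gauss_PiM I)"
  using measurable_component_singleton[of i I "\<lambda>_. std_normal_distribution"]
    measurable_cong_sets[of "gauss_PiM I" "gauss_PiM I" std_normal_distribution borel]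
  by simp

lemma borel_measurable_quad_form [measurable]:
  "quad_form I C \<in> borel_measurable (gauss_PiM I)"
  unfolding quad_form_def by measurable

lemma integrable_gauss_mult:
  assumes "i \<in> I" "j \<in> I"
  shows "integrable (gauss_PiM I) (\<lambda>x. x i * x j)"
proof (rule Bochner_Integration.integrable_bound)
  show "integrable (gauss_PiM I) (\<lambda>x. \<bar>x i\<bar>^2 + \<bar>x j\<bar>^2)"
    using assms integrable_std_normal_abs_power[of 2]
    by (intro Bochner_Integration.integrable_add integrable_gauss_component[where f = "\<lambda>x. \<bar>x\<bar>^2"]) auto
  have "\<bar>a * b\<bar> \<le> a\<^sup>2 + b\<^sup>2" for a b :: real
    using sum_squares_bound[of "\<bar>a\<bar>" "\<bar>b\<bar>"] mult_nonneg_nonneg[OF abs_ge_zero abs_ge_zero, of a b]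
    unfolding abs_mult power2_abs by linarith
  then show "AE x in gauss_PiM I. norm (x i * x j) \<le> norm (\<bar>x i\<bar>^2 + \<bar>x j\<bar>^2)"
    by simp
qed (use assms in measurable)

lemma integrable_mult_iexp:
  assumes "integrable M f" and [measurable]: "g \<in> borel_measurable M"
  shows "integrable M (\<lambda>x. complex_of_real (f x) * iexp (g x))"
proof (rule Bochner_Integration.integrable_bound)
  show "integrable M (\<lambda>x. complex_of_real (f x))" using assms(1) by (rule integrable_of_real)
  have [measurable]: "f \<in> borel_measurable M" using assms(1) by (rule borel_measurable_integrable)
  show "(\<lambda>x. complex_of_real (f x) * iexp (g x)) \<in> borel_measurable M" by measurable
  show "AE x in M. norm (complex_of_real (f x) * iexp (g x)) \<le> norm (complex_of_real (f x))"
    by (intro AE_I2) (simp only: norm_mult norm_exp_i_times mult_1_right order_refl)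
qed

text \<open>The entries of the matrix M(t) = E[N N^T exp(i t N^T C N)].\<close>

definition gauss_moment :: "'i set \<Rightarrow> ('i \<Rightarrow> 'i \<Rightarrow> real) \<Rightarrow> real \<Rightarrow> 'i \<Rightarrow> 'i \<Rightarrow> complex" where
  "gauss_moment I C t i j =
     (CLINT x|gauss_PiM I. of_real (x i * x j) * iexp (t * quad_form I C x))"

definition gauss_phase :: "'i set \<Rightarrow> ('i \<Rightarrow> 'i \<Rightarrow> real) \<Rightarrow> real \<Rightarrow> complex" where
  "gauss_phase I C t = (CLINT x|gauss_PiM I. iexp (t * quad_form I C x))"

text \<open>Isolates the dependence on one coordinate, so that the one-dimensional identity applies
  with the others frozen; symmetry merges row and column of \<open>i\<close> into the factor
  2.\<close>

lemma quad_form_upd: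
  assumes "finite J" "i \<notin> J" and sym: "\<And>a b. a \<in> insert i J \<Longrightarrow> b \<in> insert i J \<Longrightarrow> C a b = C b a"
  shows "quad_form (insert i J) C (x(i := u)) = C i i * u\<^sup>2 + 2 * (\<Sum>l\<in>J. C i l * x l) * u + quad_form J C x"
proof -
  have neq: "l \<in> J \<Longrightarrow> l \<noteq> i" for l using assms by auto
  have "quad_form (insert i J) C (x(i := u)) =
     C i i * u * u + (\<Sum>l\<in>J. C i l * u * x l) + (\<Sum>l\<in>J. C l i * x l * u + (\<Sum>m\<in>J. C l m * x l * x m))"
    unfolding quad_form_def using assms(1,2)
    by (simp add: neq cong: sum.cong)
  also have "(\<Sum>l\<in>J. C l i * x l * u + (\<Sum>m\<in>J. C l m * x l * x m)) =
     (\<Sum>l\<in>J. C i l * u * x l) + quad_form J C x"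
    unfolding sum.distrib quad_form_def
    using sym by (auto intro!: sum.cong simp: mult_ac)
  finally show ?thesis
    by (simp add: power2_eq_square algebra_simps sum_distrib_left sum_distrib_right del: fun_upd_apply)
qed

text \<open>Coordinate \<open>i\<close> is integrated out first. Differentiating the factor x_j
  gives the diagonal term; differentiating the phase gives 2 t (C x)_i and hence a row of C
  M.\<close>

lemma gauss_moment_ibp:
  assumes fin: "finite I" and ij: "i \<in> I" "j \<in> I"
    and sym: "\<And>i j. i \<in> I \<Longrightarrow> j \<in> I \<Longrightarrow> C i j = C j i"
  shows "gauss_moment I C t i j =
    (if i = j then gauss_phase I C t else 0) +
    2 * \<i> * of_real t * (\<Sum>l\<in>I. of_real (C i l) * gauss_moment I C t l j)"
proof -
  define J where "J = I - {i}"
  have I: "I = insert i J" "i \<notin> J" "finite J" using ij fin by (auto simp: J_def)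
  have sym': "C a b = C b a" if "a \<in> insert i J" "b \<in> insert i J" for a b
    by (rule sym) (use that I(1) in simp_all)
  let ?E = "\<lambda>x. iexp (t * quad_form I C x)"
  \<comment> \<open>Together with \<open>p\<close> below, this writes x_j as p + d u in the active
    coordinate u: it is u itself for j = i and a constant otherwise.\<close>
  define d :: real where "d = (if i = j then 1 else 0)"
  define h where "h x = complex_of_real d * ?E x +
      2 * \<i> * of_real t * (\<Sum>l\<in>I. of_real (C i l) * (of_real (x l * x j) * ?E x))" for x
  have int_f: "integrable (gauss_PiM I) (\<lambda>x. of_real (x l * x j) * ?E x)" if "l \<in> I" for l
    using that ij by (intro integrable_mult_iexp integrable_gauss_mult) auto
  have int_E: "integrable (gauss_PiM I) ?E"
    by (rule prob_space.integrable_iexp[OF prob_space_gauss]) auto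
  have int_h: "integrable (gauss_PiM I) h"
    unfolding h_def
    by (intro Bochner_Integration.integrable_add integrable_mult_right Bochner_Integration.integrable_sum int_E int_f)
  have inner: "(CLINT u|std_normal_distribution. of_real ((x(i:=u)) i * (x(i:=u)) j) * ?E (x(i:=u))) =
    (CLINT u|std_normal_distribution. h (x(i:=u)))" for x
  proof -
    define p where "p = (if i = j then 0 else x j)"
    define b where "b = (\<Sum>l\<in>J. C i l * x l)"
    have Q: "t * quad_form I C (x(i:=u)) = t * C i i * u\<^sup>2 + 2 * t * b * u + t * quad_form J C x" for u
    proof -
      have "quad_form (insert i J) C (x(i := u)) = C i i * u\<^sup>2 + 2 * (\<Sum>l\<in>J. C i l * x l) * u + quad_form J C x"
        by (rule quad_form_upd[OF I(3,2) sym'])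
      then show ?thesis unfolding I(1) by (simp add: b_def ring_distribs mult_ac del: fun_upd_apply)
    qed
    have xj: "(x(i:=u)) j = p + d * u" for u by (auto simp: p_def d_def)
    have lin: "(\<Sum>l\<in>I. C i l * (x(i:=u)) l) = C i i * u + b" for u
      using I by (simp add: b_def cong: sum.cong) (auto intro!: sum.cong)
    have "h (x(i:=u)) = (of_real d + \<i> * of_real ((p + d * u) * (2 * (t * C i i) * u + 2 * t * b))) * ?E (x(i:=u))" for u
    proof -
      have "h (x(i:=u)) = (of_real d + \<i> * of_real (2 * t * (\<Sum>l\<in>I. C i l * (x(i:=u)) l) * (x(i:=u)) j)) * ?E (x(i:=u))"
        unfolding h_def by (simp add: sum_distrib_left sum_distrib_right algebra_simps)
      then show ?thesis unfolding lin xj by (simp add: algebra_simps)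
    qed
    then show ?thesis
      using stein_quadratic_phase[of p d "t * C i i" "2 * t * b" "t * quad_form J C x"]
      by (simp only: Q xj fun_upd_same)
  qed
  have "gauss_moment I C t i j = (CLINT x|gauss_PiM I. h x)"
    unfolding gauss_moment_def
    using int_h int_f[OF ij(1)] inner unfolding I(1)
    by (subst (1 2) product_sigma_finite.product_integral_insert[OF product_sigma_finite_std_normal I(3,2)]) (simp_all add: mult.commute)
  also have "\<dots> = of_real d * gauss_phase I C t +
      2 * \<i> * of_real t * (\<Sum>l\<in>I. of_real (C i l) * gauss_moment I C t l j)"
    unfolding h_def gauss_phase_def gauss_moment_def using int_E int_f
    by (simp del: of_real_mult add: Bochner_Integration.integral_sum)
  finally show ?thesis by (simp add: d_def)
qed

text \<open>Differentiation under the integral: the difference quotient minus the derivative of the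
  integrand is dominated by 2 |T|.\<close>

lemma has_vector_derivative_integral_iexp:
  assumes "finite_measure M" and T: "integrable M T"
  shows "((\<lambda>t. CLINT x|M. iexp (t * T x)) has_vector_derivative
          (CLINT x|M. \<i> * of_real (T x) * iexp (t * T x))) (at t)"
proof -
  interpret M: finite_measure M by fact
  have [measurable]: "T \<in> borel_measurable M" using T by auto
  let ?D = "CLINT x|M. \<i> * of_real (T x) * iexp (t * T x)"
  let ?d = "\<lambda>h x. (iexp ((t + h) * T x) - iexp (t * T x) - h *\<^sub>R (\<i> * of_real (T x) * iexp (t * T x))) /\<^sub>R h"
  have int1: "integrable M (\<lambda>x. iexp (s * T x))" for s
    by (rule M.integrable_const_bound[where B = 1]) auto
  have int2: "integrable M (\<lambda>x. \<i> * of_real (T x) * iexp (t * T x))"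
    unfolding mult.assoc by (intro integrable_mult_right integrable_mult_iexp T) measurable
  have bd: "norm (?d h x) \<le> 2 * \<bar>T x\<bar>" if "h \<noteq> 0" for h x
  proof -
    have "norm (iexp (h * T x) - 1) \<le> \<bar>h * T x\<bar>"
      using iexp_approx1[of "h * T x" 0] by simp
    then have 1: "norm (iexp ((t + h) * T x) - iexp (t * T x)) \<le> \<bar>h\<bar> * \<bar>T x\<bar>"
    proof -
      have "iexp ((t + h) * T x) - iexp (t * T x) = iexp (t * T x) * (iexp (h * T x) - 1)"
        by (simp add: ring_distribs exp_add)
      then show ?thesis
        using \<open>norm (iexp (h * T x) - 1) \<le> \<bar>h * T x\<bar>\<close> by (simp add: norm_mult abs_mult del: of_real_mult)
    qed
    have 2: "norm (h *\<^sub>R (\<i> * of_real (T x) * iexp (t * T x))) = \<bar>h\<bar> * \<bar>T x\<bar>"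
      by (simp add: norm_mult del: of_real_mult)
    have "norm (iexp ((t + h) * T x) - iexp (t * T x) - h *\<^sub>R (\<i> * of_real (T x) * iexp (t * T x))) \<le> \<bar>h\<bar> * (2 * \<bar>T x\<bar>)"
      using norm_triangle_ineq4[of "iexp ((t + h) * T x) - iexp (t * T x)" "h *\<^sub>R (\<i> * of_real (T x) * iexp (t * T x))"] 1 2
      by linarith
    then have "\<bar>inverse h\<bar> * norm (iexp ((t + h) * T x) - iexp (t * T x) - h *\<^sub>R (\<i> * of_real (T x) * iexp (t * T x)))
      \<le> \<bar>inverse h\<bar> * (\<bar>h\<bar> * (2 * \<bar>T x\<bar>))"
      by (rule mult_left_mono) simp
    then show ?thesis using that by (simp only: norm_scaleR) (simp add: field_simps)
  qed
  have lim: "((\<lambda>h. ?d h x) \<longlongrightarrow> 0) (at 0)" for x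
  proof -
    have "((\<lambda>t. t * T x) has_vector_derivative T x) (at t)"
      by (auto intro!: derivative_eq_intros)
    from vector_diff_chain_at[OF this has_vector_derivative_iexp]
    have "((\<lambda>t. iexp (t * T x)) has_vector_derivative (\<i> * of_real (T x) * iexp (t * T x))) (at t)"
      by (simp add: o_def scaleR_conv_of_real mult_ac)
    then have "((\<lambda>h. norm (iexp ((t + h) * T x) - iexp (t * T x) - h *\<^sub>R (\<i> * of_real (T x) * iexp (t * T x))) / norm h) \<longlongrightarrow> 0) (at 0)"
      unfolding has_vector_derivative_def has_derivative_at by simp
    then show ?thesis
      by (subst tendsto_norm_zero_iff[symmetric]) (simp add: divide_inverse mult.commute)
  qed
  have "((\<lambda>h. CLINT x|M. ?d h x) \<longlongrightarrow> 0) (at 0)"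
    unfolding tendsto_at_iff_sequentially comp_def
  proof safe
    fix X :: "nat \<Rightarrow> real" assume X: "\<forall>i. X i \<in> UNIV - {0}" "X \<longlonglongrightarrow> 0"
    have "(\<lambda>i. CLINT x|M. ?d (X i) x) \<longlonglongrightarrow> (CLINT x|M. 0)"
    proof (rule integral_dominated_convergence[where w = "\<lambda>x. 2 * \<bar>T x\<bar>"])
      show "AE x in M. (\<lambda>i. ?d (X i) x) \<longlonglongrightarrow> 0"
        using lim X by (auto simp: tendsto_at_iff_sequentially comp_def)
      show "AE x in M. norm (?d (X i) x) \<le> 2 * \<bar>T x\<bar>" for i
        using bd X by auto
      show "(\<lambda>x. ?d (X i) x) \<in> borel_measurable M" for i by measurable
    qed (use T in auto)
    then show "(\<lambda>i. CLINT x|M. ?d (X i) x) \<longlonglongrightarrow> 0" by simp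
  qed
  moreover have "(CLINT x|M. ?d h x) = ((CLINT x|M. iexp ((t + h) * T x)) - (CLINT x|M. iexp (t * T x)) - h *\<^sub>R ?D) /\<^sub>R h" for h
    using int1 int2 by (simp del: of_real_mult of_real_add)
  ultimately have "((\<lambda>h. ((CLINT x|M. iexp ((t + h) * T x)) - (CLINT x|M. iexp (t * T x)) - h *\<^sub>R ?D) /\<^sub>R h) \<longlongrightarrow> 0) (at 0)"
    by (simp only:)
  then have "((\<lambda>h. norm ((CLINT x|M. iexp ((t + h) * T x)) - (CLINT x|M. iexp (t * T x)) - h *\<^sub>R ?D) / norm h) \<longlongrightarrow> 0) (at 0)"
    by (subst (asm) tendsto_norm_zero_iff[symmetric]) (simp add: divide_inverse mult.commute)
  then show ?thesis
    unfolding has_vector_derivative_def has_derivative_at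
    by (simp add: bounded_linear_scaleR_left)
qed

definition mat_mul :: "'i set \<Rightarrow> ('i \<Rightarrow> 'i \<Rightarrow> real) \<Rightarrow> ('i \<Rightarrow> 'i \<Rightarrow> real) \<Rightarrow> 'i \<Rightarrow> 'i \<Rightarrow> real" where
  "mat_mul I A B = (\<lambda>i j. \<Sum>k\<in>I. A i k * B k j)"

text \<open>x^T C^3 x = (C x)^T C (C x). Thus C^3 inherits positivity from C without
  diagonalisation, and a remainder with weight C^3 can be bounded by its trace.\<close>

lemma quad_form_mat_mul_cube:
  assumes sym: "\<And>i j. i \<in> I \<Longrightarrow> j \<in> I \<Longrightarrow> C i j = C j i"
  shows "quad_form I (mat_mul I C (mat_mul I C C)) x = quad_form I C (\<lambda>i. \<Sum>l\<in>I. C i l * x l)"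
proof -
  have "quad_form I (mat_mul I C (mat_mul I C C)) x =
    (\<Sum>i\<in>I. \<Sum>j\<in>I. \<Sum>k\<in>I. \<Sum>l\<in>I. C k l * (C i k * x i) * (C l j * x j))"
    unfolding quad_form_def mat_mul_def
    by (simp add: sum_distrib_left sum_distrib_right mult_ac)
  also have "\<dots> = (\<Sum>k\<in>I. \<Sum>l\<in>I. \<Sum>i\<in>I. \<Sum>j\<in>I. C k l * (C i k * x i) * (C l j * x j))"
  proof -
    have "(\<Sum>i\<in>I. \<Sum>j\<in>I. \<Sum>k\<in>I. \<Sum>l\<in>I. f i j k l) = (\<Sum>k\<in>I. \<Sum>l\<in>I. \<Sum>i\<in>I. \<Sum>j\<in>I. f i j k l)"
      for f :: "_ \<Rightarrow> _ \<Rightarrow> _ \<Rightarrow> _ \<Rightarrow> real"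
    proof -
      have "(\<Sum>i\<in>I. \<Sum>j\<in>I. \<Sum>k\<in>I. \<Sum>l\<in>I. f i j k l) = (\<Sum>i\<in>I. \<Sum>k\<in>I. \<Sum>j\<in>I. \<Sum>l\<in>I. f i j k l)"
        by (intro sum.cong refl sum.swap)
      also have "\<dots> = (\<Sum>k\<in>I. \<Sum>i\<in>I. \<Sum>l\<in>I. \<Sum>j\<in>I. f i j k l)"
        by (subst sum.swap) (intro sum.cong refl sum.swap)
      also have "\<dots> = (\<Sum>k\<in>I. \<Sum>l\<in>I. \<Sum>i\<in>I. \<Sum>j\<in>I. f i j k l)"
        by (intro sum.cong refl sum.swap)
      finally show ?thesis .
    qed
    then show ?thesis .
  qed
  also have "\<dots> = quad_form I C (\<lambda>i. \<Sum>l\<in>I. C i l * x l)"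
    unfolding quad_form_def
  proof (intro sum.cong refl)
    fix k l assume "k \<in> I" "l \<in> I"
    have "(\<Sum>i\<in>I. \<Sum>j\<in>I. C k l * (C i k * x i) * (C l j * x j)) =
      C k l * (\<Sum>i\<in>I. \<Sum>j\<in>I. (C i k * x i) * (C l j * x j))"
      by (simp only: sum_distrib_left mult.assoc)
    also have "\<dots> = C k l * ((\<Sum>i\<in>I. C i k * x i) * (\<Sum>j\<in>I. C l j * x j))"
      by (simp only: sum_product)
    finally have "(\<Sum>i\<in>I. \<Sum>j\<in>I. C k l * (C i k * x i) * (C l j * x j)) =
      C k l * ((\<Sum>i\<in>I. C i k * x i) * (\<Sum>j\<in>I. C l j * x j))" .
    then show "(\<Sum>i\<in>I. \<Sum>j\<in>I. C k l * (C i k * x i) * (C l j * x j)) =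
      C k l * (\<Sum>l\<in>I. C k l * x l) * (\<Sum>la\<in>I. C l la * x la)"
      using sym[OF _ \<open>k \<in> I\<close>] by (simp add: mult.assoc cong: sum.cong)
  qed
  finally show ?thesis .
qed

text \<open>The relation M = phi + 2 i t C M contracted with a matrix \<open>A\<close>. Each
  application extracts a trace and replaces \<open>A\<close> by C A at the cost of a factor
  t.\<close>

lemma gauss_trace_step:
  assumes fin: "finite I" and sym: "\<And>i j. i \<in> I \<Longrightarrow> j \<in> I \<Longrightarrow> C i j = C j i"
  shows "(\<Sum>i\<in>I. \<Sum>j\<in>I. of_real (A i j) * gauss_moment I C t i j) =
    of_real (\<Sum>i\<in>I. A i i) * gauss_phase I C t +
    2 * \<i> * of_real t * (\<Sum>i\<in>I. \<Sum>j\<in>I. of_real (mat_mul I C A i j) * gauss_moment I C t i j)"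
proof -
  let ?m = "gauss_moment I C t" and ?p = "gauss_phase I C t"
  have "(\<Sum>i\<in>I. \<Sum>j\<in>I. of_real (A i j) * ?m i j) =
    (\<Sum>i\<in>I. \<Sum>j\<in>I. (if i = j then of_real (A i j) * ?p else 0)) +
    (\<Sum>i\<in>I. \<Sum>j\<in>I. \<Sum>l\<in>I. 2 * \<i> * of_real t * (of_real (C i l) * of_real (A i j) * ?m l j))"
    unfolding sum.distrib[symmetric]
    by (intro sum.cong refl, subst gauss_moment_ibp[OF fin _ _ sym])
      (auto simp: algebra_simps sum_distrib_left)
  also have "(\<Sum>i\<in>I. \<Sum>j\<in>I. (if i = j then of_real (A i j) * ?p else 0)) = of_real (\<Sum>i\<in>I. A i i) * ?p"
    using fin by (simp add: sum_distrib_right)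
  also have "(\<Sum>i\<in>I. \<Sum>j\<in>I. \<Sum>l\<in>I. 2 * \<i> * of_real t * (of_real (C i l) * of_real (A i j) * ?m l j)) =
    (\<Sum>l\<in>I. \<Sum>j\<in>I. \<Sum>i\<in>I. 2 * \<i> * of_real t * (of_real (C i l) * of_real (A i j) * ?m l j))"
    by (subst sum.swap[of _ I I], subst (2) sum.swap, subst sum.swap[of _ I I]) (rule refl)
  also have "\<dots> = 2 * \<i> * of_real t * (\<Sum>l\<in>I. \<Sum>j\<in>I. of_real (mat_mul I C A l j) * ?m l j)"
    unfolding mat_mul_def using sym
    by (simp add: sum_distrib_left sum_distrib_right mult_ac cong: sum.cong)
  finally show ?thesis .
qed

lemma integral_quad_form_iexp:
  assumes "finite I"
  shows "(CLINT x|gauss_PiM I. of_real (quad_form I A x) * iexp (t * quad_form I C x)) =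
    (\<Sum>i\<in>I. \<Sum>j\<in>I. of_real (A i j) * gauss_moment I C t i j)"
proof -
  have "(CLINT x|gauss_PiM I. of_real (quad_form I A x) * iexp (t * quad_form I C x)) =
    (CLINT x|gauss_PiM I. (\<Sum>i\<in>I. \<Sum>j\<in>I. of_real (A i j) * (of_real (x i * x j) * iexp (t * quad_form I C x))))"
    by (rule Bochner_Integration.integral_cong)
      (simp_all add: quad_form_def[of I A] sum_distrib_left sum_distrib_right mult_ac)
  also have "\<dots> = (\<Sum>i\<in>I. \<Sum>j\<in>I. of_real (A i j) * gauss_moment I C t i j)"
    unfolding gauss_moment_def
    by (subst Bochner_Integration.integral_sum, simp_all del: of_real_mult
         add: integrable_mult_iexp integrable_gauss_mult Bochner_Integration.integral_sum)
  finally show ?thesis .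
qed

lemma integrable_quad_form: "integrable (gauss_PiM I) (quad_form I A)"
  unfolding quad_form_def mult.assoc
  by (intro Bochner_Integration.integrable_sum integrable_mult_right integrable_gauss_mult)

text \<open>With C = 0 and t = 0 the trace step has phase 1 and no remainder.\<close>

lemma integral_quad_form:
  assumes fin: "finite I"
  shows "(\<integral>x. quad_form I A x \<partial>gauss_PiM I) = (\<Sum>i\<in>I. A i i)"
proof -
  have "gauss_phase I (\<lambda>_ _. 0) 0 = 1"
    by (simp add: gauss_phase_def prob_space.prob_space[OF prob_space_gauss])
  then have "complex_of_real (\<integral>x. quad_form I A x \<partial>gauss_PiM I) = of_real (\<Sum>i\<in>I. A i i)"
    using integral_quad_form_iexp[OF fin, of A 0 "\<lambda>_ _. 0"] gauss_trace_step[OF fin, of "\<lambda>_ _. 0" A 0]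
    by simp
  then show ?thesis by (simp only: of_real_eq_iff)
qed

text \<open>Two trace steps, from C and from C^2, give phi' = i tr(C) phi - 2 t tr(C^2) phi - 4 i
  t^2 R with R weighted by C^3. The integrating factor in \<open>\<psi>\<close> removes the first
  two terms, and the mean value inequality controls what is left; the weight exp(t^2 tr(C^2)) that
  it produces cancels at the end.\<close>

lemma gauss_phase_bound:
  fixes C :: "'i \<Rightarrow> 'i \<Rightarrow> real" and t \<rho> :: real
  assumes fin: "finite I"
    and sym: "\<And>i j. i \<in> I \<Longrightarrow> j \<in> I \<Longrightarrow> C i j = C j i"
    and psd: "\<And>x. 0 \<le> quad_form I C x"
    and row: "\<And>i. i \<in> I \<Longrightarrow> (\<Sum>j\<in>I. \<bar>C i j\<bar>) \<le> \<rho>"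
  shows "norm (iexp (- t * (\<Sum>i\<in>I. C i i)) * gauss_phase I C t - of_real (exp (- t\<^sup>2 * (\<Sum>i\<in>I. \<Sum>j\<in>I. (C i j)\<^sup>2))))
     \<le> 4 * \<bar>t\<bar>^3 * (\<rho> * (\<Sum>i\<in>I. \<Sum>j\<in>I. (C i j)\<^sup>2))"
proof -
  define tr where "tr = (\<Sum>i\<in>I. C i i)"
  define \<tau> where "\<tau> = (\<Sum>i\<in>I. \<Sum>j\<in>I. (C i j)\<^sup>2)"
  define C3 where "C3 = mat_mul I C (mat_mul I C C)"
  define K where "K = (\<Sum>i\<in>I. C3 i i)"
  define R where "R t = (\<Sum>i\<in>I. \<Sum>j\<in>I. of_real (C3 i j) * gauss_moment I C t i j)" for t
  define \<psi> where "\<psi> t = of_real (exp (t\<^sup>2 * \<tau>)) * (iexp (- t * tr) * gauss_phase I C t)" for t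
  have tr2: "(\<Sum>i\<in>I. mat_mul I C C i i) = \<tau>"
    unfolding \<tau>_def mat_mul_def using sym by (simp add: power2_eq_square cong: sum.cong)
  have R_bound: "norm (R t) \<le> K" for t
  proof -
    have "norm (R t) \<le> (\<integral>x. norm (of_real (quad_form I C3 x) * iexp (t * quad_form I C x)) \<partial>gauss_PiM I)"
      unfolding R_def integral_quad_form_iexp[OF fin, symmetric] by (rule integral_norm_bound)
    also have "\<dots> = (\<integral>x. quad_form I C3 x \<partial>gauss_PiM I)"
      using psd by (intro Bochner_Integration.integral_cong refl)
        (simp add: norm_mult C3_def quad_form_mat_mul_cube[OF sym] del: of_real_mult)
    finally show ?thesis by (simp add: integral_quad_form[OF fin] K_def)
  qed
  \<comment> \<open>The arithmetic-geometric mean inequality on two of the three factors in tr(C^3)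
    leaves one absolute row sum, bounded by \<open>\<rho>\<close>, and a sum of squared
    entries.\<close>
  have K_bound: "K \<le> \<rho> * \<tau>"
  proof -
    have "K = (\<Sum>i\<in>I. \<Sum>k\<in>I. \<Sum>l\<in>I. C i k * (C k l * C l i))"
      unfolding K_def C3_def mat_mul_def by (simp add: sum_distrib_left)
    also have "\<dots> \<le> (\<Sum>i\<in>I. \<Sum>k\<in>I. \<Sum>l\<in>I. \<bar>C i k\<bar> * ((C k l)\<^sup>2 + (C i l)\<^sup>2) / 2)"
    proof (intro sum_mono)
      fix i k l assume "i \<in> I" "k \<in> I" "l \<in> I"
      have "C i k * (C k l * C l i) \<le> \<bar>C i k\<bar> * (\<bar>C k l\<bar> * \<bar>C i l\<bar>)"
        using sym[OF \<open>l \<in> I\<close> \<open>i \<in> I\<close>] by (simp add: abs_mult[symmetric])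
      also have "\<dots> \<le> \<bar>C i k\<bar> * (((C k l)\<^sup>2 + (C i l)\<^sup>2) / 2)"
        using sum_squares_bound[of "\<bar>C k l\<bar>" "\<bar>C i l\<bar>"] by (intro mult_left_mono) auto
      finally show "C i k * (C k l * C l i) \<le> \<bar>C i k\<bar> * ((C k l)\<^sup>2 + (C i l)\<^sup>2) / 2" by simp
    qed
    also have "\<dots> = ((\<Sum>i\<in>I. \<Sum>k\<in>I. \<Sum>l\<in>I. \<bar>C i k\<bar> * (C k l)\<^sup>2) + (\<Sum>i\<in>I. \<Sum>k\<in>I. \<Sum>l\<in>I. \<bar>C i k\<bar> * (C i l)\<^sup>2)) / 2"
      unfolding sum.distrib[symmetric] sum_divide_distrib by (simp add: algebra_simps)
    also have "(\<Sum>i\<in>I. \<Sum>k\<in>I. \<Sum>l\<in>I. \<bar>C i k\<bar> * (C k l)\<^sup>2) = (\<Sum>i\<in>I. \<Sum>k\<in>I. \<Sum>l\<in>I. \<bar>C i k\<bar> * (C i l)\<^sup>2)"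
      by (subst sum.swap) (auto intro!: sum.cong simp: sym)
    also have "(\<dots> + \<dots>) / 2 = (\<Sum>i\<in>I. (\<Sum>k\<in>I. \<bar>C i k\<bar>) * (\<Sum>l\<in>I. (C i l)\<^sup>2))"
      by (simp add: sum_product)
    also have "\<dots> \<le> (\<Sum>i\<in>I. \<rho> * (\<Sum>l\<in>I. (C i l)\<^sup>2))"
      by (intro sum_mono mult_right_mono row sum_nonneg) auto
    finally show ?thesis by (simp add: \<tau>_def sum_distrib_left)
  qed
  have der: "(\<psi> has_vector_derivative
      (- 4 * \<i> * of_real (t\<^sup>2 * exp (t\<^sup>2 * \<tau>)) * iexp (- t * tr) * R t)) (at t within S)" for t S
  proof -
    have "(CLINT x|gauss_PiM I. \<i> * of_real (quad_form I C x) * iexp (t * quad_form I C x)) =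
       \<i> * (of_real tr * gauss_phase I C t + 2 * \<i> * of_real t *
         (of_real \<tau> * gauss_phase I C t + 2 * \<i> * of_real t * R t))"
      using integral_quad_form_iexp[OF fin, where A = C and t = t and C = C] gauss_trace_step[OF fin sym, where A = C and t = t]
        gauss_trace_step[OF fin sym, where A = "mat_mul I C C" and t = t]
      by (simp add: mult.assoc tr_def R_def C3_def tr2)
    then have 1: "(gauss_phase I C has_vector_derivative \<i> * (of_real tr * gauss_phase I C t + 2 * \<i> * of_real t *
         (of_real \<tau> * gauss_phase I C t + 2 * \<i> * of_real t * R t))) (at t within S)"
      using has_vector_derivative_integral_iexp[OF prob_space.finite_measure[OF prob_space_gauss] integrable_quad_form, of I C t]
      unfolding gauss_phase_def[abs_def] by (auto intro: has_vector_derivative_at_within)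
    have 2: "((\<lambda>t. iexp (- t * tr)) has_vector_derivative (- \<i> * of_real tr * iexp (- t * tr))) (at t within S)"
    proof -
      have "((\<lambda>t. - t * tr) has_vector_derivative - tr) (at t within S)"
        by (auto intro!: derivative_eq_intros)
      from vector_diff_chain_within[OF this has_vector_derivative_iexp]
      show ?thesis by (simp add: o_def scaleR_conv_of_real mult_ac)
    qed
    have 3: "((\<lambda>t. complex_of_real (exp (t\<^sup>2 * \<tau>))) has_vector_derivative of_real (2 * t * \<tau> * exp (t\<^sup>2 * \<tau>))) (at t within S)"
      by (rule has_vector_derivative_of_real) (auto intro!: derivative_eq_intros)
    show ?thesis
      unfolding \<psi>_def
      by (rule has_vector_derivative_eq_rhs[OF has_vector_derivative_mult[OF 3 has_vector_derivative_mult[OF 2 1]]])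
        (simp add: algebra_simps power2_eq_square)
  qed
  have "norm (\<psi> t - \<psi> 0) \<le> (4 * t\<^sup>2 * exp (t\<^sup>2 * \<tau>) * K) * norm (t - 0)"
  proof (rule differentiable_bound[where f' = "\<lambda>s h. h *\<^sub>R (- 4 * \<i> * of_real (s\<^sup>2 * exp (s\<^sup>2 * \<tau>)) * iexp (- s * tr) * R s)"])
    show "convex (closed_segment 0 t)" by (rule convex_closed_segment)
    fix s assume "s \<in> closed_segment 0 t"
    then have "\<bar>s\<bar> \<le> \<bar>t\<bar>" by (auto simp: closed_segment_eq_real_ivl split: if_splits)
    then have s2: "s\<^sup>2 \<le> t\<^sup>2" by (simp add: abs_le_square_iff)
    have \<tau>0: "\<tau> \<ge> 0" unfolding \<tau>_def by (intro sum_nonneg) auto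
    show "onorm (\<lambda>h. h *\<^sub>R (- 4 * \<i> * of_real (s\<^sup>2 * exp (s\<^sup>2 * \<tau>)) * iexp (- s * tr) * R s)) \<le> 4 * t\<^sup>2 * exp (t\<^sup>2 * \<tau>) * K"
    proof (rule onorm_bound)
      have K0: "0 \<le> K" using R_bound[of 0] norm_ge_zero order_trans by blast
      then show "0 \<le> 4 * t\<^sup>2 * exp (t\<^sup>2 * \<tau>) * K" by simp
      fix h :: real
      have "norm (h *\<^sub>R (- 4 * \<i> * of_real (s\<^sup>2 * exp (s\<^sup>2 * \<tau>)) * iexp (- s * tr) * R s)) =
        4 * s\<^sup>2 * exp (s\<^sup>2 * \<tau>) * norm (R s) * norm h"
        by (simp add: norm_mult del: of_real_mult of_real_minus)
      also have "\<dots> \<le> 4 * t\<^sup>2 * exp (t\<^sup>2 * \<tau>) * K * norm h"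
        using s2 \<tau>0 R_bound[of s] K0
        by (intro mult_right_mono mult_mono) (auto simp: mult_right_mono)
      finally show "norm (h *\<^sub>R (- 4 * \<i> * of_real (s\<^sup>2 * exp (s\<^sup>2 * \<tau>)) * iexp (- s * tr) * R s)) \<le> 4 * t\<^sup>2 * exp (t\<^sup>2 * \<tau>) * K * norm h" .
    qed
  qed (use der in \<open>auto simp: has_vector_derivative_def\<close>)
  moreover have "\<psi> 0 = 1"
    by (simp add: \<psi>_def gauss_phase_def prob_space.prob_space[OF prob_space_gauss])
  moreover have "iexp (- t * tr) * gauss_phase I C t - of_real (exp (- t\<^sup>2 * \<tau>)) = of_real (exp (- t\<^sup>2 * \<tau>)) * (\<psi> t - 1)"
    by (simp add: \<psi>_def algebra_simps flip: exp_of_real exp_add)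
  ultimately have "norm (iexp (- t * tr) * gauss_phase I C t - of_real (exp (- t\<^sup>2 * \<tau>))) \<le>
      exp (- t\<^sup>2 * \<tau>) * ((4 * t\<^sup>2 * exp (t\<^sup>2 * \<tau>) * K) * \<bar>t\<bar>)"
    by (simp add: norm_mult)
  also have "\<dots> = 4 * \<bar>t\<bar>^3 * K"
    by (simp add: power3_eq_cube power2_eq_square exp_minus field_simps)
  also have "\<dots> \<le> 4 * \<bar>t\<bar>^3 * (\<rho> * \<tau>)"
    using K_bound by (intro mult_left_mono) auto
  finally show ?thesis by (simp add: tr_def \<tau>_def)
qed

text \<open>The characteristic function of a variable with values in [-1, 1] is its moment series:
  the m-th term is at most |t|^m / m!, which permits the interchange of sum and integral.\<close>

lemma distr_eq_if_moments_eq: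
  fixes U :: "'a \<Rightarrow> real" and V :: "'b \<Rightarrow> real"
  assumes "prob_space M" "prob_space N"
    and [measurable]: "U \<in> borel_measurable M" "V \<in> borel_measurable N"
    and U: "\<And>x. \<bar>U x\<bar> \<le> 1" and V: "\<And>x. \<bar>V x\<bar> \<le> 1"
    and eq: "\<And>m::nat. (\<integral>x. U x ^ m \<partial>M) = (\<integral>x. V x ^ m \<partial>N)"
  shows "distr M borel U = distr N borel V"
proof -
  have series: "char (distr M borel U) t = (\<Sum>m. of_real (\<integral>x. U x ^ m \<partial>M) * ((\<i> * of_real t) ^ m / fact m))"
    if "prob_space M" and [measurable]: "U \<in> borel_measurable M" and U: "\<And>x. \<bar>U x\<bar> \<le> 1"
    for M :: "'c measure" and U :: "'c \<Rightarrow> real" and t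
  proof -
    interpret prob_space M by fact
    let ?f = "\<lambda>m x. of_real (U x ^ m) * ((\<i> * of_real t) ^ m / fact m)"
    have Um: "\<bar>U x ^ m\<bar> \<le> 1" for x m
      using U[of x] by (simp add: power_abs power_le_one)
    have int: "integrable M (\<lambda>x. U x ^ m)" for m
      by (rule integrable_const_bound[where B = 1]) (use Um in auto)
    have nf: "norm (?f m x) \<le> \<bar>t\<bar> ^ m / fact m" for m x
      using Um[of x m] by (simp add: norm_mult norm_divide norm_power divide_right_mono mult_left_le_one_le del: of_real_power)
    have sm: "summable (\<lambda>m. \<bar>t\<bar> ^ m / fact m)"
      using summable_exp[of "\<bar>t\<bar>"] by (simp add: divide_inverse mult.commute)
    have intf: "integrable M (?f m)" for m
      by (intro integrable_mult_left integrable_of_real int)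
    have "char (distr M borel U) t = (CLINT x|M. iexp (t * U x))"
      by (simp add: char_def integral_distr)
    also have "\<dots> = (CLINT x|M. (\<Sum>m. ?f m x))"
    proof (rule Bochner_Integration.integral_cong[OF refl])
      fix x
      have "iexp (t * U x) = (\<Sum>m. (\<i> * of_real (t * U x)) ^ m /\<^sub>R fact m)" by (simp only: exp_def)
      also have "(\<lambda>m. (\<i> * of_real (t * U x)) ^ m /\<^sub>R fact m) = (\<lambda>m. ?f m x)"
        by (simp add: fun_eq_iff scaleR_conv_of_real power_mult_distrib field_simps)
      finally show "iexp (t * U x) = (\<Sum>m. ?f m x)" .
    qed
    also have "\<dots> = (\<Sum>m. CLINT x|M. ?f m x)"
    proof (rule integral_suminf[OF intf])
      show "AE x in M. summable (\<lambda>m. norm (?f m x))"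
        by (intro AE_I2 summable_comparison_test'[OF sm, where N = 0]) (use nf in simp)
      have "norm (\<integral>x. norm (?f m x) \<partial>M) \<le> \<bar>t\<bar> ^ m / fact m" for m
      proof -
        have "(\<integral>x. norm (?f m x) \<partial>M) \<le> (\<integral>x. \<bar>t\<bar> ^ m / fact m \<partial>M)"
          using nf intf by (intro integral_mono integrable_norm) auto
        then show ?thesis by (simp add: prob_space)
      qed
      then show "summable (\<lambda>m. \<integral>x. norm (?f m x) \<partial>M)"
        by (intro summable_comparison_test'[OF sm, where N = 0]) simp
    qed
    also have "\<dots> = (\<Sum>m. of_real (\<integral>x. U x ^ m \<partial>M) * ((\<i> * of_real t) ^ m / fact m))"
      by (simp only: integral_mult_left_zero integral_complex_of_real)
    finally show ?thesis .
  qed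
  show ?thesis
  proof (rule Levy_uniqueness)
    show "real_distribution (distr M borel U)" "real_distribution (distr N borel V)"
      using assms(1,2) by (auto intro!: prob_space.real_distribution_distr)
    show "char (distr M borel U) = char (distr N borel V)"
      using series[OF assms(1,3) U] series[OF assms(2,4) V] eq by (simp add: fun_eq_iff)
  qed
qed

lemma char_gauss_linear:
  assumes "finite I"
  shows "(CLINT x|gauss_PiM I. iexp (\<Sum>i\<in>I. z i * x i)) = of_real (exp (- (\<Sum>i\<in>I. (z i)\<^sup>2) / 2))"
proof -
  have "(CLINT x|gauss_PiM I. iexp (\<Sum>i\<in>I. z i * x i)) = (CLINT x|gauss_PiM I. (\<Prod>i\<in>I. iexp (z i * x i)))"
    using assms by (simp add: exp_sum sum_distrib_left)
  also have "\<dots> = (\<Prod>i\<in>I. CLINT u|std_normal_distribution. iexp (z i * u))"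
    by (rule product_sigma_finite.product_integral_prod[OF product_sigma_finite_std_normal assms])
      (intro prob_space.integrable_iexp[OF prob_space_std_normal], auto)
  also have "\<dots> = (\<Prod>i\<in>I. of_real (exp (- (z i)\<^sup>2 / 2)))"
    using char_std_normal_distribution by (simp add: char_def fun_eq_iff)
  also have "\<dots> = of_real (exp (- (\<Sum>i\<in>I. (z i)\<^sup>2) / 2))"
    using exp_sum[OF assms, of "\<lambda>i. - (z i)\<^sup>2 / 2"]
    by (simp add: sum_negf sum_divide_distrib flip: of_real_prod)
  finally show ?thesis .
qed

text \<open>No square root of C is taken. Averaging exp(i b sum x_i Z_i) over independent standard x
  gives exp(-b^2 |Z|^2 / 2), and averaging over Z gives exp(-b^2 x^T C x / 2); Fubini equates the
  two Laplace transforms. Since exp(-|Z|^2) lies in [0, 1], integer arguments suffice: they are its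
  moments.\<close>

theorem gaussian_squared_norm_char:
  fixes C :: "'i \<Rightarrow> 'i \<Rightarrow> real" and t \<rho> :: real
  assumes "prob_space M" and fin: "finite I"
    and meas: "\<And>i. i \<in> I \<Longrightarrow> Z i \<in> borel_measurable M"
    and gauss: "\<And>a. (CLINT \<omega>|M. iexp (\<Sum>i\<in>I. a i * Z i \<omega>)) = of_real (exp (- quad_form I C a / 2))"
    and sym: "\<And>i j. i \<in> I \<Longrightarrow> j \<in> I \<Longrightarrow> C i j = C j i"
    and row: "\<And>i. i \<in> I \<Longrightarrow> (\<Sum>j\<in>I. \<bar>C i j\<bar>) \<le> \<rho>"
  shows "norm ((CLINT \<omega>|M. iexp (t * ((\<Sum>i\<in>I. (Z i \<omega>)\<^sup>2) - (\<Sum>i\<in>I. C i i)))) -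
       of_real (exp (- t\<^sup>2 * (\<Sum>i\<in>I. \<Sum>j\<in>I. (C i j)\<^sup>2)))) \<le> 4 * \<bar>t\<bar>^3 * (\<rho> * (\<Sum>i\<in>I. \<Sum>j\<in>I. (C i j)\<^sup>2))"
proof -
  interpret M: prob_space M by fact
  interpret G: prob_space "gauss_PiM I" by (rule prob_space_gauss)
  interpret P: pair_prob_space M "gauss_PiM I" ..
  have [measurable]: "(\<lambda>x. x i) \<in> borel_measurable (gauss_PiM I)" if "i \<in> I" for i
    using that by (rule measurable_gauss_component)
  note meas [measurable]
  define S where "S \<omega> = (\<Sum>i\<in>I. (Z i \<omega>)\<^sup>2)" for \<omega>
  have [measurable]: "S \<in> borel_measurable M" unfolding S_def by measurable
  \<comment> \<open>A characteristic function is at most 1 in modulus, so the exponent is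
    nonpositive.\<close>
  have psd: "0 \<le> quad_form I C a" for a
  proof -
    have "norm (CLINT \<omega>|M. iexp (\<Sum>i\<in>I. a i * Z i \<omega>)) \<le> (\<integral>\<omega>. norm (iexp (\<Sum>i\<in>I. a i * Z i \<omega>)) \<partial>M)"
      by (rule integral_norm_bound)
    also have "\<dots> = 1" by (simp only: norm_exp_i_times) (simp add: M.prob_space)
    finally have "exp (- quad_form I C a / 2) \<le> 1" unfolding gauss by simp
    then show ?thesis by simp
  qed
  have S0: "0 \<le> S \<omega>" for \<omega> unfolding S_def by (intro sum_nonneg) auto
  have laplace: "(\<integral>\<omega>. exp (- S \<omega>) ^ m \<partial>M) = (\<integral>x. exp (- quad_form I C x) ^ m \<partial>gauss_PiM I)" for m :: nat
  proof -
    \<comment> \<open>With b^2 = 2 m the Gaussian average is exactly the m-th power of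
      exp(-S).\<close>
    define b where "b = sqrt (2 * real m)"
    have b2: "b\<^sup>2 = 2 * real m" by (simp add: b_def)
    let ?f = "\<lambda>\<omega> x. iexp (\<Sum>i\<in>I. b * x i * Z i \<omega>)"
    have 1: "(CLINT x|gauss_PiM I. ?f \<omega> x) = of_real (exp (- S \<omega>) ^ m)" for \<omega>
    proof -
      have "(CLINT x|gauss_PiM I. ?f \<omega> x) = of_real (exp (- (\<Sum>i\<in>I. (b * Z i \<omega>)\<^sup>2) / 2))"
        using char_gauss_linear[OF fin, of "\<lambda>i. b * Z i \<omega>"] by (simp add: mult_ac)
      also have "(\<Sum>i\<in>I. (b * Z i \<omega>)\<^sup>2) = 2 * real m * S \<omega>"
        by (simp add: power_mult_distrib b2 S_def sum_distrib_left)
      finally show ?thesis by (simp add: exp_of_nat_mult[symmetric])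
    qed
    have 2: "(CLINT \<omega>|M. ?f \<omega> x) = of_real (exp (- quad_form I C x) ^ m)" for x
    proof -
      have "(CLINT \<omega>|M. ?f \<omega> x) = of_real (exp (- quad_form I C (\<lambda>i. b * x i) / 2))"
        using gauss[of "\<lambda>i. b * x i"] by simp
      also have "quad_form I C (\<lambda>i. b * x i) = b\<^sup>2 * quad_form I C x"
        by (simp add: quad_form_def sum_distrib_left power2_eq_square mult_ac)
      finally show ?thesis by (simp add: b2 exp_of_nat_mult[symmetric])
    qed
    have "integrable (M \<Otimes>\<^sub>M gauss_PiM I) (\<lambda>p. iexp (\<Sum>i\<in>I. b * snd p i * Z i (fst p)))"
    proof (rule P.integrable_const_bound[where B = 1])
      have [measurable]: "(\<lambda>p. snd p i) \<in> borel_measurable (M \<Otimes>\<^sub>M gauss_PiM I)" if "i \<in> I" for i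
        by (rule measurable_compose[OF measurable_snd measurable_gauss_component[OF that]])
      have [measurable]: "(\<lambda>p. Z i (fst p)) \<in> borel_measurable (M \<Otimes>\<^sub>M gauss_PiM I)" if "i \<in> I" for i
        by (rule measurable_compose[OF measurable_fst meas[OF that]])
      show "(\<lambda>p. iexp (\<Sum>i\<in>I. b * snd p i * Z i (fst p))) \<in> borel_measurable (M \<Otimes>\<^sub>M gauss_PiM I)"
        by measurable
    qed (simp only: norm_exp_i_times, simp)
    then have "integrable (M \<Otimes>\<^sub>M gauss_PiM I) (case_prod ?f)"
      by (simp add: case_prod_beta' mult_ac)
    from P.Fubini_integral[OF this]
    have "complex_of_real (\<integral>x. exp (- quad_form I C x) ^ m \<partial>gauss_PiM I) = of_real (\<integral>\<omega>. exp (- S \<omega>) ^ m \<partial>M)"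
      unfolding 1 2 by (simp only: integral_complex_of_real)
    then show ?thesis by (simp only: of_real_eq_iff)
  qed
  have eq: "distr M borel (\<lambda>\<omega>. exp (- S \<omega>)) = distr (gauss_PiM I) borel (\<lambda>x. exp (- quad_form I C x))"
    by (rule distr_eq_if_moments_eq[OF assms(1) prob_space_gauss _ _ _ _ laplace]) (use psd S0 in auto)
  let ?c = "\<Sum>i\<in>I. C i i"
  \<comment> \<open>Undoes the map from S to exp(-S), so that equality of laws passes to |Z|^2
    itself.\<close>
  let ?h = "\<lambda>u. iexp (t * (- ln u - ?c))"
  have "(CLINT \<omega>|M. iexp (t * (S \<omega> - ?c))) = (CLINT u|distr M borel (\<lambda>\<omega>. exp (- S \<omega>)). ?h u)"
    by (subst integral_distr) auto
  also have "\<dots> = (CLINT x|gauss_PiM I. iexp (t * (quad_form I C x - ?c)))"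
    unfolding eq by (subst integral_distr) auto
  also have "\<dots> = (CLINT x|gauss_PiM I. iexp (- t * ?c) * iexp (t * quad_form I C x))"
    by (intro Bochner_Integration.integral_cong refl) (simp add: exp_add[symmetric] algebra_simps)
  also have "\<dots> = iexp (- t * ?c) * gauss_phase I C t"
    by (simp add: gauss_phase_def)
  finally show ?thesis
    using gauss_phase_bound[OF fin sym psd row, of t] by (simp add: S_def)
qed

section \<open>Gaussian laws of Wiener integrals\<close>

text \<open>Induction along the sorted time points: a new largest point \<open>b\<close> adds the
  interval from the previous maximum to \<open>b\<close>, and its weight is added to all earlier
  increments, because \<Phi> b - \<Phi> 0 telescopes. One choice of \<open>\<tau>\<close> and
  \<open>d\<close> serves every \<Phi>, so it can be used both for the paths of W and for the
  indicators of {0<..t}.\<close>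

lemma step_reparam:
  fixes T :: "real set" and c :: "real \<Rightarrow> real"
  assumes "finite T" "T \<subseteq> {0..}"
  shows "\<exists>N \<tau> d. \<tau> 0 = (0::real) \<and> (\<forall>l<N. \<tau> l \<le> \<tau> (Suc l)) \<and> \<tau> N \<in> insert 0 T \<and>
    (\<forall>\<Phi> :: real \<Rightarrow> real. (\<Sum>t\<in>T. c t * (\<Phi> t - \<Phi> 0)) = (\<Sum>l<(N::nat). d l * (\<Phi> (\<tau> (Suc l)) - \<Phi> (\<tau> l))))"
  using assms
proof (induction T rule: finite_linorder_max_induct)
  case empty
  show ?case by (intro exI[of _ 0] exI[of _ "\<lambda>_. 0"]) auto
next
  case (insert b A)
  then obtain N \<tau> d where IH: "\<tau> 0 = (0::real)" "\<And>l. l < N \<Longrightarrow> \<tau> l \<le> \<tau> (Suc l)" "\<tau> N \<in> insert 0 A"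
    "\<And>\<Phi> :: real \<Rightarrow> real. (\<Sum>t\<in>A. c t * (\<Phi> t - \<Phi> 0)) = (\<Sum>l<(N::nat). d l * (\<Phi> (\<tau> (Suc l)) - \<Phi> (\<tau> l)))"
    by auto
  define \<tau>' where "\<tau>' = \<tau>(Suc N := b)"
  define d' where "d' l = (if l < N then d l else 0) + c b" for l
  have le: "\<tau> N \<le> b" using IH(3) insert by force
  have 1: "\<forall>l<Suc N. \<tau>' l \<le> \<tau>' (Suc l)"
    using IH(2) le by (auto simp: \<tau>'_def less_Suc_eq)
  have 2: "(\<Sum>t\<in>insert b A. c t * (\<Phi> t - \<Phi> 0)) = (\<Sum>l<Suc N. d' l * (\<Phi> (\<tau>' (Suc l)) - \<Phi> (\<tau>' l)))"
    for \<Phi> :: "real \<Rightarrow> real"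
  proof -
    have "b \<notin> A" using insert by auto
    then have "(\<Sum>t\<in>insert b A. c t * (\<Phi> t - \<Phi> 0)) = c b * (\<Phi> b - \<Phi> 0) + (\<Sum>l<N. d l * (\<Phi> (\<tau> (Suc l)) - \<Phi> (\<tau> l)))"
      using insert by (simp add: IH(4))
    also have "\<Phi> b - \<Phi> 0 = (\<Sum>l<Suc N. \<Phi> (\<tau>' (Suc l)) - \<Phi> (\<tau>' l))"
      by (subst sum_lessThan_telescope) (simp add: \<tau>'_def IH(1))
    also have "(\<Sum>l<N. d l * (\<Phi> (\<tau> (Suc l)) - \<Phi> (\<tau> l))) =
       (\<Sum>l<Suc N. (if l < N then d l else 0) * (\<Phi> (\<tau>' (Suc l)) - \<Phi> (\<tau>' l)))"
      by (auto simp: \<tau>'_def intro!: sum.cong)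
    finally show ?thesis
      unfolding d'_def sum_distrib_left sum.distrib[symmetric] by (simp add: algebra_simps)
  qed
  have "\<tau>' 0 = 0" "\<tau>' (Suc N) \<in> insert 0 (insert b A)" by (simp_all add: \<tau>'_def IH)
  with 1 2 show ?case by blast
qed

text \<open>A step function together with its integral. Anchoring every term at time 0 makes sums a
  matter of uniting finite sets of times; the consecutive increments that independence requires are
  recovered in \<open>step_pairE\<close>.\<close>

definition step_pair :: "(real \<Rightarrow> 'w \<Rightarrow> real) \<Rightarrow> ('w \<Rightarrow> real) \<Rightarrow> (real \<Rightarrow> real) \<Rightarrow> bool" where
  "step_pair W V s \<longleftrightarrow> (\<exists>T c. finite T \<and> T \<subseteq> {0..} \<and>
     V = (\<lambda>\<omega>. \<Sum>t\<in>T. c t * (W t \<omega> - W 0 \<omega>)) \<and> s = (\<lambda>u. \<Sum>t\<in>T. c t * indicator {0<..t} u))"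

lemma step_pairE:
  assumes "step_pair W V s"
  obtains N \<tau> d where "\<tau> 0 = 0" "\<And>l. l < N \<Longrightarrow> \<tau> l \<le> \<tau> (Suc l)"
    "V = (\<lambda>\<omega>. \<Sum>l<(N::nat). d l * (W (\<tau> (Suc l)) \<omega> - W (\<tau> l) \<omega>))"
    "s = (\<lambda>u. \<Sum>l<N. d l * indicator {\<tau> l<..\<tau> (Suc l)} u)"
proof -
  from assms obtain T c where T: "finite T" "T \<subseteq> {0..}"
    "V = (\<lambda>\<omega>. \<Sum>t\<in>T. c t * (W t \<omega> - W 0 \<omega>))" "s = (\<lambda>u. \<Sum>t\<in>T. c t * indicator {0<..t} u)"
    unfolding step_pair_def by auto
  obtain N \<tau> d where R: "\<tau> 0 = (0::real)" "\<And>l. l < N \<Longrightarrow> \<tau> l \<le> \<tau> (Suc l)"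
    "\<And>\<Phi> :: real \<Rightarrow> real. (\<Sum>t\<in>T. c t * (\<Phi> t - \<Phi> 0)) = (\<Sum>l<(N::nat). d l * (\<Phi> (\<tau> (Suc l)) - \<Phi> (\<tau> l)))"
    using step_reparam[OF T(1,2), of c] by auto
  have pos: "0 \<le> \<tau> l" if "l \<le> N" for l
    using that
  proof (induction l)
    case (Suc l)
    then show ?case using R(2)[of l] by simp
  qed (simp add: R(1))
  have "V = (\<lambda>\<omega>. \<Sum>l<N. d l * (W (\<tau> (Suc l)) \<omega> - W (\<tau> l) \<omega>))"
    unfolding T(3) using R(3)[of "\<lambda>t. W t \<omega>" for \<omega>] by auto
  moreover have "s = (\<lambda>u. \<Sum>l<N. d l * indicator {\<tau> l<..\<tau> (Suc l)} u)"
  proof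
    fix u
    have "s u = (\<Sum>l<N. d l * (indicator {0<..\<tau> (Suc l)} u - indicator {0<..\<tau> l} u))"
      unfolding T(4) using R(3)[of "\<lambda>t. indicator {0<..t} u"] by simp
    also have "\<dots> = (\<Sum>l<N. d l * indicator {\<tau> l<..\<tau> (Suc l)} u)"
    proof (intro sum.cong refl)
      fix l assume "l \<in> {..<N}"
      then have "0 \<le> \<tau> l" "\<tau> l \<le> \<tau> (Suc l)" using pos R(2) by auto
      then show "d l * (indicator {0<..\<tau> (Suc l)} u - indicator {0<..\<tau> l} u) = d l * indicator {\<tau> l<..\<tau> (Suc l)} u"
        by (auto simp: indicator_def)
    qed
    finally show "s u = (\<Sum>l<N. d l * indicator {\<tau> l<..\<tau> (Suc l)} u)" .
  qed
  ultimately show ?thesis using that R(1,2) by blast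
qed

lemma step_pair_zero: "step_pair W (\<lambda>_. 0) (\<lambda>_. 0)"
  unfolding step_pair_def by (intro exI[of _ "{}"]) auto

lemma step_pair_scale:
  assumes "step_pair W V s"
  shows "step_pair W (\<lambda>\<omega>. a * V \<omega>) (\<lambda>u. a * s u)"
proof -
  from assms obtain T c where "finite T" "T \<subseteq> {0..}"
    "V = (\<lambda>\<omega>. \<Sum>t\<in>T. c t * (W t \<omega> - W 0 \<omega>))" "s = (\<lambda>u. \<Sum>t\<in>T. c t * indicator {0<..t} u)"
    unfolding step_pair_def by auto
  then show ?thesis
    unfolding step_pair_def
    by (intro exI[of _ T] exI[of _ "\<lambda>t. a * c t"]) (simp add: sum_distrib_left mult.assoc del: sum_mult_indicator sum_indicator_mult)
qed

lemma step_pair_add: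
  assumes "step_pair W V s" "step_pair W V' s'"
  shows "step_pair W (\<lambda>\<omega>. V \<omega> + V' \<omega>) (\<lambda>u. s u + s' u)"
proof -
  from assms(1) obtain T c where T: "finite T" "T \<subseteq> {0..}"
    "V = (\<lambda>\<omega>. \<Sum>t\<in>T. c t * (W t \<omega> - W 0 \<omega>))" "s = (\<lambda>u. \<Sum>t\<in>T. c t * indicator {0<..t} u)"
    unfolding step_pair_def by auto
  from assms(2) obtain T' c' where T': "finite T'" "T' \<subseteq> {0..}"
    "V' = (\<lambda>\<omega>. \<Sum>t\<in>T'. c' t * (W t \<omega> - W 0 \<omega>))" "s' = (\<lambda>u. \<Sum>t\<in>T'. c' t * indicator {0<..t} u)"
    unfolding step_pair_def by auto
  define e where "e t = (if t \<in> T then c t else 0) + (if t \<in> T' then c' t else 0)" for t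
  have e: "(\<Sum>t\<in>T. c t * f t) + (\<Sum>t\<in>T'. c' t * f t) = (\<Sum>t\<in>T\<union>T'. e t * f t)" for f :: "real \<Rightarrow> real"
  proof -
    have "(\<Sum>t\<in>T. c t * f t) = (\<Sum>t\<in>T\<union>T'. (if t \<in> T then c t else 0) * f t)"
      using T(1) T'(1) by (intro sum.mono_neutral_cong_left) auto
    moreover have "(\<Sum>t\<in>T'. c' t * f t) = (\<Sum>t\<in>T\<union>T'. (if t \<in> T' then c' t else 0) * f t)"
      using T(1) T'(1) by (intro sum.mono_neutral_cong_left) auto
    ultimately show ?thesis by (simp add: e_def ring_distribs sum.distrib)
  qed
  show ?thesis
    unfolding step_pair_def
    by (intro exI[of _ "T \<union> T'"] exI[of _ e]) (use T T' in \<open>auto simp: e simp del: sum_mult_indicator sum_indicator_mult\<close>)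
qed

lemma step_pair_increment:
  assumes "0 \<le> a" "a \<le> b"
  shows "step_pair W (\<lambda>\<omega>. W b \<omega> - W a \<omega>) (indicator {a<..b})"
proof -
  have *: "step_pair W (\<lambda>\<omega>. c * (W t \<omega> - W 0 \<omega>)) (\<lambda>u. c * indicator {0<..t} u)" if "0 \<le> t" for c t
    unfolding step_pair_def by (intro exI[of _ "{t}"] exI[of _ "\<lambda>_. c"]) (use that in \<open>auto simp del: sum_mult_indicator sum_indicator_mult\<close>)
  have "step_pair W (\<lambda>\<omega>. 1 * (W b \<omega> - W 0 \<omega>) + (- 1) * (W a \<omega> - W 0 \<omega>)) (\<lambda>u. 1 * indicator {0<..b} u + (- 1) * indicator {0<..a} u)"
    using assms by (intro step_pair_add *) auto
  also have "(\<lambda>\<omega>. 1 * (W b \<omega> - W 0 \<omega>) + (- 1) * (W a \<omega> - W 0 \<omega>)) = (\<lambda>\<omega>. W b \<omega> - W a \<omega>)" by auto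
  also have "(\<lambda>u. 1 * indicator {0<..b} u + (- 1) * indicator {0<..a} u) = (indicator {a<..b} :: real \<Rightarrow> real)"
    using assms by (auto simp: indicator_def fun_eq_iff)
  finally show ?thesis .
qed

lemma step_pair_step_integral:
  assumes "is_partition t m \<tau>"
  shows "step_pair W (step_integral W m \<tau> c) (step_fun m \<tau> c)"
proof -
  have pos: "0 \<le> \<tau> j" if "j \<le> m" for j
    using that
  proof (induction j)
    case (Suc j)
    then have "\<tau> j \<le> \<tau> (Suc j)" using assms by (simp add: is_partition_def)
    with Suc show ?case by simp
  qed (use assms in \<open>simp add: is_partition_def\<close>)
  have "step_pair W (\<lambda>\<omega>. \<Sum>j<n. c j * (W (\<tau> (Suc j)) \<omega> - W (\<tau> j) \<omega>)) (\<lambda>s. \<Sum>j<n. c j * indicator {\<tau> j<..\<tau> (Suc j)} s)" if "n \<le> m" for n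
    using that
  proof (induction n)
    case 0 show ?case by (simp add: step_pair_zero)
  next
    case (Suc n)
    then have "0 \<le> \<tau> n" "\<tau> n \<le> \<tau> (Suc n)" using pos assms by (auto simp: is_partition_def)
    from step_pair_scale[OF step_pair_increment[OF this], of W "c n"] Suc show ?case
      by (simp add: step_pair_add)
  qed
  from this[of m] show ?thesis by (simp add: step_integral_def[abs_def] step_fun_def[abs_def])
qed

section \<open>Characteristic functions of integrals of step functions\<close>

lemma char_brownian_increment:
  assumes "prob_space M" and W: "brownian_motion M W" and st: "0 \<le> s" "s \<le> t"
  shows "(CLINT \<omega>|M. iexp (d * (W t \<omega> - W s \<omega>))) = of_real (exp (- d\<^sup>2 * (t - s) / 2))"
\<comment> \<open>\<open>brownian_motion\<close> prescribes the law of an increment only for s <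
  t.\<close>
proof (cases "s = t")
  case True
  interpret prob_space M by fact
  show ?thesis using True by (simp add: prob_space)
next
  case False
  interpret prob_space M by fact
  let ?X = "\<lambda>\<omega>. W t \<omega> - W s \<omega>" and ?q = "sqrt (t - s)"
  have q: "?q > 0" using False st by simp
  have [measurable]: "W t \<in> borel_measurable M" "W s \<in> borel_measurable M"
    using W st by (auto simp: brownian_motion_def)
  have "distributed M lborel ?X (normal_density 0 ?q)"
    using W st False by (auto simp: brownian_motion_def)
  then have D: "distributed M lborel (\<lambda>\<omega>. (?X \<omega> - 0) / ?q) std_normal_density"
    using normal_standard_normal_convert[OF q, of ?X 0] by simp
  have "(CLINT \<omega>|M. iexp (d * ?X \<omega>)) = (CLINT \<omega>|M. iexp ((d * ?q) * ((?X \<omega> - 0) / ?q)))"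
    using q by simp
  also have "\<dots> = (CLINT u|distr M lborel (\<lambda>\<omega>. (?X \<omega> - 0) / ?q). iexp ((d * ?q) * u))"
    by (subst integral_distr) auto
  also have "\<dots> = char std_normal_distribution (d * ?q)"
    unfolding distributed_distr_eq_density[OF D] char_def ..
  also have "\<dots> = of_real (exp (- d\<^sup>2 * (t - s) / 2))"
    using st by (simp add: char_std_normal_distribution power_mult_distrib)
  finally show ?thesis .
qed

lemma step_pair_measurable:
  assumes "step_pair W V s" and "\<And>t. t \<ge> 0 \<Longrightarrow> W t \<in> borel_measurable M"
  shows "V \<in> borel_measurable M" "s \<in> borel_measurable borel"
  using assms unfolding step_pair_def by (auto simp: subset_iff intro!: borel_measurable_sum)

text \<open>The Ito isometry at the level of characteristic functions: on disjoint intervals the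
  square of the step function is diagonal, and the factors of independent increments
  multiply.\<close>

lemma step_pair_char:
  assumes "prob_space M" and W: "brownian_motion M W" and "step_pair W V s"
  shows "(CLINT \<omega>|M. iexp (V \<omega>)) = of_real (exp (- (\<integral>u. (s u)\<^sup>2 \<partial>lborel) / 2))"
    and "integrable lborel (\<lambda>u. (s u)\<^sup>2)"
proof -
  interpret prob_space M by fact
  from assms(3) obtain N \<tau> d where R: "\<tau> 0 = 0" "\<And>l. l < N \<Longrightarrow> \<tau> l \<le> \<tau> (Suc l)"
    "V = (\<lambda>\<omega>. \<Sum>l<(N::nat). d l * (W (\<tau> (Suc l)) \<omega> - W (\<tau> l) \<omega>))"
    "s = (\<lambda>u. \<Sum>l<N. d l * indicator {\<tau> l<..\<tau> (Suc l)} u)"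
    by (rule step_pairE) blast
  have mono: "\<tau> l \<le> \<tau> m" if "l \<le> m" "m \<le> N" for l m
    using that
  proof (induction m rule: dec_induct)
    case (step m)
    then show ?case using R(2)[of m] by simp
  qed simp
  have pos: "0 \<le> \<tau> l" if "l \<le> N" for l using mono[of 0 l] that R(1) by simp
  have sq: "(s u)\<^sup>2 = (\<Sum>l<N. (d l)\<^sup>2 * indicator {\<tau> l<..\<tau> (Suc l)} u)" for u
  proof -
    have ind: "indicator {\<tau> l<..\<tau> (Suc l)} u * indicator {\<tau> m<..\<tau> (Suc m)} u = (if l = m then indicator {\<tau> l<..\<tau> (Suc l)} u else (0::real))"
      if "l < N" "m < N" for l m
    proof (cases "l = m")
      case False
      then have "\<tau> (Suc l) \<le> \<tau> m \<or> \<tau> (Suc m) \<le> \<tau> l"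
        using mono[of "Suc l" m] mono[of "Suc m" l] that by (cases "l < m") auto
      then show ?thesis using False by (auto simp: indicator_def)
    qed (auto simp: indicator_def)
    have "(s u)\<^sup>2 = (\<Sum>l<N. \<Sum>m<N. d l * d m * (indicator {\<tau> l<..\<tau> (Suc l)} u * indicator {\<tau> m<..\<tau> (Suc m)} u))"
      unfolding R(4) power2_eq_square sum_product by (simp add: mult_ac)
    also have "\<dots> = (\<Sum>l<N. \<Sum>m<N. (if l = m then d l * d m * indicator {\<tau> l<..\<tau> (Suc l)} u else 0))"
      by (intro sum.cong refl) (subst ind, auto)
    finally show ?thesis by (simp add: power2_eq_square)
  qed
  have int: "integrable lborel (\<lambda>u. (d l)\<^sup>2 * indicator {\<tau> l<..\<tau> (Suc l)} u)" if "l < N" for l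
    using R(2)[OF that] by (intro integrable_mult_right integrable_real_indicator) auto
  show "integrable lborel (\<lambda>u. (s u)\<^sup>2)" unfolding sq by (intro Bochner_Integration.integrable_sum int) simp
  have I: "(\<integral>u. (s u)\<^sup>2 \<partial>lborel) = (\<Sum>l<N. (d l)\<^sup>2 * (\<tau> (Suc l) - \<tau> l))"
    unfolding sq using R(2) int
    by (simp add: Bochner_Integration.integral_sum del: sum_mult_indicator sum_indicator_mult)
  have ind: "indep_vars (\<lambda>_. borel) (\<lambda>l \<omega>. W (\<tau> (Suc l)) \<omega> - W (\<tau> l) \<omega>) {..<N}"
    using W R(1,2) by (auto simp: brownian_motion_def)
  have "indep_vars (\<lambda>_. borel) (\<lambda>l \<omega>. d l * (W (\<tau> (Suc l)) \<omega> - W (\<tau> l) \<omega>)) {..<N}"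
    by (rule indep_vars_compose2[OF ind, where Y = "\<lambda>l x. d l * x"]) auto
  from char_distr_sum[OF this, of 1]
  have "char (distr M borel V) 1 = (\<Prod>l<N. char (distr M borel (\<lambda>\<omega>. d l * (W (\<tau> (Suc l)) \<omega> - W (\<tau> l) \<omega>))) 1)"
    unfolding R(3) .
  also have "\<dots> = (\<Prod>l<N. of_real (exp (- (d l)\<^sup>2 * (\<tau> (Suc l) - \<tau> l) / 2)))"
  proof (intro prod.cong refl)
    fix l assume "l \<in> {..<N}"
    then have l: "0 \<le> \<tau> l" "\<tau> l \<le> \<tau> (Suc l)" "0 \<le> \<tau> (Suc l)" using pos R(2) by auto
    have [measurable]: "W (\<tau> l) \<in> borel_measurable M" "W (\<tau> (Suc l)) \<in> borel_measurable M"
      using W l by (auto simp: brownian_motion_def)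
    show "char (distr M borel (\<lambda>\<omega>. d l * (W (\<tau> (Suc l)) \<omega> - W (\<tau> l) \<omega>))) 1 = of_real (exp (- (d l)\<^sup>2 * (\<tau> (Suc l) - \<tau> l) / 2))"
      using char_brownian_increment[OF assms(1) W l(1,2), of "d l"] by (simp add: char_def integral_distr)
  qed
  also have "\<dots> = of_real (exp (- (\<integral>u. (s u)\<^sup>2 \<partial>lborel) / 2))"
    using exp_sum[of "{..<N}" "\<lambda>l. - (d l)\<^sup>2 * (\<tau> (Suc l) - \<tau> l) / 2"]
    by (simp add: I sum_negf sum_divide_distrib flip: of_real_prod)
  finally show "(CLINT \<omega>|M. iexp (V \<omega>)) = of_real (exp (- (\<integral>u. (s u)\<^sup>2 \<partial>lborel) / 2))"
    using step_pair_measurable(1)[OF assms(3), of M] W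
    by (simp add: char_def integral_distr brownian_motion_def)
qed

section \<open>Passage to mean-square limits\<close>

lemma nn_integral_square_tendsto_0:
  fixes d :: "nat \<Rightarrow> 'a \<Rightarrow> real"
  assumes [measurable]: "\<And>p. d p \<in> borel_measurable N"
    and lim: "(\<lambda>p. \<integral>\<^sup>+x. ennreal ((d p x)\<^sup>2) \<partial>N) \<longlonglongrightarrow> 0"
  shows "eventually (\<lambda>p. integrable N (\<lambda>x. (d p x)\<^sup>2)) sequentially"
    and "(\<lambda>p. \<integral>x. (d p x)\<^sup>2 \<partial>N) \<longlonglongrightarrow> 0"
proof -
  \<comment> \<open>Convergence to 0 forces the extended integrals below 1 from some index on, which
    yields integrability.\<close>
  have "eventually (\<lambda>p. (\<integral>\<^sup>+x. ennreal ((d p x)\<^sup>2) \<partial>N) < 1) sequentially"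
    using order_tendstoD(2)[OF lim, of 1] by simp
  then show ev: "eventually (\<lambda>p. integrable N (\<lambda>x. (d p x)\<^sup>2)) sequentially"
    by eventually_elim (auto intro!: integrableI_nonneg elim: less_trans)
  have "(\<lambda>p. ennreal (\<integral>x. (d p x)\<^sup>2 \<partial>N)) \<longlonglongrightarrow> 0"
    by (rule Lim_transform_eventually[OF lim])
      (use ev in \<open>eventually_elim, simp add: nn_integral_eq_integral\<close>)
  then have "(\<lambda>p. ennreal (\<integral>x. (d p x)\<^sup>2 \<partial>N)) \<longlonglongrightarrow> ennreal 0" by simp
  then show "(\<lambda>p. \<integral>x. (d p x)\<^sup>2 \<partial>N) \<longlonglongrightarrow> 0"
    by (rule tendsto_ennrealD) auto
qed

text \<open>A non-integrable \<open>f\<close> has Bochner integral 0, and \<open>g\<close> is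
  nonnegative, so this case is covered as well.\<close>

lemma norm_integral_le:
  fixes f :: "'a \<Rightarrow> 'b :: {banach, second_countable_topology}"
  assumes g: "integrable M g" and le: "\<And>x. norm (f x) \<le> g x"
  shows "norm (integral\<^sup>L M f) \<le> integral\<^sup>L M g"
proof (cases "integrable M f")
  case True
  have "norm (integral\<^sup>L M f) \<le> (\<integral>x. norm (f x) \<partial>M)" by (rule integral_norm_bound)
  also have "\<dots> \<le> integral\<^sup>L M g" using True g le by (intro integral_mono) auto
  finally show ?thesis .
next
  case False
  have "0 \<le> g x" for x using le[of x] norm_ge_zero order_trans by blast
  then show ?thesis using False by (simp add: not_integrable_integral_eq integral_nonneg_AE)
qed

text \<open>Young's inequality with a free weight; a good choice of the weight replaces
  Cauchy-Schwarz for integrals throughout.\<close>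

lemma two_mult_le_weighted:
  fixes a b \<eta> :: real
  assumes "\<eta> > 0"
  shows "2 * \<bar>a\<bar> * \<bar>b\<bar> \<le> \<eta> * a\<^sup>2 + b\<^sup>2 / \<eta>"
proof -
  have "0 \<le> (\<eta> * \<bar>a\<bar> - \<bar>b\<bar>)\<^sup>2 / \<eta>" using assms by simp
  also have "(\<eta> * \<bar>a\<bar> - \<bar>b\<bar>)\<^sup>2 / \<eta> = \<eta> * a\<^sup>2 + b\<^sup>2 / \<eta> - 2 * \<bar>a\<bar> * \<bar>b\<bar>"
    using assms by (simp add: power2_diff field_simps power2_eq_square flip: abs_mult)
  finally show ?thesis by simp
qed

lemma div_sqrt_add_le:
  assumes "0 \<le> e" "0 < r"
  shows "e / (sqrt e + r) \<le> sqrt e"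
proof -
  have "e = sqrt e * sqrt e" using assms by simp
  also have "\<dots> \<le> sqrt e * (sqrt e + r)" using assms by (intro mult_left_mono) auto
  finally show ?thesis using assms by (simp add: pos_divide_le_eq add_nonneg_pos)
qed

text \<open>Continuity of the L2 norm, from s^2 - h^2 = (h - s)^2 - 2 h (h - s) with the last
  product split by Young's inequality.\<close>

lemma integral_square_tendsto:
  fixes s :: "nat \<Rightarrow> 'a \<Rightarrow> real"
  assumes [measurable]: "\<And>p. s p \<in> borel_measurable N" "h \<in> borel_measurable N"
    and int: "\<And>p. integrable N (\<lambda>x. (s p x)\<^sup>2)"
    and lim: "(\<lambda>p. \<integral>\<^sup>+x. ennreal ((h x - s p x)\<^sup>2) \<partial>N) \<longlonglongrightarrow> 0"
  shows "integrable N (\<lambda>x. (h x)\<^sup>2)" and "(\<lambda>p. \<integral>x. (s p x)\<^sup>2 \<partial>N) \<longlonglongrightarrow> (\<integral>x. (h x)\<^sup>2 \<partial>N)"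
proof -
  define e where "e p = (\<integral>x. (h x - s p x)\<^sup>2 \<partial>N)" for p
  have ev: "eventually (\<lambda>p. integrable N (\<lambda>x. (h x - s p x)\<^sup>2)) sequentially"
    and e: "e \<longlonglongrightarrow> 0"
    using nn_integral_square_tendsto_0[of "\<lambda>p x. h x - s p x" N] lim by (auto simp: e_def[abs_def])
  have e0: "0 \<le> e p" for p unfolding e_def by (intro integral_nonneg_AE) auto
  obtain p0 where p0: "integrable N (\<lambda>x. (h x - s p0 x)\<^sup>2)" using eventually_happens'[OF _ ev] by auto
  show inth: "integrable N (\<lambda>x. (h x)\<^sup>2)"
  proof (rule Bochner_Integration.integrable_bound)
    show "integrable N (\<lambda>x. 2 * (h x - s p0 x)\<^sup>2 + 2 * (s p0 x)\<^sup>2)"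
      using p0 int by (intro Bochner_Integration.integrable_add integrable_mult_right) auto
    have "a\<^sup>2 \<le> 2 * (a - b)\<^sup>2 + 2 * b\<^sup>2" for a b :: real
      using zero_le_power2[of "a - 2 * b"] by (simp add: power2_diff power_mult_distrib)
    then show "AE x in N. norm ((h x)\<^sup>2) \<le> norm (2 * (h x - s p0 x)\<^sup>2 + 2 * (s p0 x)\<^sup>2)"
      by simp
  qed measurable
  define H where "H = (\<integral>x. (h x)\<^sup>2 \<partial>N)"
  \<comment> \<open>The weight balances Young's inequality like the L2 distance
    \<open>sqrt (e p)\<close>; the summand 1 / (p + 1) keeps it positive when \<open>e p\<close> is
    0.\<close>
  let ?\<eta> = "\<lambda>p. sqrt (e p) + 1 / real (Suc p)"
  have "(\<lambda>p. (\<integral>x. (s p x)\<^sup>2 \<partial>N) - H) \<longlonglongrightarrow> 0"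
  proof (rule Lim_null_comparison)
    show "eventually (\<lambda>p. norm ((\<integral>x. (s p x)\<^sup>2 \<partial>N) - H) \<le> ?\<eta> p * H + (e p + sqrt (e p))) sequentially"
      using ev
    proof eventually_elim
      case (elim p)
      have \<eta>: "?\<eta> p > 0" using e0[of p] by (intro add_nonneg_pos) auto
      have "norm ((\<integral>x. (s p x)\<^sup>2 \<partial>N) - H) = norm (\<integral>x. (s p x)\<^sup>2 - (h x)\<^sup>2 \<partial>N)"
        using int inth by (simp add: H_def)
      also have "\<dots> \<le> (\<integral>x. ?\<eta> p * (h x)\<^sup>2 + ((h x - s p x)\<^sup>2 + (h x - s p x)\<^sup>2 / ?\<eta> p) \<partial>N)"
      proof (rule norm_integral_le)
        show "norm ((s p x)\<^sup>2 - (h x)\<^sup>2) \<le> ?\<eta> p * (h x)\<^sup>2 + ((h x - s p x)\<^sup>2 + (h x - s p x)\<^sup>2 / ?\<eta> p)" for x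
        proof -
          have "(s p x)\<^sup>2 - (h x)\<^sup>2 = (h x - s p x)\<^sup>2 - 2 * (h x) * (h x - s p x)"
            by (simp add: power2_eq_square algebra_simps)
          then have "norm ((s p x)\<^sup>2 - (h x)\<^sup>2) \<le> \<bar>(h x - s p x)\<^sup>2\<bar> + \<bar>2 * h x * (h x - s p x)\<bar>"
            by (simp only: real_norm_def abs_triangle_ineq4)
          then have "norm ((s p x)\<^sup>2 - (h x)\<^sup>2) \<le> (h x - s p x)\<^sup>2 + 2 * \<bar>h x\<bar> * \<bar>h x - s p x\<bar>"
            by (simp only: abs_mult abs_power2 abs_numeral)
          then show ?thesis using two_mult_le_weighted[OF \<eta>, of "h x" "h x - s p x"] by linarith
        qed
      qed (use elim int inth in \<open>auto intro!: Bochner_Integration.integrable_add Bochner_Integration.integrable_diff\<close>)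
      also have "\<dots> = ?\<eta> p * H + (e p + e p / ?\<eta> p)"
        using elim inth by (simp add: H_def e_def del: distrib_right)
      also have "\<dots> \<le> ?\<eta> p * H + (e p + sqrt (e p))"
        using div_sqrt_add_le[OF e0, of "1 / real (Suc p)" p] by simp
      finally show ?case .
    qed
    have "(\<lambda>p. ?\<eta> p * H + (e p + sqrt (e p))) \<longlonglongrightarrow> (sqrt 0 + 0) * H + (0 + sqrt 0)"
      using LIMSEQ_inverse_real_of_nat by (intro tendsto_intros e) (simp add: inverse_eq_divide)
    then show "(\<lambda>p. ?\<eta> p * H + (e p + sqrt (e p))) \<longlonglongrightarrow> 0" by simp
  qed
  then show "(\<lambda>p. \<integral>x. (s p x)\<^sup>2 \<partial>N) \<longlonglongrightarrow> (\<integral>x. (h x)\<^sup>2 \<partial>N)"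
    unfolding H_def using LIM_zero_iff by blast
qed

lemma norm_iexp_diff_le: "norm (iexp a - iexp b) \<le> \<bar>a - b\<bar>"
proof -
  have "iexp a - iexp b = iexp b * (iexp (a - b) - 1)"
    by (simp add: algebra_simps flip: exp_add)
  then have "norm (iexp a - iexp b) = norm (iexp (a - b) - 1)" by (simp add: norm_mult)
  also have "\<dots> \<le> \<bar>a - b\<bar>" using iexp_approx1[of "a - b" 0] by simp
  finally show ?thesis .
qed

text \<open>The map x to exp(i x) is 1-Lipschitz, so mean-square closeness is enough; the weight is
  chosen as in \<open>integral_square_tendsto\<close>.\<close>

lemma integral_iexp_tendsto:
  fixes V :: "nat \<Rightarrow> 'a \<Rightarrow> real"
  assumes "prob_space M" and [measurable]: "\<And>p. V p \<in> borel_measurable M" "Y \<in> borel_measurable M"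
    and lim: "(\<lambda>p. \<integral>\<^sup>+x. ennreal ((Y x - V p x)\<^sup>2) \<partial>M) \<longlonglongrightarrow> 0"
  shows "(\<lambda>p. CLINT x|M. iexp (V p x)) \<longlonglongrightarrow> (CLINT x|M. iexp (Y x))"
proof -
  interpret prob_space M by fact
  define e where "e p = (\<integral>x. (Y x - V p x)\<^sup>2 \<partial>M)" for p
  have ev: "eventually (\<lambda>p. integrable M (\<lambda>x. (Y x - V p x)\<^sup>2)) sequentially"
    and e: "e \<longlonglongrightarrow> 0"
    using nn_integral_square_tendsto_0[of "\<lambda>p x. Y x - V p x" M] lim by (auto simp: e_def[abs_def])
  have e0: "0 \<le> e p" for p unfolding e_def by (intro integral_nonneg_AE) auto
  let ?\<eta> = "\<lambda>p. sqrt (e p) + 1 / real (Suc p)"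
  have int: "integrable M (\<lambda>x. iexp (U x))" if [measurable]: "U \<in> borel_measurable M" for U
    by (rule integrable_iexp) auto
  have "(\<lambda>p. (CLINT x|M. iexp (V p x)) - (CLINT x|M. iexp (Y x))) \<longlonglongrightarrow> 0"
  proof (rule Lim_null_comparison)
    show "eventually (\<lambda>p. norm ((CLINT x|M. iexp (V p x)) - (CLINT x|M. iexp (Y x))) \<le> ?\<eta> p + sqrt (e p)) sequentially"
      using ev
    proof eventually_elim
      case (elim p)
      have \<eta>: "?\<eta> p > 0" using e0[of p] by (intro add_nonneg_pos) auto
      have "norm ((CLINT x|M. iexp (V p x)) - (CLINT x|M. iexp (Y x))) = norm (CLINT x|M. iexp (V p x) - iexp (Y x))"
        by (subst Bochner_Integration.integral_diff) (auto intro!: int)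
      also have "\<dots> \<le> (\<integral>x. ?\<eta> p + (Y x - V p x)\<^sup>2 / ?\<eta> p \<partial>M)"
      proof (rule norm_integral_le)
        show "norm (iexp (V p x) - iexp (Y x)) \<le> ?\<eta> p + (Y x - V p x)\<^sup>2 / ?\<eta> p" for x
        proof -
          have "norm (iexp (V p x) - iexp (Y x)) \<le> \<bar>Y x - V p x\<bar>"
            using norm_iexp_diff_le[of "V p x" "Y x"] by (simp add: abs_minus_commute)
          also have "\<dots> \<le> 2 * \<bar>Y x - V p x\<bar>" by simp
          also have "\<dots> \<le> ?\<eta> p + (Y x - V p x)\<^sup>2 / ?\<eta> p"
            using two_mult_le_weighted[OF \<eta>, of 1 "Y x - V p x"] by simp
          finally show ?thesis .
        qed
      qed (use elim in \<open>auto intro!: Bochner_Integration.integrable_diff int\<close>)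
      also have "\<dots> = ?\<eta> p + e p / ?\<eta> p"
        using elim by (simp add: e_def prob_space)
      also have "\<dots> \<le> ?\<eta> p + sqrt (e p)"
        using div_sqrt_add_le[OF e0, of "1 / real (Suc p)" p] by simp
      finally show ?case .
    qed
    have "(\<lambda>p. ?\<eta> p + sqrt (e p)) \<longlonglongrightarrow> (sqrt 0 + 0) + sqrt 0"
      using LIMSEQ_inverse_real_of_nat by (intro tendsto_intros e) (simp add: inverse_eq_divide)
    then show "(\<lambda>p. ?\<eta> p + sqrt (e p)) \<longlonglongrightarrow> 0" by simp
  qed
  then show ?thesis using LIM_zero_iff by blast
qed

text \<open>The L2 closure of \<open>step_pair\<close>. Integrands live on the whole line, with the
  time horizon encoded as an indicator, so that integrals up to different times can be combined
  linearly.\<close>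

definition wiener_rel :: "'w measure \<Rightarrow> (real \<Rightarrow> 'w \<Rightarrow> real) \<Rightarrow> (real \<Rightarrow> real) \<Rightarrow> ('w \<Rightarrow> real) \<Rightarrow> bool" where
  "wiener_rel M W h Y \<longleftrightarrow> h \<in> borel_measurable borel \<and> Y \<in> borel_measurable M \<and>
    (\<exists>V s. (\<forall>p::nat. step_pair W (V p) (s p)) \<and>
      (\<lambda>p. \<integral>\<^sup>+u. ennreal ((h u - s p u)\<^sup>2) \<partial>lborel) \<longlonglongrightarrow> 0 \<and>
      (\<lambda>p. \<integral>\<^sup>+\<omega>. ennreal ((Y \<omega> - V p \<omega>)\<^sup>2) \<partial>M) \<longlonglongrightarrow> 0)"

lemma nn_integral_square_add_tendsto_0:
  fixes d d' :: "nat \<Rightarrow> 'a \<Rightarrow> real"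
  assumes [measurable]: "\<And>p. d p \<in> borel_measurable N" "\<And>p. d' p \<in> borel_measurable N"
    and "(\<lambda>p. \<integral>\<^sup>+x. ennreal ((d p x)\<^sup>2) \<partial>N) \<longlonglongrightarrow> 0" "(\<lambda>p. \<integral>\<^sup>+x. ennreal ((d' p x)\<^sup>2) \<partial>N) \<longlonglongrightarrow> 0"
  shows "(\<lambda>p. \<integral>\<^sup>+x. ennreal ((d p x + d' p x)\<^sup>2) \<partial>N) \<longlonglongrightarrow> 0"
proof (rule tendsto_sandwich[where f = "\<lambda>_. 0"])
  show "(\<lambda>p. 2 * (\<integral>\<^sup>+x. ennreal ((d p x)\<^sup>2) \<partial>N) + 2 * (\<integral>\<^sup>+x. ennreal ((d' p x)\<^sup>2) \<partial>N)) \<longlonglongrightarrow> 0"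
    using tendsto_add[OF ennreal_tendsto_cmult[OF _ assms(3), of 2] ennreal_tendsto_cmult[OF _ assms(4), of 2]] by simp
  show "eventually (\<lambda>p. (\<integral>\<^sup>+x. ennreal ((d p x + d' p x)\<^sup>2) \<partial>N) \<le> 2 * (\<integral>\<^sup>+x. ennreal ((d p x)\<^sup>2) \<partial>N) + 2 * (\<integral>\<^sup>+x. ennreal ((d' p x)\<^sup>2) \<partial>N)) sequentially"
  proof (intro always_eventually allI)
    fix p
    have "(\<integral>\<^sup>+x. ennreal ((d p x + d' p x)\<^sup>2) \<partial>N) \<le> (\<integral>\<^sup>+x. 2 * ennreal ((d p x)\<^sup>2) + 2 * ennreal ((d' p x)\<^sup>2) \<partial>N)"
    proof (rule nn_integral_mono)
      fix x
      have "(d p x + d' p x)\<^sup>2 \<le> 2 * (d p x)\<^sup>2 + 2 * (d' p x)\<^sup>2"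
        using zero_le_power2[of "d p x - d' p x"] by (simp add: power2_diff power2_sum)
      then have "ennreal ((d p x + d' p x)\<^sup>2) \<le> ennreal (2 * (d p x)\<^sup>2 + 2 * (d' p x)\<^sup>2)"
        by (rule ennreal_leI)
      then show "ennreal ((d p x + d' p x)\<^sup>2) \<le> 2 * ennreal ((d p x)\<^sup>2) + 2 * ennreal ((d' p x)\<^sup>2)"
        by (simp add: ennreal_plus ennreal_mult)
    qed
    then show "(\<integral>\<^sup>+x. ennreal ((d p x + d' p x)\<^sup>2) \<partial>N) \<le> 2 * (\<integral>\<^sup>+x. ennreal ((d p x)\<^sup>2) \<partial>N) + 2 * (\<integral>\<^sup>+x. ennreal ((d' p x)\<^sup>2) \<partial>N)"
      by (simp add: nn_integral_add nn_integral_cmult)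
  qed
qed auto

lemma wiener_rel_zero: "wiener_rel M W (\<lambda>_. 0) (\<lambda>_. 0)"
  unfolding wiener_rel_def using step_pair_zero[of W]
  by (intro conjI exI[of _ "\<lambda>_ _. 0"]) auto

lemma wiener_rel_add:
  assumes W: "\<And>t. t \<ge> 0 \<Longrightarrow> W t \<in> borel_measurable M"
    and "wiener_rel M W h Y" "wiener_rel M W h' Y'"
  shows "wiener_rel M W (\<lambda>u. h u + h' u) (\<lambda>\<omega>. Y \<omega> + Y' \<omega>)"
proof -
  from assms(2) obtain V s where 1: "h \<in> borel_measurable borel" "Y \<in> borel_measurable M" "\<And>p::nat. step_pair W (V p) (s p)"
     "(\<lambda>p. \<integral>\<^sup>+u. ennreal ((h u - s p u)\<^sup>2) \<partial>lborel) \<longlonglongrightarrow> 0" "(\<lambda>p. \<integral>\<^sup>+\<omega>. ennreal ((Y \<omega> - V p \<omega>)\<^sup>2) \<partial>M) \<longlonglongrightarrow> 0"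
    unfolding wiener_rel_def by auto
  from assms(3) obtain V' s' where 2: "h' \<in> borel_measurable borel" "Y' \<in> borel_measurable M" "\<And>p::nat. step_pair W (V' p) (s' p)"
     "(\<lambda>p. \<integral>\<^sup>+u. ennreal ((h' u - s' p u)\<^sup>2) \<partial>lborel) \<longlonglongrightarrow> 0" "(\<lambda>p. \<integral>\<^sup>+\<omega>. ennreal ((Y' \<omega> - V' p \<omega>)\<^sup>2) \<partial>M) \<longlonglongrightarrow> 0"
    unfolding wiener_rel_def by auto
  note m1 = step_pair_measurable[OF 1(3) W] and m2 = step_pair_measurable[OF 2(3) W]
  show ?thesis
    unfolding wiener_rel_def
  proof (intro conjI exI[of _ "\<lambda>p \<omega>. V p \<omega> + V' p \<omega>"] exI[of _ "\<lambda>p u. s p u + s' p u"] allI)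
    show "(\<lambda>p. \<integral>\<^sup>+u. ennreal ((h u + h' u - (s p u + s' p u))\<^sup>2) \<partial>lborel) \<longlonglongrightarrow> 0"
      using nn_integral_square_add_tendsto_0[of "\<lambda>p u. h u - s p u" lborel "\<lambda>p u. h' u - s' p u"] 1 2 m1 m2
      by (simp add: add_diff_add)
    show "(\<lambda>p. \<integral>\<^sup>+u. ennreal ((Y u + Y' u - (V p u + V' p u))\<^sup>2) \<partial>M) \<longlonglongrightarrow> 0"
      using nn_integral_square_add_tendsto_0[of "\<lambda>p u. Y u - V p u" M "\<lambda>p u. Y' u - V' p u"] 1 2 m1 m2
      by (simp add: add_diff_add)
  qed (use 1 2 in \<open>auto intro: step_pair_add\<close>)
qed

lemma wiener_rel_scale:
  assumes W: "\<And>t. t \<ge> 0 \<Longrightarrow> W t \<in> borel_measurable M" and "wiener_rel M W h Y"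
  shows "wiener_rel M W (\<lambda>u. a * h u) (\<lambda>\<omega>. a * Y \<omega>)"
proof -
  from assms(2) obtain V s where 1: "h \<in> borel_measurable borel" "Y \<in> borel_measurable M" "\<And>p::nat. step_pair W (V p) (s p)"
     "(\<lambda>p. \<integral>\<^sup>+u. ennreal ((h u - s p u)\<^sup>2) \<partial>lborel) \<longlonglongrightarrow> 0" "(\<lambda>p. \<integral>\<^sup>+\<omega>. ennreal ((Y \<omega> - V p \<omega>)\<^sup>2) \<partial>M) \<longlonglongrightarrow> 0"
    unfolding wiener_rel_def by auto
  note [measurable] = step_pair_measurable[OF 1(3) W] 1(1,2)
  have sc: "(\<integral>\<^sup>+x. ennreal ((a * f x - a * g x)\<^sup>2) \<partial>N) = ennreal (a\<^sup>2) * (\<integral>\<^sup>+x. ennreal ((f x - g x)\<^sup>2) \<partial>N)"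
    if [measurable]: "f \<in> borel_measurable N" "g \<in> borel_measurable N" for f g :: "'c \<Rightarrow> real" and N
    by (subst nn_integral_cmult[symmetric]) (auto simp: right_diff_distrib[symmetric] power_mult_distrib ennreal_mult)
  have z: "(\<lambda>p. ennreal (a\<^sup>2) * F p) \<longlonglongrightarrow> 0" if "F \<longlonglongrightarrow> 0" for F :: "nat \<Rightarrow> ennreal"
    using ennreal_tendsto_cmult[OF _ that, of "ennreal (a\<^sup>2)"] by simp
  show ?thesis
    unfolding wiener_rel_def
  proof (intro conjI exI[of _ "\<lambda>p \<omega>. a * V p \<omega>"] exI[of _ "\<lambda>p u. a * s p u"] allI)
    show "(\<lambda>p. \<integral>\<^sup>+u. ennreal ((a * h u - a * s p u)\<^sup>2) \<partial>lborel) \<longlonglongrightarrow> 0"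
      by (subst sc) (auto intro!: z 1)
    show "(\<lambda>p. \<integral>\<^sup>+u. ennreal ((a * Y u - a * V p u)\<^sup>2) \<partial>M) \<longlonglongrightarrow> 0"
      by (subst sc) (auto intro!: z 1)
  qed (use 1 in \<open>auto intro: step_pair_scale\<close>)
qed

lemma wiener_rel_sum:
  assumes W: "\<And>t. t \<ge> 0 \<Longrightarrow> W t \<in> borel_measurable M"
    and "finite L" and "\<And>l. l \<in> L \<Longrightarrow> wiener_rel M W (h l) (Y l)"
  shows "wiener_rel M W (\<lambda>u. \<Sum>l\<in>L. b l * h l u) (\<lambda>\<omega>. \<Sum>l\<in>L. b l * Y l \<omega>)"
  using assms(2,3)
  by (induction L rule: finite_induct)
    (auto simp: wiener_rel_zero intro!: wiener_rel_add wiener_rel_scale W)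

lemma wiener_rel_of_integral:
  assumes "is_wiener_integral M W t f J" and [measurable]: "f \<in> borel_measurable borel"
  shows "wiener_rel M W (\<lambda>u. indicator {0..t} u * f u) J"
proof -
  from assms(1) obtain m \<tau> c where 1: "J \<in> borel_measurable M" "\<And>p::nat. is_partition t (m p) (\<tau> p)"
    "(\<lambda>p. \<integral>\<^sup>+s\<in>{0..t}. ennreal ((f s - step_fun (m p) (\<tau> p) (c p) s)\<^sup>2) \<partial>lborel) \<longlonglongrightarrow> 0"
    "(\<lambda>p. \<integral>\<^sup>+\<omega>. ennreal ((J \<omega> - step_integral W (m p) (\<tau> p) (c p) \<omega>)\<^sup>2) \<partial>M) \<longlonglongrightarrow> 0"
    unfolding is_wiener_integral_def by auto
  \<comment> \<open>The step functions vanish outside [0, t], so extending the integrand by 0 leaves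
    the approximation error unchanged.\<close>
  have z: "step_fun (m p) (\<tau> p) (c p) u = 0" if u: "u \<notin> {0..t}" for p u
  proof -
    have P: "\<tau> p 0 = 0" "\<tau> p (m p) = t" "\<And>j. j < m p \<Longrightarrow> \<tau> p j \<le> \<tau> p (Suc j)"
      using 1(2)[of p] by (auto simp: is_partition_def)
    have mono: "\<tau> p i \<le> \<tau> p j" if "i \<le> j" "j \<le> m p" for i j
      using that
    proof (induction j rule: dec_induct)
      case (step j)
      then show ?case using P(3)[of j] by simp
    qed simp
    have "indicator {\<tau> p j<..\<tau> p (Suc j)} u = (0::real)" if "j < m p" for j
      using mono[of 0 j] mono[of "Suc j" "m p"] that u P(1,2) by (auto simp: indicator_def)
    then show ?thesis by (simp add: step_fun_def del: sum_mult_indicator)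
  qed
  have "(\<integral>\<^sup>+u. ennreal ((indicator {0..t} u * f u - step_fun (m p) (\<tau> p) (c p) u)\<^sup>2) \<partial>lborel) =
    (\<integral>\<^sup>+s\<in>{0..t}. ennreal ((f s - step_fun (m p) (\<tau> p) (c p) s)\<^sup>2) \<partial>lborel)" for p
    by (intro nn_integral_cong) (auto simp: z split: split_indicator)
  with 1 step_pair_step_integral[OF 1(2)] show ?thesis
    unfolding wiener_rel_def
    by (intro conjI exI[of _ "\<lambda>p. step_integral W (m p) (\<tau> p) (c p)"] exI[of _ "\<lambda>p. step_fun (m p) (\<tau> p) (c p)"]) auto
qed

text \<open>For step functions, independence factorises the characteristic function; the mean-square
  limit is then taken for the whole finite sum.\<close>

lemma wiener_sum_char:
  assumes "prob_space M" and fin: "finite K"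
    and W: "\<And>k. k \<in> K \<Longrightarrow> brownian_motion M (W k)"
    and ind: "prob_space.indep_vars M (\<lambda>_. PiM {0..} (\<lambda>_. borel)) (\<lambda>k \<omega>. restrict (\<lambda>t. W k t \<omega>) {0..}) K"
    and rel: "\<And>k. k \<in> K \<Longrightarrow> wiener_rel M (W k) (h k) (Y k)"
  shows "(CLINT \<omega>|M. iexp (\<Sum>k\<in>K. Y k \<omega>)) = of_real (exp (- (\<Sum>k\<in>K. \<integral>u. (h k u)\<^sup>2 \<partial>lborel) / 2))"
proof -
  interpret prob_space M by fact
  define Q where "Q k V s \<longleftrightarrow> (\<forall>p::nat. step_pair (W k) (V p) (s p)) \<and>
     (\<lambda>p. \<integral>\<^sup>+u. ennreal ((h k u - s p u)\<^sup>2) \<partial>lborel) \<longlonglongrightarrow> 0 \<and> (\<lambda>p. \<integral>\<^sup>+\<omega>. ennreal ((Y k \<omega> - V p \<omega>)\<^sup>2) \<partial>M) \<longlonglongrightarrow> 0"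
    for k V s
  have "\<forall>k\<in>K. \<exists>V s. Q k V s"
    using rel unfolding wiener_rel_def Q_def by blast
  then obtain V s where Q: "\<And>k. k \<in> K \<Longrightarrow> Q k (V k) (s k)" by metis
  have R: "h k \<in> borel_measurable borel" "Y k \<in> borel_measurable M" "step_pair (W k) (V k p) (s k p)"
    "(\<lambda>p. \<integral>\<^sup>+u. ennreal ((h k u - s k p u)\<^sup>2) \<partial>lborel) \<longlonglongrightarrow> 0"
    "(\<lambda>p. \<integral>\<^sup>+\<omega>. ennreal ((Y k \<omega> - V k p \<omega>)\<^sup>2) \<partial>M) \<longlonglongrightarrow> 0" if "k \<in> K" for k p
    using rel[OF that] Q[OF that] by (auto simp: wiener_rel_def Q_def)
  have Wm: "W k t \<in> borel_measurable M" if "k \<in> K" "t \<ge> 0" for k t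
    using W[OF that(1)] that(2) by (auto simp: brownian_motion_def)
  have Vm: "V k p \<in> borel_measurable M" and sm: "s k p \<in> borel_measurable borel" if "k \<in> K" for k p
    using step_pair_measurable[OF R(3)[OF that], of M] Wm[OF that] by auto
  have step: "(CLINT \<omega>|M. iexp (\<Sum>k\<in>K. V k p \<omega>)) = of_real (exp (- (\<Sum>k\<in>K. \<integral>u. (s k p u)\<^sup>2 \<partial>lborel) / 2))" for p
  proof -
    define R' where "R' k T c \<longleftrightarrow> finite T \<and> T \<subseteq> {0..} \<and> V k p = (\<lambda>\<omega>. \<Sum>t\<in>T. c t * (W k t \<omega> - W k 0 \<omega>))" for k T c
    have "\<forall>k\<in>K. \<exists>T c. R' k T c"
      using R(3)[of _ p] unfolding step_pair_def R'_def by blast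
    then obtain T c where "\<And>k. k \<in> K \<Longrightarrow> R' k (T k) (c k)" by metis
    then have T: "finite (T k)" "T k \<subseteq> {0..}" "V k p = (\<lambda>\<omega>. \<Sum>t\<in>T k. c k t * (W k t \<omega> - W k 0 \<omega>))" if "k \<in> K" for k
      using that by (auto simp: R'_def)
    \<comment> \<open>Each approximant depends on finitely many values of a path restricted to
      nonnegative times, so the independence of the path-valued variables carries over.\<close>
    have "indep_vars (\<lambda>_. borel) (\<lambda>k \<omega>. \<Sum>t\<in>T k. c k t * (restrict (\<lambda>t. W k t \<omega>) {0..} t - restrict (\<lambda>t. W k t \<omega>) {0..} 0)) K"
    proof (rule indep_vars_compose2[OF ind, where Y = "\<lambda>k w. \<Sum>t\<in>T k. c k t * (w t - w 0)"])
      fix k assume "k \<in> K"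
      then have "t \<in> T k \<Longrightarrow> t \<in> {0..}" for t using T(2) by auto
      then show "(\<lambda>w. \<Sum>t\<in>T k. c k t * (w t - w 0)) \<in> borel_measurable (PiM {0..} (\<lambda>_. borel))"
        by (intro borel_measurable_sum borel_measurable_times borel_measurable_diff
            borel_measurable_const measurable_component_singleton) auto
    qed
    also have "?this \<longleftrightarrow> indep_vars (\<lambda>_. borel) (\<lambda>k. V k p) K"
    proof (rule indep_vars_cong)
      fix k assume k: "k \<in> K"
      show "(\<lambda>\<omega>. \<Sum>t\<in>T k. c k t * (restrict (\<lambda>t. W k t \<omega>) {0..} t - restrict (\<lambda>t. W k t \<omega>) {0..} 0)) = V k p"
        unfolding T(3)[OF k] using T(2)[OF k] by (intro ext sum.cong) auto
    qed auto
    finally have "char (distr M borel (\<lambda>\<omega>. \<Sum>k\<in>K. V k p \<omega>)) 1 = (\<Prod>k\<in>K. char (distr M borel (V k p)) 1)"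
      by (rule char_distr_sum)
    also have "\<dots> = (\<Prod>k\<in>K. of_real (exp (- (\<integral>u. (s k p u)\<^sup>2 \<partial>lborel) / 2)))"
    proof (intro prod.cong refl)
      fix k assume k: "k \<in> K"
      have "char (distr M borel (V k p)) 1 = (CLINT \<omega>|M. iexp (V k p \<omega>))"
        unfolding char_def by (subst integral_distr) (use Vm[OF k] in auto)
      then show "char (distr M borel (V k p)) 1 = of_real (exp (- (\<integral>u. (s k p u)\<^sup>2 \<partial>lborel) / 2))"
        using step_pair_char(1)[OF assms(1) W[OF k] R(3)[OF k]] by simp
    qed
    also have "char (distr M borel (\<lambda>\<omega>. \<Sum>k\<in>K. V k p \<omega>)) 1 = (CLINT \<omega>|M. iexp (\<Sum>k\<in>K. V k p \<omega>))"
      unfolding char_def by (subst integral_distr) (use Vm in \<open>auto intro!: borel_measurable_sum\<close>)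
    finally show ?thesis
      using exp_sum[OF fin, of "\<lambda>k. - (\<integral>u. (s k p u)\<^sup>2 \<partial>lborel) / 2"]
      by (simp add: sum_negf sum_divide_distrib flip: of_real_prod)
  qed
  have "(\<lambda>p. \<integral>\<^sup>+\<omega>. ennreal (((\<Sum>k\<in>K'. Y k \<omega>) - (\<Sum>k\<in>K'. V k p \<omega>))\<^sup>2) \<partial>M) \<longlonglongrightarrow> 0" if "K' \<subseteq> K" for K'
    using finite_subset[OF that fin] that
  proof (induction K' rule: finite_induct)
    case (insert k K')
    have "(\<lambda>p. \<integral>\<^sup>+\<omega>. ennreal (((Y k \<omega> - V k p \<omega>) + ((\<Sum>k\<in>K'. Y k \<omega>) - (\<Sum>k\<in>K'. V k p \<omega>)))\<^sup>2) \<partial>M) \<longlonglongrightarrow> 0"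
      using insert Vm R by (intro nn_integral_square_add_tendsto_0) (auto intro!: borel_measurable_diff borel_measurable_sum)
    then show ?case using insert by (simp add: algebra_simps)
  qed simp
  from integral_iexp_tendsto[OF assms(1) _ _ this[OF subset_refl]]
  have "(\<lambda>p. CLINT \<omega>|M. iexp (\<Sum>k\<in>K. V k p \<omega>)) \<longlonglongrightarrow> (CLINT \<omega>|M. iexp (\<Sum>k\<in>K. Y k \<omega>))"
    using Vm R(2) by auto
  moreover have "(\<lambda>p. complex_of_real (exp (- (\<Sum>k\<in>K. \<integral>u. (s k p u)\<^sup>2 \<partial>lborel) / 2))) \<longlonglongrightarrow>
     of_real (exp (- (\<Sum>k\<in>K. \<integral>u. (h k u)\<^sup>2 \<partial>lborel) / 2))"
    by (intro tendsto_intros integral_square_tendsto(2))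
      (use R sm step_pair_char(2)[OF assms(1) W R(3)] in auto)
  ultimately show ?thesis
    unfolding step by (rule LIMSEQ_unique)
qed

text \<open>2 (1 - cos(t Y)) / t^2 tends to Y^2 as t tends to 0, and its expectation is 2 (1 -
  exp(-t^2 v / 2)) / t^2, at most v. Fatou's lemma then gives the second moment, whose finiteness is
  part of the conclusion.\<close>

lemma nn_integral_square_le_of_char:
  assumes "prob_space M" and [measurable]: "Y \<in> borel_measurable M"
    and char: "\<And>t. (CLINT \<omega>|M. iexp (t * Y \<omega>)) = of_real (exp (- t\<^sup>2 * v / 2))"
  shows "(\<integral>\<^sup>+\<omega>. ennreal ((Y \<omega>)\<^sup>2) \<partial>M) \<le> ennreal v"
proof -
  interpret prob_space M by fact
  define t where "t n = 1 / real (Suc n)" for n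
  have t: "t n > 0" for n by (simp add: t_def)
  have t0: "t \<longlonglongrightarrow> 0" unfolding t_def using LIMSEQ_inverse_real_of_nat by (simp add: inverse_eq_divide)
  let ?f = "\<lambda>n \<omega>. 2 * (1 - cos (t n * Y \<omega>)) / (t n)\<^sup>2"
  have lim: "(\<lambda>n. ?f n \<omega>) \<longlonglongrightarrow> (Y \<omega>)\<^sup>2" for \<omega>
  proof -
    have "((\<lambda>s. 2 * (1 - cos (s * a)) / s\<^sup>2) \<longlongrightarrow> a\<^sup>2) (at_right 0)" for a :: real
      unfolding power2_eq_square[of a] by real_asymp
    moreover have "filterlim t (at_right 0) sequentially"
      using t t0 less_imp_neq[OF t] by (auto simp: filterlim_at intro!: always_eventually)
    ultimately show ?thesis by (rule filterlim_compose)
  qed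
  have bound: "(\<integral>\<^sup>+\<omega>. ennreal (?f n \<omega>) \<partial>M) \<le> ennreal v" for n
  proof -
    have int: "integrable M (\<lambda>\<omega>. cos (t n * Y \<omega>))"
      by (rule integrable_const_bound[where B = 1]) auto
    have "(\<integral>\<omega>. cos (t n * Y \<omega>) \<partial>M) = (\<integral>\<omega>. Re (iexp (t n * Y \<omega>)) \<partial>M)"
      by (intro Bochner_Integration.integral_cong refl) (simp add: Re_exp)
    also have "\<dots> = Re (CLINT \<omega>|M. iexp (t n * Y \<omega>))"
      by (rule integral_Re) (rule integrable_iexp, auto)
    also have "\<dots> = exp (- (t n)\<^sup>2 * v / 2)" unfolding char by simp
    finally have c: "(\<integral>\<omega>. cos (t n * Y \<omega>) \<partial>M) = exp (- (t n)\<^sup>2 * v / 2)" .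
    have "(\<integral>\<^sup>+\<omega>. ennreal (?f n \<omega>) \<partial>M) = ennreal (\<integral>\<omega>. ?f n \<omega> \<partial>M)"
      by (intro nn_integral_eq_integral) (use int in auto)
    also have "(\<integral>\<omega>. ?f n \<omega> \<partial>M) = 2 * (1 - exp (- (t n)\<^sup>2 * v / 2)) / (t n)\<^sup>2"
      using int by (simp add: c prob_space)
    also have "\<dots> \<le> v"
    proof -
      have "1 - exp (- (t n)\<^sup>2 * v / 2) \<le> (t n)\<^sup>2 * v / 2"
        using exp_ge_add_one_self[of "- (t n)\<^sup>2 * v / 2"] by simp
      then show ?thesis using t[of n] by (simp add: pos_divide_le_eq mult.commute)
    qed
    finally show ?thesis by (simp add: ennreal_leI)
  qed
  have "(\<integral>\<^sup>+\<omega>. ennreal ((Y \<omega>)\<^sup>2) \<partial>M) = (\<integral>\<^sup>+\<omega>. liminf (\<lambda>n. ennreal (?f n \<omega>)) \<partial>M)"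
    by (intro nn_integral_cong lim_imp_Liminf[symmetric] tendsto_ennrealI lim) simp
  also have "\<dots> \<le> liminf (\<lambda>n. \<integral>\<^sup>+\<omega>. ennreal (?f n \<omega>) \<partial>M)"
    by (rule nn_integral_liminf) measurable
  also have "\<dots> \<le> limsup (\<lambda>n. \<integral>\<^sup>+\<omega>. ennreal (?f n \<omega>) \<partial>M)" by (rule Liminf_le_Limsup) simp
  also have "\<dots> \<le> ennreal v" by (rule Limsup_bounded) (use bound in auto)
  finally show ?thesis .
qed

definition expint :: "real \<Rightarrow> real \<Rightarrow> real" where
  "expint \<mu> x = (if \<mu> = 0 then x else (1 - exp (- \<mu> * x)) / \<mu>)"

lemma has_real_derivative_expint [derivative_intros]:
  assumes "(f has_real_derivative f') (at x within S)"
  shows "((\<lambda>x. expint \<mu> (f x)) has_real_derivative (exp (- \<mu> * f x) * f')) (at x within S)"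
  using assms unfolding expint_def
  by (cases "\<mu> = 0") (auto intro!: derivative_eq_intros)

text \<open>Up to the factor \<sigma>^2 / 2, the covariance of a stochastic convolution started at
  0: for nonzero \<mu> it equals (exp(-\<mu> |s - t|) - exp(-\<mu> (s + t))) / \<mu>. Written with
  \<open>expint\<close> it separates s + t from |s - t|, the source of the Hankel and the Toeplitz
  part.\<close>

definition expcov :: "real \<Rightarrow> real \<Rightarrow> real \<Rightarrow> real" where
  "expcov \<mu> s t = expint \<mu> (s + t) - expint \<mu> \<bar>s - t\<bar>"

lemma integral_exp_kernel:
  fixes \<mu> \<sigma> s t :: real
  assumes st: "0 \<le> s" "0 \<le> t"
  defines "h \<equiv> \<lambda>t u. indicator {0..t} u * (exp (- \<mu> * (t - u)) * \<sigma>)"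
  shows "integrable lborel (\<lambda>u. h s u * h t u)"
    and "(\<integral>u. h s u * h t u \<partial>lborel) = \<sigma>\<^sup>2 / 2 * expcov \<mu> s t"
proof -
  define m where "m = min s t"
  have m: "0 \<le> m" using st by (simp add: m_def)
  let ?f = "\<lambda>u. \<sigma>\<^sup>2 * exp (- \<mu> * (s + t - 2 * u))"
  have eq: "(\<lambda>u. h s u * h t u) = (\<lambda>u. ?f u * indicator {0..m} u)"
    by (auto simp: h_def m_def fun_eq_iff power2_eq_square algebra_simps split: split_indicator
      simp flip: exp_add)
  have int: "set_integrable lborel {0..m} ?f"
    by (rule borel_integrable_atLeastAtMost') (auto intro!: continuous_intros)
  then show "integrable lborel (\<lambda>u. h s u * h t u)"
    unfolding eq set_integrable_def by (simp add: mult.commute)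
  \<comment> \<open>The kernels overlap on [0, min s t]. A primitive expressed by
    \<open>expint\<close> covers \<mu> = 0 without a case distinction.\<close>
  have "(\<integral>u. ?f u * indicator {0..m} u \<partial>lborel) = - \<sigma>\<^sup>2 / 2 * expint \<mu> (s + t - 2 * m) - (- \<sigma>\<^sup>2 / 2 * expint \<mu> (s + t - 2 * 0))"
    using m by (rule integral_FTC_Icc_real) (auto intro!: derivative_eq_intros)
  moreover have "s + t - 2 * m = \<bar>s - t\<bar>" by (auto simp: m_def)
  ultimately show "(\<integral>u. h s u * h t u \<partial>lborel) = \<sigma>\<^sup>2 / 2 * expcov \<mu> s t"
    unfolding eq expcov_def by (simp only:) (simp add: right_diff_distrib)
qed

text \<open>A linear combination within one coordinate is again a Wiener integral, of the combined
  kernel \<open>H k\<close>, and the squared L2 norm of that kernel is the covariance form.\<close>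

lemma coordinates_char:
  fixes \<mu> :: "nat \<Rightarrow> real" and g :: "nat \<Rightarrow> real" and b \<tau> :: "'l \<Rightarrow> real"
  assumes M: "prob_space M" and noise: "driving_noise M \<theta>1 \<theta>2 W \<xi>"
    and J: "\<And>k t. k \<ge> 1 \<Longrightarrow> t \<ge> 0 \<Longrightarrow> is_wiener_integral M (W k) t (\<lambda>s. exp (- \<mu> k * (t - s)) * \<sigma>) (J k t)"
    and K: "finite K" "K \<subseteq> {1..}" and L: "finite L" and \<tau>: "\<And>l. l \<in> L \<Longrightarrow> 0 \<le> \<tau> l"
  shows "(CLINT \<omega>|M. iexp (\<Sum>k\<in>K. g k * (\<Sum>l\<in>L. b l * J k (\<tau> l) \<omega>))) =
    of_real (exp (- (\<Sum>k\<in>K. (g k)\<^sup>2 * (\<sigma>\<^sup>2 / 2 * (\<Sum>l\<in>L. \<Sum>m\<in>L. b l * b m * expcov (\<mu> k) (\<tau> l) (\<tau> m)))) / 2))"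
proof -
  define h where "h k t u = indicator {0..t} u * (exp (- \<mu> k * (t - u)) * \<sigma>)" for k t u
  define H where "H k u = g k * (\<Sum>l\<in>L. b l * h k (\<tau> l) u)" for k u
  have W: "brownian_motion M (W k)" if "k \<in> K" for k
    using noise that K(2) unfolding driving_noise_def by auto
  have Wm: "W k t \<in> borel_measurable M" if "k \<in> K" "t \<ge> 0" for k t
    using W[OF that(1)] that(2) by (simp add: brownian_motion_def)
  have ind: "prob_space.indep_vars M (\<lambda>_. PiM {0..} (\<lambda>_. borel)) (\<lambda>k \<omega>. restrict (\<lambda>t. W k t \<omega>) {0..}) K"
    using noise prob_space.indep_vars_subset[OF M _ K(2)] unfolding driving_noise_def by blast
  have rel: "wiener_rel M (W k) (H k) (\<lambda>\<omega>. g k * (\<Sum>l\<in>L. b l * J k (\<tau> l) \<omega>))" if k: "k \<in> K" for k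
  proof -
    have "wiener_rel M (W k) (h k (\<tau> l)) (J k (\<tau> l))" if "l \<in> L" for l
      unfolding h_def using k K(2) \<tau>[OF that]
      by (intro wiener_rel_of_integral J) auto
    then show ?thesis
      unfolding H_def[abs_def] by (intro wiener_rel_scale wiener_rel_sum Wm[OF k] L)
  qed
  have "(\<integral>u. (H k u)\<^sup>2 \<partial>lborel) = (g k)\<^sup>2 * (\<sigma>\<^sup>2 / 2 * (\<Sum>l\<in>L. \<Sum>m\<in>L. b l * b m * expcov (\<mu> k) (\<tau> l) (\<tau> m)))" for k
  proof -
    have I: "integrable lborel (\<lambda>u. h k (\<tau> l) u * h k (\<tau> m) u)"
      "(\<integral>u. h k (\<tau> l) u * h k (\<tau> m) u \<partial>lborel) = \<sigma>\<^sup>2 / 2 * expcov (\<mu> k) (\<tau> l) (\<tau> m)" if "l \<in> L" "m \<in> L" for l m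
      unfolding h_def using integral_exp_kernel[of "\<tau> l" "\<tau> m" "\<mu> k" \<sigma>] \<tau> that by auto
    have "(H k u)\<^sup>2 = (\<Sum>l\<in>L. \<Sum>m\<in>L. (g k)\<^sup>2 * (b l * b m) * (h k (\<tau> l) u * h k (\<tau> m) u))" for u
      unfolding H_def power_mult_distrib power2_eq_square[of "\<Sum>l\<in>L. b l * h k (\<tau> l) u"] sum_product
      by (simp add: sum_distrib_left mult_ac)
    then have "(\<integral>u. (H k u)\<^sup>2 \<partial>lborel) = (\<Sum>l\<in>L. \<Sum>m\<in>L. (g k)\<^sup>2 * (b l * b m) * (\<sigma>\<^sup>2 / 2 * expcov (\<mu> k) (\<tau> l) (\<tau> m)))"
      by (simp only: I Bochner_Integration.integral_sum Bochner_Integration.integrable_sum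
          integrable_mult_right integral_mult_right_zero cong: sum.cong)
    then show ?thesis by (simp add: sum_distrib_left mult_ac)
  qed
  with wiener_sum_char[OF M K(1) W ind rel] show ?thesis by simp
qed

section \<open>Small-time asymptotics of the heat kernel on the diagonal\<close>

text \<open>Only differences and the derivative of this function enter, so any primitive
  serves.\<close>

definition gauss_antideriv :: "real \<Rightarrow> real \<Rightarrow> real" where
  "gauss_antideriv s = (SOME F. \<forall>x. (F has_real_derivative exp (- s * x\<^sup>2)) (at x))"

lemma gauss_antideriv: "(gauss_antideriv s has_real_derivative exp (- s * x\<^sup>2)) (at x)"
proof -
  have "\<exists>F. \<forall>x::real. - \<infinity> < ereal x \<longrightarrow> ereal x < \<infinity> \<longrightarrow> (F has_vector_derivative exp (- s * x\<^sup>2)) (at x)"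
    by (rule einterval_antiderivative) (auto intro!: continuous_intros)
  then have "\<exists>F. \<forall>x. (F has_real_derivative exp (- s * x\<^sup>2)) (at x)"
    by (simp add: has_real_derivative_iff_has_vector_derivative)
  then show ?thesis unfolding gauss_antideriv_def by (rule someI2_ex) blast
qed

lemma gauss_antideriv_tendsto:
  assumes s: "s > 0"
  shows "(\<lambda>n. gauss_antideriv s (real n) - gauss_antideriv s 0) \<longlonglongrightarrow> sqrt (pi / s) / 2"
proof -
  define f where "f x = indicator {0..} x *\<^sub>R exp (- s * x\<^sup>2)" for x :: real
  have "has_bochner_integral lborel (\<lambda>x. indicator {0..} (0 + sqrt s * x) *\<^sub>R exp (- (0 + sqrt s * x)\<^sup>2)) ((sqrt pi / 2) /\<^sub>R \<bar>sqrt s\<bar>)"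
    using s by (intro lborel_has_bochner_integral_real_affine_iff[THEN iffD1] gaussian_moment_0) auto
  moreover have "(\<lambda>x. indicator {0..} (0 + sqrt s * x) *\<^sub>R exp (- (0 + sqrt s * x)\<^sup>2)) = f"
    using s by (auto simp: f_def fun_eq_iff indicator_def zero_le_mult_iff power_mult_distrib)
  moreover have "(sqrt pi / 2) /\<^sub>R \<bar>sqrt s\<bar> = sqrt (pi / s) / 2"
    using s by (simp add: real_sqrt_divide field_simps)
  ultimately have f: "has_bochner_integral lborel f (sqrt (pi / s) / 2)" by simp
  have "((\<lambda>y. \<integral>x. indicator {..y} x *\<^sub>R f x \<partial>lborel) \<longlongrightarrow> (\<integral>x. f x \<partial>lborel)) at_top"
    using f by (intro tendsto_integral_at_top) (auto simp: has_bochner_integral_iff)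
  then have "(\<lambda>n. \<integral>x. indicator {..real n} x *\<^sub>R f x \<partial>lborel) \<longlonglongrightarrow> sqrt (pi / s) / 2"
    using has_bochner_integral_integral_eq[OF f] by (auto dest: filterlim_compose[OF _ filterlim_real_sequentially])
  moreover have "(\<integral>x. indicator {..real n} x *\<^sub>R f x \<partial>lborel) = gauss_antideriv s (real n) - gauss_antideriv s 0" for n
  proof -
    have "(\<integral>x. indicator {..real n} x *\<^sub>R f x \<partial>lborel) = (\<integral>x. exp (- s * x\<^sup>2) * indicator {0..real n} x \<partial>lborel)"
      by (intro Bochner_Integration.integral_cong) (auto simp: f_def indicator_def)
    also have "\<dots> = gauss_antideriv s (real n) - gauss_antideriv s 0"
      by (rule integral_FTC_Icc_real) (auto intro: gauss_antideriv[simplified])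
    finally show ?thesis .
  qed
  ultimately show ?thesis by simp
qed

section \<open>Comparison of Gaussian sums with Gaussian integrals\<close>

lemma gauss_antideriv_mono: "x \<le> y \<Longrightarrow> gauss_antideriv s x \<le> gauss_antideriv s y"
  by (rule DERIV_nonneg_imp_nondecreasing) (use gauss_antideriv in \<open>force+\<close>)

lemma gauss_antideriv_le:
  assumes "s > 0"
  shows "gauss_antideriv s (real n) - gauss_antideriv s 0 \<le> sqrt (pi / s) / 2"
proof (rule LIMSEQ_le_const[OF gauss_antideriv_tendsto[OF assms]])
  show "\<exists>N. \<forall>m\<ge>N. gauss_antideriv s (real n) - gauss_antideriv s 0 \<le> gauss_antideriv s (real m) - gauss_antideriv s 0"
    by (intro exI[of _ n] allI impI diff_right_mono gauss_antideriv_mono) simp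
qed

text \<open>The term k + 1 is at most the integral over [k, k + 1] by monotonicity; the summand 1 is
  the term k = 0.\<close>

lemma sum_gauss_le:
  assumes s: "s > 0"
  shows "(\<Sum>k<n. exp (- s * (real k)\<^sup>2)) \<le> 1 + sqrt (pi / s) / 2"
proof (cases n)
  case (Suc m)
  have "exp (- s * (real (Suc k))\<^sup>2) \<le> gauss_antideriv s (real (Suc k)) - gauss_antideriv s (real k)" for k
  proof -
    obtain z where z: "real k < z" "z < real (Suc k)"
      "gauss_antideriv s (real (Suc k)) - gauss_antideriv s (real k) = (real (Suc k) - real k) * exp (- s * z\<^sup>2)"
      using MVT2[of "real k" "real (Suc k)" "gauss_antideriv s" "\<lambda>x. exp (- s * x\<^sup>2)"] gauss_antideriv by auto
    have "z\<^sup>2 \<le> (real (Suc k))\<^sup>2" using z by (intro power_mono) auto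
    then show ?thesis using z(3) s by (simp add: mult_left_mono)
  qed
  then have "(\<Sum>k<m. exp (- s * (real (Suc k))\<^sup>2)) \<le> (\<Sum>k<m. gauss_antideriv s (real (Suc k)) - gauss_antideriv s (real k))"
    by (intro sum_mono)
  also have "\<dots> \<le> sqrt (pi / s) / 2"
    using gauss_antideriv_le[OF s, of m] by (simp add: sum_lessThan_telescope[of "\<lambda>k. gauss_antideriv s (real k)"] del: of_nat_Suc)
  finally show ?thesis unfolding Suc sum.lessThan_Suc_shift by simp
qed (use s in simp)

lemma summable_gauss: "s > 0 \<Longrightarrow> summable (\<lambda>k. exp (- s * (real k)\<^sup>2))"
  by (rule summableI_nonneg_bounded[OF _ sum_gauss_le]) auto

text \<open>Half of the Gaussian decay absorbs the polynomial factor, through 1 + 2 v <= 2 exp(v /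
  2) with v = s x^2.\<close>

lemma gauss_second_deriv:
  fixes s x k :: real
  assumes s: "s > 0" and x: "0 \<le> k" "k \<le> x"
  shows "\<bar>(4 * s\<^sup>2 * x\<^sup>2 - 2 * s) * exp (- s * x\<^sup>2)\<bar> \<le> 4 * s * exp (- (s/2) * k\<^sup>2)"
proof -
  define v where "v = s * x\<^sup>2"
  have v: "0 \<le> v" using s by (simp add: v_def)
  have "1 + 2 * v \<le> 2 * (1 + v/2 + (v/2)\<^sup>2/2)"
    using zero_le_power2[of "v/2 - 1"] by (simp add: power2_diff power_divide)
  also have "\<dots> \<le> 2 * exp (v/2)"
    using exp_lower_Taylor_quadratic[of "v/2"] v by simp
  finally have e: "1 + 2 * v \<le> 2 * exp (v/2)" .
  have "\<bar>(4 * s\<^sup>2 * x\<^sup>2 - 2 * s) * exp (- s * x\<^sup>2)\<bar> = 2 * s * \<bar>2 * v - 1\<bar> * exp (- v)"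
  proof -
    have "4 * s\<^sup>2 * x\<^sup>2 - 2 * s = 2 * s * (2 * v - 1)" by (simp add: v_def power2_eq_square algebra_simps)
    then show ?thesis using s by (simp add: v_def abs_mult)
  qed
  also have "\<dots> \<le> 2 * s * (2 * exp (v/2)) * exp (- v)"
    using s v e by (intro mult_right_mono mult_left_mono) auto
  also have "\<dots> = 4 * s * exp (- v/2)"
    by (simp add: mult.assoc flip: exp_add)
  also have "\<dots> \<le> 4 * s * exp (- (s/2) * k\<^sup>2)"
    using s x power_mono[OF x(2,1), of 2] by (simp add: v_def mult_left_mono)
  finally show ?thesis .
qed

lemma gauss_derivs:
  "((\<lambda>x. exp (- s * x\<^sup>2)) has_real_derivative (- 2 * s * x * exp (- s * x\<^sup>2))) (at x)"
  "((\<lambda>x. - 2 * s * x * exp (- s * x\<^sup>2)) has_real_derivative ((4 * s\<^sup>2 * x\<^sup>2 - 2 * s) * exp (- s * x\<^sup>2))) (at x)"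
  by (auto intro!: derivative_eq_intros simp: power2_eq_square algebra_simps)

text \<open>Taylor expansions on [k, k + 1]: from the left end, from the right end, and of the
  primitive. All remainders carry the same Gaussian factor in the left end k, so that sums of errors
  reduce to \<open>gauss_error_sum\<close>.\<close>

lemma gauss_Taylor:
  assumes s: "s > 0"
  shows "\<bar>exp (- s * (real (Suc k))\<^sup>2) - exp (- s * (real k)\<^sup>2) - (- 2 * s * real k * exp (- s * (real k)\<^sup>2))\<bar> \<le> 2 * s * exp (- (s/2) * (real k)\<^sup>2)"
    and "\<bar>exp (- s * (real k)\<^sup>2) - exp (- s * (real (Suc k))\<^sup>2) + (- 2 * s * real (Suc k) * exp (- s * (real (Suc k))\<^sup>2))\<bar> \<le> 2 * s * exp (- (s/2) * (real k)\<^sup>2)"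
    and "\<bar>gauss_antideriv s (real (Suc k)) - gauss_antideriv s (real k) - exp (- s * (real k)\<^sup>2) - (- 2 * s * real k * exp (- s * (real k)\<^sup>2)) / 2\<bar> \<le> s * exp (- (s/2) * (real k)\<^sup>2)"
proof -
  define q where "q x = exp (- s * x\<^sup>2)" for x :: real
  define q1 where "q1 x = - 2 * s * x * exp (- s * x\<^sup>2)" for x :: real
  define q2 where "q2 x = (4 * s\<^sup>2 * x\<^sup>2 - 2 * s) * exp (- s * x\<^sup>2)" for x :: real
  have b: "\<bar>q2 x\<bar> \<le> 4 * s * exp (- (s/2) * (real k)\<^sup>2)" if "real k \<le> x" for x
    unfolding q2_def using gauss_second_deriv[OF s _ that] by simp
  define dq where "dq = (\<lambda>m::nat. if m = 0 then q else if m = 1 then q1 else q2)"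
  define dF where "dF = (\<lambda>m::nat. if m = 0 then gauss_antideriv s else if m = 1 then q else if m = 2 then q1 else q2)"
  have Dq: "DERIV (dq m) t :> dq (Suc m) t" if "m < 2" for m t
  proof -
    have "m = 0 \<or> m = 1" using that by auto
    then show ?thesis using gauss_derivs[where x = t and s = s]
      by (auto simp: dq_def q_def[abs_def] q1_def[abs_def] q2_def)
  qed
  have DF: "DERIV (dF m) t :> dF (Suc m) t" if "m < 3" for m t
  proof -
    have "m = 0 \<or> m = 1 \<or> m = 2" using that by auto
    then show ?thesis using gauss_derivs[where x = t and s = s] gauss_antideriv[of s t]
      by (auto simp: dF_def q_def[abs_def] q1_def[abs_def] q2_def)
  qed
  have "\<exists>t>real k. t < real (Suc k) \<and> q (real (Suc k)) = (\<Sum>m<2. dq m (real k) / fact m * (real (Suc k) - real k) ^ m) + dq 2 t / fact 2 * (real (Suc k) - real k) ^ 2"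
    by (rule Taylor_up[where a = "real k"]) (auto simp: Dq, simp add: dq_def)
  then obtain t where "t > real k" "q (real (Suc k)) = q (real k) + q1 (real k) + q2 t / 2"
    by (auto simp: dq_def numeral_2_eq_2)
  then have "\<bar>q (real (Suc k)) - q (real k) - q1 (real k)\<bar> \<le> 2 * s * exp (- (s/2) * (real k)\<^sup>2)"
    using b[of t] by simp
  then show "\<bar>exp (- s * (real (Suc k))\<^sup>2) - exp (- s * (real k)\<^sup>2) - (- 2 * s * real k * exp (- s * (real k)\<^sup>2))\<bar> \<le> 2 * s * exp (- (s/2) * (real k)\<^sup>2)"
    unfolding q_def q1_def .
  have "\<exists>t>real k. t < real (Suc k) \<and> q (real k) = (\<Sum>m<2. dq m (real (Suc k)) / fact m * (real k - real (Suc k)) ^ m) + dq 2 t / fact 2 * (real k - real (Suc k)) ^ 2"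
    by (rule Taylor_down[where b = "real (Suc k)"]) (auto simp: Dq, simp add: dq_def)
  then obtain t where "t > real k" "q (real k) = q (real (Suc k)) - q1 (real (Suc k)) + q2 t / 2"
    by (auto simp: dq_def numeral_2_eq_2)
  then have "\<bar>q (real k) - q (real (Suc k)) + q1 (real (Suc k))\<bar> \<le> 2 * s * exp (- (s/2) * (real k)\<^sup>2)"
    using b[of t] by simp
  then show "\<bar>exp (- s * (real k)\<^sup>2) - exp (- s * (real (Suc k))\<^sup>2) + (- 2 * s * real (Suc k) * exp (- s * (real (Suc k))\<^sup>2))\<bar> \<le> 2 * s * exp (- (s/2) * (real k)\<^sup>2)"
    unfolding q_def q1_def .
  have "\<exists>t>real k. t < real (Suc k) \<and> gauss_antideriv s (real (Suc k)) = (\<Sum>m<3. dF m (real k) / fact m * (real (Suc k) - real k) ^ m) + dF 3 t / fact 3 * (real (Suc k) - real k) ^ 3"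
    by (rule Taylor_up[where a = "real k"]) (auto simp: DF, simp add: dF_def)
  then obtain t where t: "t > real k" "gauss_antideriv s (real (Suc k)) = gauss_antideriv s (real k) + q (real k) + q1 (real k) / 2 + q2 t / 6"
    by (auto simp: dF_def numeral_2_eq_2 numeral_3_eq_3)
  have "\<bar>q2 t / 6\<bar> \<le> s * exp (- (s/2) * (real k)\<^sup>2)"
    using b[of t] t(1) s by simp
  then have "\<bar>gauss_antideriv s (real (Suc k)) - gauss_antideriv s (real k) - q (real k) - q1 (real k) / 2\<bar> \<le> s * exp (- (s/2) * (real k)\<^sup>2)"
    unfolding t(2) by simp
  then show "\<bar>gauss_antideriv s (real (Suc k)) - gauss_antideriv s (real k) - exp (- s * (real k)\<^sup>2) - (- 2 * s * real k * exp (- s * (real k)\<^sup>2)) / 2\<bar> \<le> s * exp (- (s/2) * (real k)\<^sup>2)"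
    unfolding q_def q1_def .
qed

text \<open>In the trapezoidal rule the first-derivative terms cancel, leaving an error of order s
  per interval with Gaussian decay, hence O(sqrt s) in total.\<close>

lemma gauss_trapezoid:
  assumes s: "s > 0"
  shows "\<bar>gauss_antideriv s (real (Suc k)) - gauss_antideriv s (real k) - (exp (- s * (real k)\<^sup>2) + exp (- s * (real (Suc k))\<^sup>2)) / 2\<bar> \<le> 2 * s * exp (- (s/2) * (real k)\<^sup>2)"
proof -
  have *: "\<bar>F1 - F0 - (q0 + q1) / 2\<bar> \<le> 2 * s * r"
    if "\<bar>q1 - q0 - d\<bar> \<le> 2 * s * r" "\<bar>F1 - F0 - q0 - d / 2\<bar> \<le> s * r" for F0 F1 q0 q1 d r :: real
  proof -
    have "F1 - F0 - (q0 + q1) / 2 = (F1 - F0 - q0 - d / 2) - (q1 - q0 - d) / 2" by (simp add: field_simps)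
    then have "\<bar>F1 - F0 - (q0 + q1) / 2\<bar> \<le> \<bar>F1 - F0 - q0 - d / 2\<bar> + \<bar>q1 - q0 - d\<bar> / 2"
      using abs_triangle_ineq4[of "F1 - F0 - q0 - d / 2" "(q1 - q0 - d) / 2"] by simp
    also have "\<dots> \<le> s * r + (2 * s * r) / 2" using that by (intro add_mono divide_right_mono) auto
    finally show ?thesis by (simp add: mult_ac)
  qed
  show ?thesis by (rule *[OF gauss_Taylor(1,3)[OF s, of k]])
qed

lemma gauss_second_difference:
  assumes s: "s > 0"
  shows "\<bar>2 * exp (- s * (real (Suc k))\<^sup>2) - exp (- s * (real k)\<^sup>2) - exp (- s * (real (Suc (Suc k)))\<^sup>2)\<bar> \<le> 4 * s * exp (- (s/2) * (real k)\<^sup>2)"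
proof -
  have "exp (- (s/2) * (real (Suc k))\<^sup>2) \<le> exp (- (s/2) * (real k)\<^sup>2)"
    using s by (simp add: power_mono mult_left_mono)
  then have "2 * s * exp (- (s/2) * (real (Suc k))\<^sup>2) \<le> 2 * s * exp (- (s/2) * (real k)\<^sup>2)"
    using s by simp
  then show ?thesis
    using gauss_Taylor(1)[OF s, of "Suc k"] gauss_Taylor(2)[OF s, of k]
    by (simp only: abs_le_iff) linarith
qed

text \<open>About s^(-1/2) terms are of size s. The constant comes from s <= sqrt s and the crude
  bound sqrt(2 pi) / 2 <= 2.\<close>

lemma gauss_error_sum:
  assumes s: "0 < s" "s \<le> 1"
  shows "(\<Sum>k<n. s * exp (- (s/2) * (real k)\<^sup>2)) \<le> 3 * sqrt s"
proof -
  have "(\<Sum>k<n. s * exp (- (s/2) * (real k)\<^sup>2)) \<le> s * (1 + sqrt (pi / (s/2)) / 2)"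
    using sum_gauss_le[of "s/2" n] s by (simp add: sum_distrib_left[symmetric])
  also have "\<dots> = s + sqrt s * (sqrt (2 * pi) / 2)"
    using s by (simp add: real_sqrt_divide real_sqrt_mult field_simps)
  also have "\<dots> \<le> sqrt s + sqrt s * 2"
  proof (rule add_mono)
    have "s = sqrt s * sqrt s" using s by simp
    also have "\<dots> \<le> sqrt s * 1" using s by (intro mult_left_mono) auto
    finally show "s \<le> sqrt s" by simp
    have "sqrt (2 * pi) \<le> sqrt (4\<^sup>2)" using pi_less_4 by (intro real_sqrt_le_mono) simp
    then show "sqrt s * (sqrt (2 * pi) / 2) \<le> sqrt s * 2" using s by (intro mult_left_mono) auto
  qed
  finally show ?thesis by simp
qed

text \<open>The trapezoidal sum gives the term k = 0 half weight, whereas the series starts at k =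
  1; this is the source of -1/2.\<close>

lemma gauss_sum_asymp:
  assumes s: "0 < s" "s \<le> 1"
  shows "\<bar>(\<Sum>k. exp (- s * (real (Suc k))\<^sup>2)) - (sqrt (pi / s) / 2 - 1 / 2)\<bar> \<le> 6 * sqrt s"
proof -
  let ?q = "\<lambda>k. exp (- s * (real k)\<^sup>2)" and ?F = "\<lambda>k. gauss_antideriv s (real k)"
  have sm: "summable ?q" by (rule summable_gauss[OF s(1)])
  then have sm': "summable (\<lambda>k. ?q (Suc k))" by (subst summable_Suc_iff)
  have S: "(\<Sum>k. ?q k) = (\<Sum>k. ?q (Suc k)) + 1"
    using suminf_split_head[OF sm] by simp
  have "(\<lambda>n. \<Sum>k<n. (?q k + ?q (Suc k)) / 2) \<longlonglongrightarrow> ((\<Sum>k. ?q k) + (\<Sum>k. ?q (Suc k))) / 2"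
    using summable_LIMSEQ[OF sm] summable_LIMSEQ[OF sm']
    by (simp add: sum_divide_distrib[symmetric] sum.distrib) (intro tendsto_intros, auto)
  then have "(\<lambda>n. (?F n - ?F 0) - (\<Sum>k<n. (?q k + ?q (Suc k)) / 2)) \<longlonglongrightarrow>
     sqrt (pi / s) / 2 - ((\<Sum>k. ?q k) + (\<Sum>k. ?q (Suc k))) / 2"
    using gauss_antideriv_tendsto[OF s(1)] by (intro tendsto_diff) auto
  then have lim: "(\<lambda>n. \<bar>(?F n - ?F 0) - (\<Sum>k<n. (?q k + ?q (Suc k)) / 2)\<bar>) \<longlonglongrightarrow>
     \<bar>sqrt (pi / s) / 2 - ((\<Sum>k. ?q k) + (\<Sum>k. ?q (Suc k))) / 2\<bar>"
    by (rule tendsto_rabs)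
  have "\<bar>(?F n - ?F 0) - (\<Sum>k<n. (?q k + ?q (Suc k)) / 2)\<bar> \<le> 6 * sqrt s" for n
  proof -
    have eq: "(?F n - ?F 0) - (\<Sum>k<n. (?q k + ?q (Suc k)) / 2) = (\<Sum>k<n. ?F (Suc k) - ?F k - (?q k + ?q (Suc k)) / 2)"
      unfolding sum_lessThan_telescope[of ?F n, symmetric] by (simp add: sum_subtractf del: of_nat_Suc)
    have "\<bar>\<Sum>k<n. ?F (Suc k) - ?F k - (?q k + ?q (Suc k)) / 2\<bar> \<le> (\<Sum>k<n. 2 * s * exp (- (s/2) * (real k)\<^sup>2))"
      by (rule order_trans[OF sum_abs]) (rule sum_mono, rule gauss_trapezoid[OF s(1)])
    also have "\<dots> = 2 * (\<Sum>k<n. s * exp (- (s/2) * (real k)\<^sup>2))" by (simp add: sum_distrib_left mult.assoc)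
    also have "\<dots> \<le> 2 * (3 * sqrt s)" using gauss_error_sum[OF s] by (intro mult_left_mono) auto
    finally show ?thesis unfolding eq by simp
  qed
  then have "\<bar>sqrt (pi / s) / 2 - ((\<Sum>k. ?q k) + (\<Sum>k. ?q (Suc k))) / 2\<bar> \<le> 6 * sqrt s"
    by (intro LIMSEQ_le_const2[OF lim]) auto
  moreover have "(\<Sum>k. ?q (Suc k)) - (sqrt (pi / s) / 2 - 1 / 2) = - (sqrt (pi / s) / 2 - ((\<Sum>k. ?q k) + (\<Sum>k. ?q (Suc k))) / 2)"
    unfolding S by (simp add: field_simps)
  ultimately show ?thesis by (simp only: abs_minus_cancel)
qed

text \<open>The cosine sequence is an eigenvector of the discrete second difference, with eigenvalue
  \<kappa> = 2 - 2 cos(2 pi y), positive because y is interior. Summing by parts twice moves the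
  difference onto the Gaussian, where it sums to O(sqrt s).\<close>

lemma gauss_cos_sum_asymp:
  assumes s: "0 < s" "s \<le> 1" and y: "0 < y" "y < 1"
  shows "\<bar>(\<Sum>k. exp (- s * (real (Suc k))\<^sup>2) * cos (2 * pi * real (Suc k) * y)) + 1 / 2\<bar> \<le> 13 / (2 - 2 * cos (2 * pi * y)) * sqrt s"
proof -
  let ?q = "\<lambda>k. exp (- s * (real k)\<^sup>2)" and ?c = "\<lambda>k. cos (2 * pi * real k * y)"
  define \<kappa> where "\<kappa> = 2 - 2 * cos (2 * pi * y)"
  have "cos (2 * pi * y) < 1"
  proof -
    have "cos (2 * pi * y) = 1 - 2 * (sin (pi * y))\<^sup>2"
      using cos_double_sin[of "pi * y"] by (simp add: mult_ac)
    moreover have "sin (pi * y) > 0" using y by (intro sin_gt_zero) auto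
    ultimately show ?thesis by simp
  qed
  then have \<kappa>: "\<kappa> > 0" by (simp add: \<kappa>_def)
  have rec: "2 * ?c (Suc k) - ?c (Suc (Suc k)) - ?c k = \<kappa> * ?c (Suc k)" for k
  proof -
    have a: "2 * pi * real (Suc (Suc k)) * y = 2 * pi * real (Suc k) * y + 2 * pi * y"
      "2 * pi * real k * y = 2 * pi * real (Suc k) * y - 2 * pi * y" by (simp_all add: algebra_simps)
    show ?thesis unfolding a cos_add cos_diff \<kappa>_def by (simp add: algebra_simps)
  qed
  have abel: "(\<Sum>j<n. ?q (Suc j) * (2 * ?c (Suc j) - ?c (Suc (Suc j)) - ?c j)) =
    (\<Sum>j<n. ?c (Suc j) * (2 * ?q (Suc j) - ?q j - ?q (Suc (Suc j)))) + ?q 0 * ?c 1 - ?q 1 * ?c 0 - ?q n * ?c (Suc n) + ?q (Suc n) * ?c n" for n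
  proof (induction n)
    case (Suc n)
    then show ?case unfolding sum.lessThan_Suc by (simp add: algebra_simps del: of_nat_Suc)
  qed simp
  have sm: "summable ?q" by (rule summable_gauss[OF s(1)])
  then have sm': "summable (\<lambda>k. ?q (Suc k))" by (subst summable_Suc_iff)
  have smc: "summable (\<lambda>k. ?q (Suc k) * ?c (Suc k))"
    by (rule summable_comparison_test'[OF sm', of 0]) (simp add: abs_mult del: of_nat_Suc)
  let ?S = "\<Sum>k. ?q (Suc k) * ?c (Suc k)"
  have bd: "\<bar>\<kappa> * (\<Sum>j<n. ?q (Suc j) * ?c (Suc j)) + \<kappa> / 2\<bar> \<le> 13 * sqrt s + (?q n + ?q (Suc n))" for n
  proof -
    have "\<kappa> * (\<Sum>j<n. ?q (Suc j) * ?c (Suc j)) + \<kappa> / 2 =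
      (\<Sum>j<n. ?c (Suc j) * (2 * ?q (Suc j) - ?q j - ?q (Suc (Suc j)))) + (1 - exp (- s)) + (?q (Suc n) * ?c n - ?q n * ?c (Suc n))"
    proof -
      have 1: "\<kappa> * (\<Sum>j<n. ?q (Suc j) * ?c (Suc j)) = (\<Sum>j<n. ?q (Suc j) * (2 * ?c (Suc j) - ?c (Suc (Suc j)) - ?c j))"
        unfolding rec by (simp only: sum_distrib_left mult_ac)
      have 2: "A + a - b - q + p + k = A + e + (p - q)" if "a - b + k = e" for A a b p q e k :: real
        using that by simp
      show ?thesis unfolding 1 abel by (rule 2) (simp add: \<kappa>_def field_simps)
    qed
    moreover have "\<bar>\<Sum>j<n. ?c (Suc j) * (2 * ?q (Suc j) - ?q j - ?q (Suc (Suc j)))\<bar> \<le> 12 * sqrt s"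
    proof -
      have "\<bar>\<Sum>j<n. ?c (Suc j) * (2 * ?q (Suc j) - ?q j - ?q (Suc (Suc j)))\<bar> \<le> (\<Sum>j<n. \<bar>?c (Suc j) * (2 * ?q (Suc j) - ?q j - ?q (Suc (Suc j)))\<bar>)"
        by (rule sum_abs)
      also have "\<dots> \<le> (\<Sum>j<n. 4 * s * exp (- (s/2) * (real j)\<^sup>2))"
      proof (rule sum_mono)
        fix j
        have "\<bar>?c (Suc j) * (2 * ?q (Suc j) - ?q j - ?q (Suc (Suc j)))\<bar> \<le> 1 * \<bar>2 * ?q (Suc j) - ?q j - ?q (Suc (Suc j))\<bar>"
          unfolding abs_mult by (intro mult_right_mono abs_cos_le_one) simp
        then show "\<bar>?c (Suc j) * (2 * ?q (Suc j) - ?q j - ?q (Suc (Suc j)))\<bar> \<le> 4 * s * exp (- (s/2) * (real j)\<^sup>2)"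
          using gauss_second_difference[OF s(1), of j] unfolding mult_1_left by (rule order_trans)
      qed
      also have "\<dots> = 4 * (\<Sum>k<n. s * exp (- (s/2) * (real k)\<^sup>2))" by (simp add: sum_distrib_left mult.assoc)
      also have "\<dots> \<le> 4 * (3 * sqrt s)" using gauss_error_sum[OF s] by (intro mult_left_mono) auto
      finally show ?thesis by simp
    qed
    moreover have "0 \<le> 1 - exp (- s)" "1 - exp (- s) \<le> sqrt s"
    proof -
      show "0 \<le> 1 - exp (- s)" using s by simp
      have "1 - exp (- s) \<le> s" using exp_ge_add_one_self[of "- s"] by simp
      also have "s = sqrt s * sqrt s" using s by simp
      also have "\<dots> \<le> sqrt s * 1" using s by (intro mult_left_mono) auto
      finally show "1 - exp (- s) \<le> sqrt s" by simp
    qed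
    moreover have "\<bar>?q (Suc n) * ?c n\<bar> \<le> ?q (Suc n)" "\<bar>?q n * ?c (Suc n)\<bar> \<le> ?q n"
      by (simp_all add: abs_mult del: of_nat_Suc)
    moreover have "\<bar>X\<bar> \<le> 13 * r + (Q + P)" if "X = A + e + (p - q)" "\<bar>A\<bar> \<le> 12 * r" "0 \<le> e" "e \<le> r" "\<bar>p\<bar> \<le> P" "\<bar>q\<bar> \<le> Q"
      for X A e p q P Q r :: real using that by linarith
    ultimately show ?thesis by blast
  qed
  have "(\<lambda>n. \<bar>\<kappa> * (\<Sum>j<n. ?q (Suc j) * ?c (Suc j)) + \<kappa> / 2\<bar>) \<longlonglongrightarrow> \<bar>\<kappa> * ?S + \<kappa> / 2\<bar>"
    by (intro tendsto_intros summable_LIMSEQ smc)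
  moreover have "(\<lambda>n. 13 * sqrt s + (?q n + ?q (Suc n))) \<longlonglongrightarrow> 13 * sqrt s + (0 + 0)"
    by (intro tendsto_intros summable_LIMSEQ_zero sm sm')
  ultimately have "\<bar>\<kappa> * ?S + \<kappa> / 2\<bar> \<le> 13 * sqrt s"
    using bd by (intro LIMSEQ_le[of _ _ "\<lambda>n. 13 * sqrt s + (?q n + ?q (Suc n))"]) auto
  moreover have "\<kappa> * ?S + \<kappa> / 2 = \<kappa> * (?S + 1 / 2)" by (simp add: algebra_simps)
  ultimately have "\<kappa> * \<bar>?S + 1 / 2\<bar> \<le> 13 * sqrt s" using \<kappa> by (simp add: abs_mult)
  then have "\<bar>?S + 1 / 2\<bar> \<le> 13 * sqrt s / \<kappa>"
    using \<kappa> by (simp only: pos_le_divide_eq mult.commute)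
  then show ?thesis unfolding \<kappa>_def times_divide_eq_left .
qed

text \<open>The constants -1/2 of the two sums cancel. Away from the boundary the heat kernel on the
  diagonal therefore has no constant term, and the error is O(sqrt s) instead of O(1).\<close>

theorem gauss_one_minus_cos_asymp:
  assumes y: "0 < y" "y < 1"
  obtains C where "0 \<le> C"
    "\<And>s. 0 < s \<Longrightarrow> s \<le> 1 \<Longrightarrow> summable (\<lambda>k. exp (- s * (real (Suc k))\<^sup>2) * (1 - cos (2 * pi * real (Suc k) * y)))"
    "\<And>s. 0 < s \<Longrightarrow> s \<le> 1 \<Longrightarrow>
      \<bar>(\<Sum>k. exp (- s * (real (Suc k))\<^sup>2) * (1 - cos (2 * pi * real (Suc k) * y))) - sqrt (pi / s) / 2\<bar> \<le> C * sqrt s"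
proof
  let ?C = "6 + 13 / (2 - 2 * cos (2 * pi * y))"
  show "0 \<le> ?C" by simp
  fix s :: real assume s: "0 < s" "s \<le> 1"
  let ?q = "\<lambda>k. exp (- s * (real k)\<^sup>2)" and ?c = "\<lambda>k. cos (2 * pi * real k * y)"
  have sm: "summable (\<lambda>k. ?q (Suc k))" using summable_gauss[OF s(1)] by (subst summable_Suc_iff)
  have smc: "summable (\<lambda>k. ?q (Suc k) * ?c (Suc k))"
    by (rule summable_comparison_test'[OF sm, of 0]) (simp add: abs_mult del: of_nat_Suc)
  have eq: "?q (Suc k) * (1 - ?c (Suc k)) = ?q (Suc k) - ?q (Suc k) * ?c (Suc k)" for k by (simp only: right_diff_distrib mult_1_right)
  show "summable (\<lambda>k. ?q (Suc k) * (1 - ?c (Suc k)))" unfolding eq by (rule summable_diff[OF sm smc])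
  have *: "\<bar>A - B - I\<bar> \<le> a + b" if "\<bar>A - (I - 1 / 2)\<bar> \<le> a" "\<bar>B + 1 / 2\<bar> \<le> b" for A B I a b :: real
    using that by linarith
  show "\<bar>(\<Sum>k. ?q (Suc k) * (1 - ?c (Suc k))) - sqrt (pi / s) / 2\<bar> \<le> ?C * sqrt s"
    unfolding eq suminf_diff[OF sm smc, symmetric] distrib_right
    using *[OF gauss_sum_asymp[OF s] gauss_cos_sum_asymp[OF s y]] .
qed

section \<open>From the heat kernel to its integral in time\<close>

lemma expint_nonneg: "0 \<le> x \<Longrightarrow> 0 \<le> expint \<mu> x"
  unfolding expint_def by (auto simp: divide_simps mult_nonneg_nonpos mult_le_0_iff)

lemma expint_0 [simp]: "expint \<mu> 0 = 0"
  by (simp add: expint_def)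

lemma continuous_on_expint: "continuous_on A (expint \<mu>)"
  by (rule DERIV_continuous_on[where D = "\<lambda>x. exp (- \<mu> * x)"]) (auto intro!: derivative_eq_intros)

lemma sqrt_cube_deriv:
  assumes "0 < u"
  shows "((\<lambda>u. a * sqrt u + c * (u * sqrt u)) has_real_derivative (a / (2 * sqrt u) + 3 / 2 * c * sqrt u)) (at u)"
proof -
  have "u = sqrt u * sqrt u" using assms by simp
  then show ?thesis
    using assms by (auto intro!: derivative_eq_intros simp: field_simps)
qed

text \<open>The kernel bound is integrated over (0, x]; the error C sqrt u would give 2/3 C x^(3/2),
  and C x^(3/2) leaves some room. As the kernel is singular at 0, the two directions differ: the
  upper bound is proved for partial sums, which are continuous at 0 and thereby also give
  summability; the lower bound is proved on [e, x] for the full series.\<close>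

lemma expint_series_asymp:
  fixes \<mu> w :: "nat \<Rightarrow> real"
  assumes w: "\<And>k. 0 \<le> w k" and x0: "0 < x0" and C: "0 \<le> C"
    and sm: "\<And>u. 0 < u \<Longrightarrow> u \<le> x0 \<Longrightarrow> summable (\<lambda>k. w k * exp (- \<mu> k * u))"
    and g: "\<And>u. 0 < u \<Longrightarrow> u \<le> x0 \<Longrightarrow> \<bar>(\<Sum>k. w k * exp (- \<mu> k * u)) - a / (2 * sqrt u)\<bar> \<le> C * sqrt u"
    and x: "0 < x" "x < x0"
  shows "summable (\<lambda>k. w k * expint (\<mu> k) x)"
    and "\<bar>(\<Sum>k. w k * expint (\<mu> k) x) - a * sqrt x\<bar> \<le> C * (x * sqrt x)"
proof -
  define G where "G x = (\<Sum>k. w k * expint (\<mu> k) x)" for x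
  have part: "(\<Sum>k<n. w k * expint (\<mu> k) x) \<le> a * sqrt x + C * (x * sqrt x)" if x: "0 < x" "x < x0" for n x
  proof -
    define D where "D u = a * sqrt u + C * (u * sqrt u) - (\<Sum>k<n. w k * expint (\<mu> k) u)" for u
    define d where "d u = a / (2 * sqrt u) + 3 / 2 * C * sqrt u - (\<Sum>k<n. w k * exp (- \<mu> k * u))" for u
    have "continuous_on {0..x} D"
      unfolding D_def by (intro continuous_intros continuous_on_expint)
    moreover have "(D has_derivative (\<lambda>h. d u * h)) (at u)" if "0 < u" for u
    proof -
      have "((\<lambda>u. \<Sum>k<n. w k * expint (\<mu> k) u) has_real_derivative (\<Sum>k<n. w k * exp (- \<mu> k * u))) (at u)"
        by (intro DERIV_sum) (auto intro!: derivative_eq_intros)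
      from DERIV_diff[OF sqrt_cube_deriv[OF that, of a C] this] show ?thesis
        unfolding D_def[abs_def] d_def by (simp only: has_field_derivative_def)
    qed
    ultimately obtain z where "0 < z" "z < x" "D x - D 0 = d z * (x - 0)"
      using mvt[of 0 x D "\<lambda>u h. d u * h"] x(1) by auto
    then have z: "0 < z" "z < x" "D x - D 0 = (x - 0) * (a / (2 * sqrt z) + 3 / 2 * C * sqrt z - (\<Sum>k<n. w k * exp (- \<mu> k * z)))"
      by (simp_all add: d_def mult.commute)
    have "(\<Sum>k<n. w k * exp (- \<mu> k * z)) \<le> (\<Sum>k. w k * exp (- \<mu> k * z))"
      using z x w by (intro sum_le_suminf sm) auto
    also have "\<dots> \<le> a / (2 * sqrt z) + C * sqrt z" using g[of z] z x by (simp add: abs_le_iff)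
    also have "\<dots> \<le> a / (2 * sqrt z) + 3 / 2 * C * sqrt z" using C z by simp
    finally have "0 \<le> D x - D 0" using z x by simp
    then show ?thesis by (simp add: D_def)
  qed
  have smG: "summable (\<lambda>k. w k * expint (\<mu> k) x)" if "0 < x" "x < x0" for x
    by (rule summableI_nonneg_bounded[OF _ part[OF that]]) (use that w expint_nonneg in auto)
  then show "summable (\<lambda>k. w k * expint (\<mu> k) x)" using x .
  have der: "(G has_real_derivative (\<Sum>k. w k * exp (- \<mu> k * u))) (at u)" if u: "0 < u" "u < x0" for u
  proof -
    \<comment> \<open>A neighbourhood of \<open>u\<close> away from the singularity at 0. Negative
      rates make terms grow with v, hence a majorant built from both u/2 and x0.\<close>
    define S where "S = {u/2<..<(u+x0)/2}"
    have S: "0 < u/2" "v \<in> S \<Longrightarrow> u/2 < v \<and> v < (u + x0)/2" "(u + x0)/2 < x0" "u \<in> S" for v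
      using u by (auto simp: S_def)
    have uc: "uniformly_convergent_on S (\<lambda>n v. \<Sum>i<n. w i * exp (- \<mu> i * v))"
    proof (rule uniformly_convergentI[OF Weierstrass_m_test_ev[where M = "\<lambda>i. w i * exp (- \<mu> i * (u/2)) + w i * exp (- \<mu> i * x0)"]], goal_cases)
      case 1
      show ?case
      proof (intro always_eventually allI ballI)
        fix i v assume v: "v \<in> S"
        have "exp (- \<mu> i * v) \<le> exp (- \<mu> i * (u/2)) + exp (- \<mu> i * x0)"
        proof (cases "0 \<le> \<mu> i")
          case True
          then have "- \<mu> i * v \<le> - \<mu> i * (u/2)" using S(2)[OF v] by (intro mult_left_mono_neg) auto
          then have "exp (- \<mu> i * v) \<le> exp (- \<mu> i * (u/2))" by simp
          then show ?thesis by (simp add: add_increasing2)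
        next
          case False
          then have "- \<mu> i * v \<le> - \<mu> i * x0" using S(2)[OF v] S(3) by (intro mult_left_mono) auto
          then have "exp (- \<mu> i * v) \<le> exp (- \<mu> i * x0)" by simp
          then show ?thesis by (simp add: add_increasing)
        qed
        then have "w i * exp (- \<mu> i * v) \<le> w i * (exp (- \<mu> i * (u/2)) + exp (- \<mu> i * x0))"
          by (intro mult_left_mono w)
        then show "norm (w i * exp (- \<mu> i * v)) \<le> w i * exp (- \<mu> i * (u/2)) + w i * exp (- \<mu> i * x0)"
          using w[of i] by (simp add: distrib_left)
      qed
    next
      case 2
      show ?case using u x0 by (intro summable_add sm) auto
    qed
    show ?thesis
      unfolding G_def[abs_def]
    proof (rule has_field_derivative_series'(2)[where S = S and f' = "\<lambda>k u. w k * exp (- \<mu> k * u)"])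
      show "convex S" unfolding S_def by (rule convex_real_interval)
      show "((\<lambda>x. w k * expint (\<mu> k) x) has_real_derivative w k * exp (- \<mu> k * v)) (at v within S)" for k v
        by (auto intro!: derivative_eq_intros)
      show "u \<in> interior S" using S(4) by (simp add: S_def)
    qed (use uc S(4) smG[OF u] in auto)
  qed
  have up: "G x \<le> a * sqrt x + C * (x * sqrt x)" if "0 < x" "x < x0" for x
    unfolding G_def by (rule suminf_le_const[OF smG[OF that] part[OF that]])
  have G0: "0 \<le> G x" if "0 < x" "x < x0" for x
    unfolding G_def by (rule suminf_nonneg[OF smG[OF that]]) (use that w expint_nonneg in auto)
  have low: "G x - G e \<ge> (a * sqrt x - C * (x * sqrt x)) - (a * sqrt e - C * (e * sqrt e))" if e: "0 < e" "e < x" for e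
  proof -
    define D where "D u = G u - (a * sqrt u + (- C) * (u * sqrt u))" for u
    have "D e \<le> D x"
    proof (rule DERIV_nonneg_imp_nondecreasing[OF less_imp_le[OF e(2)]])
      fix u assume u: "e \<le> u" "u \<le> x"
      then have u': "0 < u" "u < x0" using e x by auto
      have "(D has_real_derivative (\<Sum>k. w k * exp (- \<mu> k * u)) - (a / (2 * sqrt u) + 3 / 2 * (- C) * sqrt u)) (at u)"
        unfolding D_def by (intro DERIV_diff der sqrt_cube_deriv u')
      moreover have "0 \<le> (\<Sum>k. w k * exp (- \<mu> k * u)) - (a / (2 * sqrt u) + 3 / 2 * (- C) * sqrt u)"
      proof -
        have "C * sqrt u \<le> 3 / 2 * C * sqrt u" using C u' by simp
        then show ?thesis using g[OF u'(1) less_imp_le[OF u'(2)]] by (simp add: abs_le_iff)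
      qed
      ultimately show "\<exists>y. (D has_real_derivative y) (at u) \<and> 0 \<le> y" by blast
    qed
    then show ?thesis by (simp add: D_def)
  qed
  have "G x \<ge> a * sqrt x - C * (x * sqrt x)"
  proof -
    \<comment> \<open>Discarding G e >= 0 before letting e tend to 0 makes continuity of
      \<open>G\<close> at 0 dispensable.\<close>
    have "(a * sqrt x - C * (x * sqrt x)) - (a * sqrt e - C * (e * sqrt e)) \<le> G x" if "0 < e \<and> e < x" for e
      using low[of e] G0[of e] that x by simp
    moreover have "((\<lambda>e. (a * sqrt x - C * (x * sqrt x)) - (a * sqrt e - C * (e * sqrt e))) \<longlongrightarrow> (a * sqrt x - C * (x * sqrt x)) - (a * sqrt 0 - C * (0 * sqrt 0))) (at_right 0)"
      by (intro tendsto_intros)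
    moreover have "eventually (\<lambda>e. 0 < e \<and> e < x) (at_right 0)"
      using x(1) by (auto simp: eventually_at_right_field)
    ultimately have "(a * sqrt x - C * (x * sqrt x)) - (a * sqrt 0 - C * (0 * sqrt 0)) \<le> G x"
      by (intro tendsto_upperbound[where F = "at_right 0"]) (auto elim: eventually_mono simp: trivial_limit_at_right_real)
    then show ?thesis by simp
  qed
  with up[OF x] show "\<bar>(\<Sum>k. w k * expint (\<mu> k) x) - a * sqrt x\<bar> \<le> C * (x * sqrt x)"
    by (simp add: abs_le_iff G_def[symmetric])
qed

text \<open>The offset \<open>\<mu>0\<close> factors out of the kernel as exp(-\<mu>0 u) = 1 + O(u).
  Against the leading u^(-1/2) this costs O(sqrt u), the same order as the error of the Gaussian sum
  at s = pi^2 \<theta> u.\<close>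

theorem heat_trace_asymp:
  fixes \<theta> \<mu>0 y :: real
  assumes \<theta>: "\<theta> > 0" and y: "0 < y" "y < 1"
  defines "\<mu> \<equiv> \<lambda>k. \<mu>0 + pi\<^sup>2 * (real (Suc k))\<^sup>2 * \<theta>"
    and "w \<equiv> \<lambda>k. 2 * (sin (pi * real (Suc k) * y))\<^sup>2"
  obtains C x0 where "0 < x0" "0 \<le> C"
    "\<And>x. 0 < x \<Longrightarrow> x < x0 \<Longrightarrow> summable (\<lambda>k. w k * expint (\<mu> k) x)"
    "\<And>x. 0 < x \<Longrightarrow> x < x0 \<Longrightarrow> \<bar>(\<Sum>k. w k * expint (\<mu> k) x) - sqrt x / sqrt (pi * \<theta>)\<bar> \<le> C * (x * sqrt x)"
proof -
  have w: "w k = 1 - cos (2 * pi * real (Suc k) * y)" for k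
    using cos_double_sin[of "pi * real (Suc k) * y"] by (simp add: w_def mult_ac del: of_nat_Suc)
  obtain B where B0: "0 \<le> B"
    "\<And>s. 0 < s \<Longrightarrow> s \<le> 1 \<Longrightarrow> summable (\<lambda>k. exp (- s * (real (Suc k))\<^sup>2) * (1 - cos (2 * pi * real (Suc k) * y)))"
    "\<And>s. 0 < s \<Longrightarrow> s \<le> 1 \<Longrightarrow> \<bar>(\<Sum>k. exp (- s * (real (Suc k))\<^sup>2) * (1 - cos (2 * pi * real (Suc k) * y))) - sqrt (pi / s) / 2\<bar> \<le> B * sqrt s"
    by (rule gauss_one_minus_cos_asymp[OF y]) blast
  note B = B0[folded w]
  \<comment> \<open>Ensures u <= 1, for the bound on exp(-\<mu>0 u), and pi^2 \<theta> u <= 1, the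
    range of the Gaussian sum.\<close>
  define x0 where "x0 = min 1 (1 / (pi\<^sup>2 * \<theta>))"
  have x0: "0 < x0" using \<theta> by (simp add: x0_def)
  define a where "a = 1 / sqrt (pi * \<theta>)"
  define E where "E = exp \<bar>\<mu>0\<bar>"
  define C where "C = E * (B * (pi * sqrt \<theta>)) + \<bar>\<mu>0\<bar> * E * (a / 2)"
  have a0: "0 < a" using \<theta> by (simp add: a_def)
  have C0: "0 \<le> C" using B(1) \<theta> a0 by (auto simp: C_def E_def intro!: add_nonneg_nonneg mult_nonneg_nonneg)
  have sE: "exp (- \<mu> k * u) = exp (- \<mu>0 * u) * exp (- (pi\<^sup>2 * \<theta> * u) * (real (Suc k))\<^sup>2)" for k u
    by (simp add: \<mu>_def algebra_simps flip: exp_add)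
  have wsE: "w k * exp (- \<mu> k * u) = exp (- \<mu>0 * u) * (exp (- (pi\<^sup>2 * \<theta> * u) * (real (Suc k))\<^sup>2) * w k)" for k u
    unfolding sE by (simp only: mult_ac)
  have s: "0 < pi\<^sup>2 * \<theta> * u" "pi\<^sup>2 * \<theta> * u \<le> 1" if "0 < u" "u \<le> x0" for u
    using that \<theta> by (auto simp: x0_def field_simps)
  have sm: "summable (\<lambda>k. w k * exp (- \<mu> k * u))" if "0 < u" "u \<le> x0" for u
    using summable_mult[OF B(2)[OF s[OF that]], of "exp (- \<mu>0 * u)"] by (simp only: wsE)
  have g: "\<bar>(\<Sum>k. w k * exp (- \<mu> k * u)) - a / (2 * sqrt u)\<bar> \<le> C * sqrt u" if u: "0 < u" "u \<le> x0" for u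
  proof -
    define g0 where "g0 = (\<Sum>k. exp (- (pi\<^sup>2 * \<theta> * u) * (real (Suc k))\<^sup>2) * w k)"
    have eq1: "(\<Sum>k. w k * exp (- \<mu> k * u)) = exp (- \<mu>0 * u) * g0"
      unfolding g0_def suminf_mult[OF B(2)[OF s[OF u]], symmetric] by (simp only: wsE)
    have b1: "\<bar>g0 - a / (2 * sqrt u)\<bar> \<le> B * (pi * sqrt \<theta>) * sqrt u"
    proof -
      have 1: "sqrt (pi\<^sup>2 * \<theta> * u) = pi * sqrt \<theta> * sqrt u" by (simp add: real_sqrt_mult)
      have "sqrt (pi / (pi\<^sup>2 * \<theta> * u)) / 2 = a / (2 * sqrt u)"
      proof -
        have "pi / (pi\<^sup>2 * \<theta> * u) = 1 / (pi * \<theta> * u)" by (simp add: power2_eq_square)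
        then show ?thesis by (simp add: a_def real_sqrt_divide real_sqrt_mult)
      qed
      then show ?thesis using B(3)[OF s[OF u]] unfolding 1 g0_def by (simp add: mult_ac)
    qed
    have e: "exp (- \<mu>0 * u) \<le> E" "\<bar>exp (- \<mu>0 * u) - 1\<bar> \<le> \<bar>\<mu>0\<bar> * u * E"
    proof -
      have u1: "u \<le> 1" using u by (simp add: x0_def)
      have m: "\<bar>\<mu>0 * u\<bar> \<le> \<bar>\<mu>0\<bar>" using u u1 by (simp add: abs_mult mult_left_le)
      then show "exp (- \<mu>0 * u) \<le> E" by (simp add: E_def abs_le_iff)
      have "\<bar>exp z - 1\<bar> \<le> \<bar>z\<bar> * exp \<bar>z\<bar>" for z :: real
      proof (cases "0 \<le> z")
        case True
        have "exp z * (1 - z) \<le> exp z * exp (- z)"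
          using exp_ge_add_one_self[of "- z"] by (intro mult_left_mono) auto
        then show ?thesis using True by (simp add: exp_minus algebra_simps)
      next
        case False
        then have "\<bar>exp z - 1\<bar> = 1 - exp z" by simp
        also have "\<dots> \<le> \<bar>z\<bar> * 1" using exp_ge_add_one_self[of z] False by linarith
        also have "\<dots> \<le> \<bar>z\<bar> * exp \<bar>z\<bar>" by (intro mult_left_mono) auto
        finally show ?thesis .
      qed
      from this[of "- \<mu>0 * u"] have "\<bar>exp (- \<mu>0 * u) - 1\<bar> \<le> \<bar>\<mu>0 * u\<bar> * exp \<bar>\<mu>0 * u\<bar>" by simp
      also have "\<dots> \<le> \<bar>\<mu>0 * u\<bar> * E" using m by (intro mult_left_mono) (auto simp: E_def)
      finally show "\<bar>exp (- \<mu>0 * u) - 1\<bar> \<le> \<bar>\<mu>0\<bar> * u * E" using u by (simp add: abs_mult)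
    qed
    have lem: "\<bar>X * g0 - b\<bar> \<le> E * K + L * b" if "\<bar>g0 - b\<bar> \<le> K" "X \<le> E" "\<bar>X - 1\<bar> \<le> L" "0 \<le> X" "0 \<le> b" for X b K L
    proof -
      have "X * g0 - b = X * (g0 - b) + (X - 1) * b" by (simp add: algebra_simps)
      also have "\<bar>\<dots>\<bar> \<le> \<bar>X * (g0 - b)\<bar> + \<bar>(X - 1) * b\<bar>" by (rule abs_triangle_ineq)
      also have "\<dots> \<le> E * K + L * b"
        unfolding abs_mult using that by (intro add_mono mult_mono) auto
      finally show ?thesis .
    qed
    have "\<bar>(\<Sum>k. w k * exp (- \<mu> k * u)) - a / (2 * sqrt u)\<bar> \<le> E * (B * (pi * sqrt \<theta>) * sqrt u) + \<bar>\<mu>0\<bar> * u * E * (a / (2 * sqrt u))"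
      unfolding eq1 by (rule lem[OF b1 e]) (use a0 u in auto)
    also have "\<dots> = C * sqrt u"
    proof -
      define r where "r = sqrt u"
      have "r > 0" "u = r * r" using u by (simp_all add: r_def)
      then have ur: "u * (a / (2 * r)) = a / 2 * r" by simp
      have "\<bar>\<mu>0\<bar> * u * E * (a / (2 * r)) = \<bar>\<mu>0\<bar> * E * (u * (a / (2 * r)))" by (simp only: mult_ac)
      then have "\<bar>\<mu>0\<bar> * u * E * (a / (2 * r)) = \<bar>\<mu>0\<bar> * E * (a / 2) * r" unfolding ur by (simp only: mult.assoc)
      then show ?thesis unfolding r_def[symmetric] C_def by (simp only: distrib_right mult.assoc)
    qed
    finally show ?thesis .
  qed
  have "0 \<le> w k" for k by (simp add: w_def)
  note asymp = expint_series_asymp[OF this x0 C0 sm g]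
  show ?thesis
    by (rule that[OF x0 C0]) (use asymp in \<open>auto simp: a_def\<close>)
qed

section \<open>The covariance matrix of the increments\<close>

text \<open>Closed form for one mode, from which sign and monotonicity in m can be read off when
  \<mu> is positive. At \<mu> = 0 both sides are 0, the right one because division by zero yields
  0.\<close>

lemma expint_second_difference:
  assumes "1 \<le> m"
  shows "2 * expint \<mu> (real m * h) - expint \<mu> (real (m + 1) * h) - expint \<mu> (real (m - 1) * h) =
    exp (- \<mu> * (real (m - 1) * h)) * (1 - exp (- \<mu> * h))\<^sup>2 / \<mu>"
proof (cases "\<mu> = 0")
  case True
  then show ?thesis using assms by (simp add: expint_def algebra_simps of_nat_diff)
next
  case False
  obtain j where m: "m = Suc j" using assms by (cases m) auto
  have e: "exp (- \<mu> * (real (m + 1) * h)) = exp (- \<mu> * (real (m - 1) * h)) * exp (- \<mu> * h) * exp (- \<mu> * h)"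
    "exp (- \<mu> * (real m * h)) = exp (- \<mu> * (real (m - 1) * h)) * exp (- \<mu> * h)"
    unfolding m by (simp_all add: algebra_simps flip: exp_add)
  show ?thesis
    using False unfolding expint_def e
    by (simp add: divide_simps power2_eq_square) (simp add: algebra_simps)
qed

lemma expint_mono: "x \<le> y \<Longrightarrow> expint \<mu> x \<le> expint \<mu> y"
  by (rule DERIV_nonneg_imp_nondecreasing)
    (auto intro!: exI[of _ "exp (- \<mu> * z)" for z] derivative_eq_intros)

lemma expint_le_inverse: "\<mu> > 0 \<Longrightarrow> expint \<mu> x \<le> 1 / \<mu>"
  by (auto simp: expint_def divide_right_mono)

text \<open>Modes from \<open>K0\<close> on have positive rate; for them the second differences are
  nonnegative and decreasing. The finitely many others are a perturbation. Accordingly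
  \<open>G\<close> and \<open>D\<close> refer to all modes, \<open>Gh\<close> and \<open>Dh\<close>
  to the high ones. In the application \<open>a\<close> is 1 / sqrt(pi \<theta>2).\<close>

locale heat_modes =
  fixes \<mu> w :: "nat \<Rightarrow> real" and K0 :: nat and a C x0 :: real
  assumes w: "\<And>k. 0 \<le> w k"
    and \<mu>_pos: "\<And>k. K0 \<le> k \<Longrightarrow> 0 < \<mu> k"
    and summ: "summable (\<lambda>k. w (k + K0) / \<mu> (k + K0))"
    and x0: "0 < x0" and a: "0 \<le> a" and C: "0 \<le> C"
    and asymp: "\<And>x. 0 < x \<Longrightarrow> x < x0 \<Longrightarrow> \<bar>(\<Sum>k. w k * expint (\<mu> k) x) - a * sqrt x\<bar> \<le> C * (x * sqrt x)"
begin

definition G :: "real \<Rightarrow> real" where "G x = (\<Sum>k. w k * expint (\<mu> k) x)"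
definition Gh :: "real \<Rightarrow> real" where "Gh x = (\<Sum>k. w (k + K0) * expint (\<mu> (k + K0)) x)"

lemma summable_Gh: "0 \<le> x \<Longrightarrow> summable (\<lambda>k. w (k + K0) * expint (\<mu> (k + K0)) x)"
proof (rule summable_comparison_test'[OF summ, where N = 0])
  fix k assume x: "0 \<le> x"
  have "w (k + K0) * expint (\<mu> (k + K0)) x \<le> w (k + K0) * (1 / \<mu> (k + K0))"
    by (intro mult_left_mono expint_le_inverse \<mu>_pos w) simp
  then show "norm (w (k + K0) * expint (\<mu> (k + K0)) x) \<le> w (k + K0) / \<mu> (k + K0)"
    using w[of "k + K0"] expint_nonneg[OF x, of "\<mu> (k + K0)"] by simp
qed

lemma summable_G: "0 \<le> x \<Longrightarrow> summable (\<lambda>k. w k * expint (\<mu> k) x)"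
  using summable_Gh summable_iff_shift[of "\<lambda>k. w k * expint (\<mu> k) x" K0] by simp

lemma G_split: "0 \<le> x \<Longrightarrow> G x = Gh x + (\<Sum>k<K0. w k * expint (\<mu> k) x)"
  unfolding G_def Gh_def by (rule suminf_split_initial_segment[OF summable_G])

lemma G_0 [simp]: "G 0 = 0" and Gh_0 [simp]: "Gh 0 = 0"
  by (simp_all add: G_def Gh_def)

lemma Gh_mono: "0 \<le> x \<Longrightarrow> x \<le> y \<Longrightarrow> Gh x \<le> Gh y"
  unfolding Gh_def by (intro suminf_le mult_left_mono expint_mono w summable_Gh) auto

text \<open>The absolute value extends the second difference evenly to lag 0, so that the diagonal
  of the covariance matrix needs no separate formula.\<close>

definition D :: "nat \<Rightarrow> nat \<Rightarrow> real" where
  "D n m = 2 * G (real m / real n) - G (real (m + 1) / real n) - G (\<bar>real m - 1\<bar> / real n)"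

definition Dh :: "nat \<Rightarrow> nat \<Rightarrow> real" where
  "Dh n m = 2 * Gh (real m / real n) - Gh (real (m + 1) / real n) - Gh (real (m - 1) / real n)"

lemma D_0: "D n 0 = - 2 * G (1 / real n)"
  by (simp add: D_def)

lemma Dh_series:
  assumes "1 \<le> m"
  shows "summable (\<lambda>k. w (k + K0) * (exp (- \<mu> (k + K0) * (real (m - 1) * (1 / real n))) * (1 - exp (- \<mu> (k + K0) * (1 / real n)))\<^sup>2 / \<mu> (k + K0)))"
    and "Dh n m = (\<Sum>k. w (k + K0) * (exp (- \<mu> (k + K0) * (real (m - 1) * (1 / real n))) * (1 - exp (- \<mu> (k + K0) * (1 / real n)))\<^sup>2 / \<mu> (k + K0)))"
proof -
  let ?f = "\<lambda>x k. w (k + K0) * expint (\<mu> (k + K0)) x"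
  have eq: "2 * ?f (real m / real n) k - ?f (real (m + 1) / real n) k - ?f (real (m - 1) / real n) k =
    w (k + K0) * (exp (- \<mu> (k + K0) * (real (m - 1) * (1 / real n))) * (1 - exp (- \<mu> (k + K0) * (1 / real n)))\<^sup>2 / \<mu> (k + K0))" for k
    unfolding expint_second_difference[OF assms, symmetric] by (simp add: algebra_simps)
  have s: "summable (?f (real q / real n))" for q by (rule summable_Gh) simp
  show "summable (\<lambda>k. w (k + K0) * (exp (- \<mu> (k + K0) * (real (m - 1) * (1 / real n))) * (1 - exp (- \<mu> (k + K0) * (1 / real n)))\<^sup>2 / \<mu> (k + K0)))"
    unfolding eq[symmetric] by (intro summable_diff summable_mult s)
  show "Dh n m = (\<Sum>k. w (k + K0) * (exp (- \<mu> (k + K0) * (real (m - 1) * (1 / real n))) * (1 - exp (- \<mu> (k + K0) * (1 / real n)))\<^sup>2 / \<mu> (k + K0)))"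
    unfolding eq[symmetric] Dh_def Gh_def
    by (subst suminf_diff[symmetric], (intro summable_diff summable_mult s)+)+
      (simp add: suminf_mult[OF s])
qed

lemma Dh_nonneg: "1 \<le> m \<Longrightarrow> 0 \<le> Dh n m"
  unfolding Dh_series(2)
  by (intro suminf_nonneg Dh_series(1)) (auto intro!: mult_nonneg_nonneg divide_nonneg_pos w \<mu>_pos)

lemma Dh_antimono:
  assumes "1 \<le> l" "l \<le> m"
  shows "Dh n m \<le> Dh n l"
proof -
  have m: "1 \<le> m" using assms by simp
  show ?thesis
    unfolding Dh_series(2)[OF assms(1)] Dh_series(2)[OF m]
  proof (intro suminf_le Dh_series(1) assms m mult_left_mono divide_right_mono mult_right_mono w)
    fix k
    have p: "0 < \<mu> (k + K0)" by (rule \<mu>_pos) simp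
    have "real (l - 1) * (1 / real n) \<le> real (m - 1) * (1 / real n)"
      using assms by (intro mult_right_mono) auto
    then show "exp (- \<mu> (k + K0) * (real (m - 1) * (1 / real n))) \<le> exp (- \<mu> (k + K0) * (real (l - 1) * (1 / real n)))"
      unfolding exp_le_cancel_iff using p by (intro mult_left_mono_neg) auto
    show "0 \<le> \<mu> (k + K0)" using p by simp
  qed simp
qed

text \<open>A telescoping sum. Since \<open>Gh\<close> increases, the sum over any number of lags is
  at most Gh (1 / n), which is O(n^(-1/2)).\<close>

lemma Dh_sum: "(\<Sum>m=1..M. Dh n m) = Gh (1 / real n) - (Gh (real (M + 1) / real n) - Gh (real M / real n))"
proof (induction M)
  case (Suc M)
  have "Dh n (Suc M) = 2 * Gh (real (M + 1) / real n) - Gh (real (Suc M + 1) / real n) - Gh (real M / real n)"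
    by (simp add: Dh_def)
  with Suc show ?case by simp
qed simp

lemma G_bound:
  assumes "real n > 1 / x0" "n \<ge> 1"
  shows "0 \<le> Gh (1 / real n)" "Gh (1 / real n) \<le> G (1 / real n)" "G (1 / real n) \<le> (a + C) / sqrt (real n)"
proof -
  have n: "0 < 1 / real n" "1 / real n < x0" using assms x0 by (auto simp: field_simps)
  show "0 \<le> Gh (1 / real n)" using Gh_mono[of 0 "1 / real n"] by simp
  show "Gh (1 / real n) \<le> G (1 / real n)"
    by (subst G_split) (auto intro!: sum_nonneg mult_nonneg_nonneg w expint_nonneg)
  have "G (1 / real n) \<le> a * sqrt (1 / real n) + C * ((1 / real n) * sqrt (1 / real n))"
    using asymp[OF n] by (simp add: G_def abs_le_iff)
  also have "\<dots> \<le> a * sqrt (1 / real n) + C * (1 * sqrt (1 / real n))"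
    using assms C by (intro add_left_mono mult_left_mono mult_right_mono) auto
  also have "\<dots> = (a + C) / sqrt (real n)" by (simp add: real_sqrt_divide add_divide_distrib)
  finally show "G (1 / real n) \<le> (a + C) / sqrt (real n)" .
qed

text \<open>The closed form of a second difference is at most exp(2 |\<mu>|) (|\<mu>| exp |\<mu>| /
  n)^2 / |\<mu>| in modulus, that is |\<mu>| exp(4 |\<mu>|) / n^2. The first exponent uses times up
  to 2, as lags go up to 2 n.\<close>

definition L :: real where "L = (\<Sum>k<K0. w k * (\<bar>\<mu> k\<bar> * exp (4 * \<bar>\<mu> k\<bar>)))"

lemma D_Dh:
  assumes m: "1 \<le> m" "m \<le> 2 * n" and n: "n \<ge> 1"
  shows "\<bar>D n m - Dh n m\<bar> \<le> L / (real n)\<^sup>2"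
proof -
  have am: "\<bar>real m - 1\<bar> = real (m - 1)" using m by (simp add: of_nat_diff)
  have eq: "D n m - Dh n m = (\<Sum>k<K0. w k * (2 * expint (\<mu> k) (real m * (1 / real n)) - expint (\<mu> k) (real (m + 1) * (1 / real n)) - expint (\<mu> k) (real (m - 1) * (1 / real n))))"
    unfolding D_def Dh_def am
    by (simp add: G_split sum_subtractf sum_distrib_left right_diff_distrib mult.left_commute)
  have "\<bar>D n m - Dh n m\<bar> \<le> (\<Sum>k<K0. w k * (\<bar>\<mu> k\<bar> * exp (4 * \<bar>\<mu> k\<bar>)) / (real n)\<^sup>2)"
    unfolding eq
  proof (rule order_trans[OF sum_abs], rule sum_mono)
    fix k
    have e1: "\<bar>1 - exp (- \<mu> k * (1 / real n))\<bar> \<le> \<bar>\<mu> k\<bar> / real n * exp \<bar>\<mu> k\<bar>"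
    proof -
      have bz: "\<bar>1 - exp z\<bar> \<le> \<bar>z\<bar> * exp \<bar>z\<bar>" for z :: real
      proof (cases "0 \<le> z")
        case True
        have "exp z * (1 - z) \<le> exp z * exp (- z)"
          using exp_ge_add_one_self[of "- z"] by (intro mult_left_mono) auto
        then show ?thesis using True by (simp add: exp_minus algebra_simps)
      next
        case False
        then have "\<bar>1 - exp z\<bar> = 1 - exp z" by simp
        also have "\<dots> \<le> \<bar>z\<bar> * 1" using exp_ge_add_one_self[of z] False by linarith
        also have "\<dots> \<le> \<bar>z\<bar> * exp \<bar>z\<bar>" by (intro mult_left_mono) auto
        finally show ?thesis .
      qed
      have "\<bar>- \<mu> k * (1 / real n)\<bar> = \<bar>\<mu> k\<bar> / real n" by (simp add: abs_mult)
      moreover have "\<bar>\<mu> k\<bar> / real n \<le> \<bar>\<mu> k\<bar>" using n by (simp add: divide_le_eq mult_le_cancel_left1)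
      then have "\<bar>\<mu> k\<bar> / real n * exp (\<bar>\<mu> k\<bar> / real n) \<le> \<bar>\<mu> k\<bar> / real n * exp \<bar>\<mu> k\<bar>"
        by (intro mult_left_mono) auto
      ultimately show ?thesis using bz[of "- \<mu> k * (1 / real n)"] by (simp only:)
    qed
    have e2: "exp (- \<mu> k * (real (m - 1) * (1 / real n))) \<le> exp (2 * \<bar>\<mu> k\<bar>)"
    proof -
      have "real (m - 1) * (1 / real n) \<le> 2" using m n by (simp add: divide_le_eq of_nat_diff)
      then have "\<bar>\<mu> k\<bar> * (real (m - 1) * (1 / real n)) \<le> \<bar>\<mu> k\<bar> * 2" by (intro mult_left_mono) auto
      moreover have "- \<mu> k * (real (m - 1) * (1 / real n)) \<le> \<bar>\<mu> k\<bar> * (real (m - 1) * (1 / real n))"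
        by (intro mult_right_mono) auto
      ultimately show ?thesis by (subst exp_le_cancel_iff) linarith
    qed
    have "\<bar>exp (- \<mu> k * (real (m - 1) * (1 / real n))) * (1 - exp (- \<mu> k * (1 / real n)))\<^sup>2 / \<mu> k\<bar> \<le>
      exp (2 * \<bar>\<mu> k\<bar>) * (\<bar>\<mu> k\<bar> / real n * exp \<bar>\<mu> k\<bar>)\<^sup>2 / \<bar>\<mu> k\<bar>"
    proof -
      have "(1 - exp (- \<mu> k * (1 / real n)))\<^sup>2 \<le> (\<bar>\<mu> k\<bar> / real n * exp \<bar>\<mu> k\<bar>)\<^sup>2"
        using power_mono[OF e1, of 2] by simp
      then show ?thesis
        unfolding abs_divide abs_mult abs_power2 abs_exp_cancel
        using e2 by (intro divide_right_mono mult_mono) auto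
    qed
    also have "\<dots> = (\<bar>\<mu> k\<bar> * exp (4 * \<bar>\<mu> k\<bar>)) / (real n)\<^sup>2"
    proof -
      have "exp (4 * \<bar>\<mu> k\<bar>) = exp (2 * \<bar>\<mu> k\<bar>) * (exp \<bar>\<mu> k\<bar>)\<^sup>2"
        by (simp add: power2_eq_square flip: exp_add)
      moreover have "A * (m / n' * B)\<^sup>2 / m = (m * (A * B\<^sup>2)) / n'\<^sup>2" for A B m n' :: real
        by (cases "m = 0") (simp_all add: power2_eq_square)
      ultimately show ?thesis by (simp only:)
    qed
    finally have "w k * \<bar>exp (- \<mu> k * (real (m - 1) * (1 / real n))) * (1 - exp (- \<mu> k * (1 / real n)))\<^sup>2 / \<mu> k\<bar> \<le>
      w k * ((\<bar>\<mu> k\<bar> * exp (4 * \<bar>\<mu> k\<bar>)) / (real n)\<^sup>2)"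
      by (intro mult_left_mono w)
    then show "\<bar>w k * (2 * expint (\<mu> k) (real m * (1 / real n)) - expint (\<mu> k) (real (m + 1) * (1 / real n)) - expint (\<mu> k) (real (m - 1) * (1 / real n)))\<bar> \<le>
      w k * (\<bar>\<mu> k\<bar> * exp (4 * \<bar>\<mu> k\<bar>)) / (real n)\<^sup>2"
      unfolding expint_second_difference[OF m(1)] abs_mult[of "w k"] using w[of k] by simp
  qed
  also have "\<dots> = L / (real n)\<^sup>2" by (simp add: L_def sum_divide_distrib)
  finally show ?thesis .
qed

lemma L_nonneg: "0 \<le> L"
  unfolding L_def by (intro sum_nonneg mult_nonneg_nonneg w) auto

text \<open>\<open>a + C\<close> bounds the sum over lags for the high modes on the scale n^(-1/2);
  \<open>2 * L\<close> accounts for the low modes at 2 n lags.\<close>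

definition c :: real where "c = a + C + 2 * L"

lemma c_nonneg: "0 \<le> c"
  using a C L_nonneg by (simp add: c_def)

lemma Dh_sum_le:
  assumes "real n > 1 / x0" "n \<ge> 1"
  shows "(\<Sum>m=1..M. Dh n m) \<le> (a + C) / sqrt (real n)"
proof -
  have "Gh (real M / real n) \<le> Gh (real (M + 1) / real n)" by (intro Gh_mono divide_right_mono) auto
  then show ?thesis using G_bound[OF assms] unfolding Dh_sum by linarith
qed

lemma D_sum_le:
  assumes "real n > 1 / x0" "n \<ge> 1"
  shows "(\<Sum>m=1..2*n. \<bar>D n m\<bar>) \<le> c / sqrt (real n)"
proof -
  have "(\<Sum>m=1..2*n. \<bar>D n m\<bar>) \<le> (\<Sum>m=1..2*n. Dh n m + L / (real n)\<^sup>2)"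
  proof (rule sum_mono)
    fix m assume "m \<in> {1..2*n}"
    then show "\<bar>D n m\<bar> \<le> Dh n m + L / (real n)\<^sup>2"
      using D_Dh[of m n] Dh_nonneg[of m n] assms(2) by (auto simp: abs_le_iff)
  qed
  also have "\<dots> = (\<Sum>m=1..2*n. Dh n m) + 2 * (L / real n)"
    using assms(2) by (simp add: sum.distrib power2_eq_square)
  also have "\<dots> \<le> (a + C) / sqrt (real n) + 2 * (L / sqrt (real n))"
  proof (intro add_mono mult_left_mono divide_left_mono Dh_sum_le assms)
    have "sqrt (real n) * 1 \<le> sqrt (real n) * sqrt (real n)" using assms(2) by (intro mult_left_mono) auto
    then show "sqrt (real n) \<le> real n" by simp
  qed (use L_nonneg assms(2) in auto)
  also have "\<dots> = c / sqrt (real n)" by (simp add: c_def add_divide_distrib)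
  finally show ?thesis .
qed

text \<open>A decreasing sequence with partial sums at most B satisfies m Dh(m) <= B, hence the
  decay 1 / m. The low modes contribute O(n^(-2)), which for m <= 2 n is of the same type. Being
  square summable, the bound later dominates the limit of the squares.\<close>

lemma D_le:
  assumes "real n > 1 / x0" "n \<ge> 1" and m: "1 \<le> m" "m \<le> 2 * n"
  shows "\<bar>D n m\<bar> \<le> c / (sqrt (real n) * real m)"
proof -
  have "real m * Dh n m = (\<Sum>l=1..m. Dh n m)" by simp
  also have "\<dots> \<le> (\<Sum>l=1..m. Dh n l)" by (intro sum_mono Dh_antimono) auto
  also have "\<dots> \<le> (a + C) / sqrt (real n)" by (rule Dh_sum_le[OF assms(1,2)])
  finally have "Dh n m \<le> (a + C) / (sqrt (real n) * real m)" using m by (simp add: field_simps)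
  moreover have "L / (real n)\<^sup>2 \<le> 2 * L / (sqrt (real n) * real m)"
  proof -
    have "sqrt (real n) * 1 \<le> sqrt (real n) * sqrt (real n)" using assms(2) by (intro mult_left_mono) auto
    then have "sqrt (real n) * real m \<le> real n * (2 * real n)" using m by (intro mult_mono) auto
    then have "1 / (real n * (2 * real n)) \<le> 1 / (sqrt (real n) * real m)"
      using m assms(2) by (intro divide_left_mono) auto
    then have "(2 * L) * (1 / (real n * (2 * real n))) \<le> (2 * L) * (1 / (sqrt (real n) * real m))"
      using L_nonneg by (intro mult_left_mono) auto
    then show ?thesis by (simp add: power2_eq_square)
  qed
  moreover have "\<bar>D n m\<bar> \<le> Dh n m + L / (real n)\<^sup>2"
    using D_Dh[OF m assms(2)] Dh_nonneg[OF m(1), of n] by (auto simp: abs_le_iff)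
  ultimately show ?thesis by (simp add: c_def add_divide_distrib)
qed

section \<open>Scaling limit of the covariances at a fixed lag\<close>

lemma G_scaled_tendsto: "(\<lambda>n. sqrt (real n) * G (real q / real n)) \<longlonglongrightarrow> a * sqrt (real q)"
proof (cases "q = 0")
  case False
  have "(\<lambda>n. sqrt (real n) * G (real q / real n) - a * sqrt (real q)) \<longlonglongrightarrow> 0"
  proof (rule Lim_null_comparison)
    show "eventually (\<lambda>n. norm (sqrt (real n) * G (real q / real n) - a * sqrt (real q)) \<le> C * real q * sqrt (real q) * inverse (real n)) sequentially"
      using eventually_gt_at_top[of "nat \<lceil>real q / x0\<rceil>"] eventually_gt_at_top[of 0]
    proof eventually_elim
      case (elim n)
      have "real q / x0 < real n" using elim(1) by linarith
      then have x: "0 < real q / real n" "real q / real n < x0" using elim(2) False x0 by (auto simp: field_simps)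
      have s: "sqrt (real n) * sqrt (real q / real n) = sqrt (real q)" using elim(2) by (simp add: real_sqrt_divide)
      have "\<bar>sqrt (real n) * (G (real q / real n) - a * sqrt (real q / real n))\<bar> \<le> sqrt (real n) * (C * ((real q / real n) * sqrt (real q / real n)))"
        unfolding abs_mult using asymp[OF x] by (intro mult_mono) (auto simp: G_def)
      also have "\<dots> = C * (real q / real n) * (sqrt (real n) * sqrt (real q / real n))" by (simp only: mult_ac)
      also have "\<dots> = C * real q * sqrt (real q) * inverse (real n)" unfolding s by (simp add: field_simps)
      also have "sqrt (real n) * (G (real q / real n) - a * sqrt (real q / real n)) = sqrt (real n) * G (real q / real n) - a * (sqrt (real n) * sqrt (real q / real n))"
        by (simp only: right_diff_distrib mult.left_commute)
      finally show ?case unfolding s by simp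
    qed
    show "(\<lambda>n. C * real q * sqrt (real q) * inverse (real n)) \<longlonglongrightarrow> 0"
      by (intro tendsto_mult_right_zero lim_inverse_n)
  qed
  then show ?thesis by (simp add: LIM_zero_iff)
qed simp

text \<open>On the scale n^(-1/2) only the leading term a sqrt x of \<open>G\<close> survives, and
  I(r) is the second difference of the square root at r + 1.\<close>

lemma D_scaled_tendsto:
  "(\<lambda>n. sqrt (real n) * D n (Suc r)) \<longlonglongrightarrow> a * I_const r"
proof -
  have "(\<lambda>n. 2 * (sqrt (real n) * G (real (r + 1) / real n)) - sqrt (real n) * G (real (r + 2) / real n) - sqrt (real n) * G (real r / real n)) \<longlonglongrightarrow>
     2 * (a * sqrt (real (r + 1))) - a * sqrt (real (r + 2)) - a * sqrt (real r)"
    by (intro tendsto_intros G_scaled_tendsto)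
  moreover have "2 * (a * sqrt (real (r + 1))) - a * sqrt (real (r + 2)) - a * sqrt (real r) = a * I_const r"
    by (simp add: I_const_def algebra_simps)
  moreover have "2 * (sqrt (real n) * G (real (r + 1) / real n)) - sqrt (real n) * G (real (r + 2) / real n) - sqrt (real n) * G (real r / real n) = sqrt (real n) * D n (Suc r)" for n
    by (simp add: D_def algebra_simps)
  ultimately show ?thesis by simp
qed

end

text \<open>The truncated differences i - j and j - i add up to |i - j|; lag r + 1 occurs n - r - 1
  times on each side of the diagonal.\<close>

lemma sum_abs_diff_index:
  fixes f :: "nat \<Rightarrow> real"
  shows "(\<Sum>i<n. \<Sum>j<n. f (i - j + (j - i))) = real n * f 0 + 2 * (\<Sum>r<n. real (n - Suc r) * f (Suc r))"
proof (induction n)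
  case (Suc n)
  have r: "(\<Sum>i<n. f (n - i)) = (\<Sum>r<n. f (Suc r))"
  proof -
    have "(\<Sum>i<n. f (n - i)) = (\<Sum>i<n. f (Suc (n - Suc i)))" by (intro sum.cong) (auto simp: Suc_diff_Suc)
    also have "\<dots> = (\<Sum>r<n. f (Suc r))" by (rule sum.nat_diff_reindex[of "\<lambda>i. f (Suc i)"])
    finally show ?thesis .
  qed
  have "(\<Sum>i<Suc n. \<Sum>j<Suc n. f (i - j + (j - i))) =
    (\<Sum>i<n. \<Sum>j<n. f (i - j + (j - i))) + (\<Sum>i<n. f (n - i)) + (\<Sum>j<n. f (n - j)) + f 0"
    by (simp add: sum.distrib)
  also have "\<dots> = real (Suc n) * f 0 + 2 * ((\<Sum>r<n. real (n - Suc r) * f (Suc r)) + (\<Sum>r<n. f (Suc r)))"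
    unfolding r Suc by (simp add: algebra_simps)
  also have "(\<Sum>r<n. real (n - Suc r) * f (Suc r)) + (\<Sum>r<n. f (Suc r)) = (\<Sum>r<n. real (Suc n - Suc r) * f (Suc r))"
    unfolding sum.distrib[symmetric] by (intro sum.cong) (auto simp: of_nat_diff algebra_simps)
  also have "\<dots> = (\<Sum>r<Suc n. real (Suc n - Suc r) * f (Suc r))" by simp
  finally show ?case .
qed simp

text \<open>Cruder than the logarithm, but sufficient after division by n.\<close>

lemma harmonic_le_sqrt: "(\<Sum>i<n. 1 / real (i + 1)) \<le> 2 * sqrt (real n)"
proof (induction n)
  case (Suc n)
  have "1 / real (n + 1) \<le> 2 * (sqrt (real (n + 1)) - sqrt (real n))"
  proof -
    define p where "p = sqrt (real (n + 1))"
    define q where "q = sqrt (real n)"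
    have p: "1 \<le> p" and q: "0 \<le> q" "q \<le> p" and e: "p * p = q * q + 1" by (simp_all add: p_def q_def)
    have "(p - q) * (p + q) = 1" using e by (simp add: algebra_simps)
    then have "1 \<le> (p - q) * (2 * p)" using q by (smt (verit) mult_left_mono)
    also have "\<dots> = (p - q) * (2 * p) * 1" by simp
    also have "\<dots> \<le> (p - q) * (2 * p) * p" using p q by (intro mult_left_mono) auto
    also have "\<dots> = 2 * (p - q) * (p * p)" by (simp only: mult_ac)
    finally have "1 / (p * p) \<le> 2 * (p - q)" using p by (simp add: divide_le_eq)
    then show ?thesis by (simp add: p_def q_def)
  qed
  with Suc show ?case by (simp add: add.commute)
qed simp

section \<open>Row sums, trace and squared entries of the covariance matrix\<close>

context heat_modes
begin

lemma D_inj_sum: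
  assumes n: "real n > 1 / x0" "n \<ge> 1" and "finite J" "inj_on f J" "f ` J \<subseteq> {1..2*n}"
  shows "(\<Sum>j\<in>J. \<bar>D n (f j)\<bar>) \<le> c / sqrt (real n)"
proof -
  have "(\<Sum>j\<in>J. \<bar>D n (f j)\<bar>) = (\<Sum>m\<in>f ` J. \<bar>D n m\<bar>)" using assms(4) by (simp add: sum.reindex)
  also have "\<dots> \<le> (\<Sum>m=1..2*n. \<bar>D n m\<bar>)" using assms(5) by (intro sum_mono2) auto
  also have "\<dots> \<le> c / sqrt (real n)" by (rule D_sum_le[OF n])
  finally show ?thesis .
qed

lemma D_0_abs:
  assumes n: "real n > 1 / x0" "n \<ge> 1"
  shows "\<bar>D n 0\<bar> \<le> 2 * (a + C) / sqrt (real n)"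
proof -
  have "\<bar>D n 0\<bar> = 2 * G (1 / real n)" using G_bound[OF n] by (simp add: D_0)
  also have "\<dots> \<le> 2 * ((a + C) / sqrt (real n))" using G_bound(3)[OF n] by (intro mult_left_mono) auto
  finally show ?thesis by simp
qed

text \<open>On either side of the diagonal the lags are distinct, so each side is bounded by the sum
  over all lags.\<close>

lemma D_diff_row:
  assumes n: "real n > 1 / x0" "n \<ge> 1" and i: "i < n"
  shows "(\<Sum>j<n. \<bar>D n (i - j + (j - i))\<bar>) \<le> 2 * (a + C + c) / sqrt (real n)"
proof -
  have split: "(\<Sum>j<n. f j) = (\<Sum>j<i. f j) + (f i + (\<Sum>j\<in>{Suc i..<n}. f j))" for f :: "nat \<Rightarrow> real"
    using i sum.atLeastLessThan_concat[of 0 i n f] sum.atLeast_Suc_lessThan[OF i, of f]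
    by (simp add: lessThan_atLeast0)
  have "(\<Sum>j<n. \<bar>D n (i - j + (j - i))\<bar>) =
    (\<Sum>j<i. \<bar>D n (i - j + (j - i))\<bar>) + (\<bar>D n 0\<bar> + (\<Sum>j\<in>{Suc i..<n}. \<bar>D n (i - j + (j - i))\<bar>))"
    by (subst split) simp
  also have "(\<Sum>j<i. \<bar>D n (i - j + (j - i))\<bar>) \<le> c / sqrt (real n)"
    using i by (intro D_inj_sum[OF n]) (auto simp: inj_on_def)
  also have "(\<Sum>j\<in>{Suc i..<n}. \<bar>D n (i - j + (j - i))\<bar>) \<le> c / sqrt (real n)"
    using i by (intro D_inj_sum[OF n]) (auto simp: inj_on_def)
  also note D_0_abs[OF n]
  finally show ?thesis by (simp add: add_divide_distrib)
qed

text \<open>\<open>v\<close> stands for \<sigma>^2. The Toeplitz term is the stationary part; the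
  Hankel term reflects that the stochastic convolutions start from 0 at time 0.\<close>

definition cov :: "real \<Rightarrow> nat \<Rightarrow> nat \<Rightarrow> nat \<Rightarrow> real" where
  "cov v n i j = - (v / 2) * (D n (i - j + (j - i)) + D n (i + j + 1))"

lemma cov_sym: "cov v n i j = cov v n j i"
  by (simp add: cov_def add.commute)

lemma cov_row:
  assumes n: "real n > 1 / x0" "n \<ge> 1" and i: "i < n" and v: "0 \<le> v"
  shows "(\<Sum>j<n. \<bar>cov v n i j\<bar>) \<le> v * (a + C + 2 * c) / sqrt (real n)"
proof -
  have "(\<Sum>j<n. \<bar>cov v n i j\<bar>) \<le> (\<Sum>j<n. v / 2 * (\<bar>D n (i - j + (j - i))\<bar> + \<bar>D n (i + j + 1)\<bar>))"
    using v by (intro sum_mono) (simp add: cov_def abs_mult mult_left_mono)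
  also have "\<dots> = v / 2 * ((\<Sum>j<n. \<bar>D n (i - j + (j - i))\<bar>) + (\<Sum>j<n. \<bar>D n (i + j + 1)\<bar>))"
    by (simp only: sum_distrib_left[symmetric] sum.distrib)
  also have "\<dots> \<le> v / 2 * (2 * (a + C + c) / sqrt (real n) + c / sqrt (real n))"
    using v i by (intro mult_left_mono add_mono D_diff_row[OF n i] D_inj_sum[OF n]) (auto simp: inj_on_def)
  also have "\<dots> \<le> v / 2 * (2 * (a + C + c) / sqrt (real n) + 2 * c / sqrt (real n))"
    using v c_nonneg by (intro mult_left_mono add_left_mono divide_right_mono) auto
  also have "\<dots> = v * (a + C + 2 * c) / sqrt (real n)"
    by (simp add: add_divide_distrib algebra_simps)
  finally show ?thesis .
qed

lemma inverse_sqrt_tendsto: "(\<lambda>n. K / sqrt (real n)) \<longlonglongrightarrow> 0"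
  by real_asymp

lemma eventually_large: "eventually (\<lambda>n. real n > 1 / x0 \<and> n \<ge> 1) sequentially"
proof -
  have "eventually (\<lambda>n. real n > 1 / x0) sequentially"
    using filterlim_real_sequentially by (simp add: filterlim_at_top_dense)
  then show ?thesis using eventually_ge_at_top[of 1] by eventually_elim simp
qed

text \<open>The error x^(3/2) in the expansion of \<open>G\<close> is exactly what is needed: n
  copies of it at x = 1 / n add up to O(n^(-1/2)). On the diagonal the Hankel lags 2 i + 1 are
  distinct, so they too add up to O(n^(-1/2)).\<close>

lemma cov_trace: "(\<lambda>n. (\<Sum>i<n. cov v n i i) - v * a * sqrt (real n)) \<longlonglongrightarrow> 0"
proof (rule Lim_null_comparison)
  show "eventually (\<lambda>n. norm ((\<Sum>i<n. cov v n i i) - v * a * sqrt (real n)) \<le> \<bar>v\<bar> * (C + c) / sqrt (real n)) sequentially"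
    using eventually_large
  proof eventually_elim
    case (elim n)
    then have n: "real n > 1 / x0" "n \<ge> 1" by auto
    have n': "0 < 1 / real n" "1 / real n < x0" using n x0 by (auto simp: field_simps)
    have eq: "(\<Sum>i<n. cov v n i i) - v * a * sqrt (real n) = v * (real n * G (1 / real n) - a * sqrt (real n)) - v / 2 * (\<Sum>i<n. D n (i + i + 1))"
    proof -
      have "(\<Sum>i<n. cov v n i i) = - (v / 2) * (real n * D n 0 + (\<Sum>i<n. D n (i + i + 1)))"
        unfolding cov_def sum_distrib_left[symmetric] sum.distrib by simp
      then show ?thesis unfolding D_0 by (simp add: algebra_simps)
    qed
    have 1: "\<bar>real n * G (1 / real n) - a * sqrt (real n)\<bar> \<le> C / sqrt (real n)"
    proof -
      have s: "real n * sqrt (1 / real n) = sqrt (real n)" using n by (simp add: real_sqrt_divide real_div_sqrt)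
      have "\<bar>real n * (G (1 / real n) - a * sqrt (1 / real n))\<bar> \<le> real n * (C * ((1 / real n) * sqrt (1 / real n)))"
        unfolding abs_mult using asymp[OF n'] by (intro mult_mono) (auto simp: G_def)
      also have "\<dots> = C / sqrt (real n)" using n by (simp add: real_sqrt_divide)
      also have "real n * (G (1 / real n) - a * sqrt (1 / real n)) = real n * G (1 / real n) - a * sqrt (real n)"
        by (simp only: right_diff_distrib mult.left_commute[of "real n" a] s)
      finally show ?thesis .
    qed
    have 2: "\<bar>\<Sum>i<n. D n (i + i + 1)\<bar> \<le> c / sqrt (real n)"
      by (rule order_trans[OF sum_abs]) (rule D_inj_sum[OF n], auto simp: inj_on_def)
    have "norm ((\<Sum>i<n. cov v n i i) - v * a * sqrt (real n)) \<le> \<bar>v\<bar> * (C / sqrt (real n)) + \<bar>v\<bar> / 2 * (c / sqrt (real n))"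
      unfolding eq real_norm_def
    proof (rule order_trans[OF abs_triangle_ineq4 add_mono])
      show "\<bar>v * (real n * G (1 / real n) - a * sqrt (real n))\<bar> \<le> \<bar>v\<bar> * (C / sqrt (real n))"
        unfolding abs_mult[of v] by (rule mult_left_mono[OF 1]) simp
      have "\<bar>v / 2\<bar> * \<bar>\<Sum>i<n. D n (i + i + 1)\<bar> \<le> \<bar>v / 2\<bar> * (c / sqrt (real n))"
        by (rule mult_left_mono[OF 2]) simp
      then show "\<bar>v / 2 * (\<Sum>i<n. D n (i + i + 1))\<bar> \<le> \<bar>v\<bar> / 2 * (c / sqrt (real n))"
        by (simp only: abs_mult abs_divide abs_numeral)
    qed
    also have "\<dots> \<le> \<bar>v\<bar> * (C / sqrt (real n)) + \<bar>v\<bar> * (c / sqrt (real n))"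
      using c_nonneg by (intro add_left_mono mult_right_mono) auto
    finally show ?case by (simp add: add_divide_distrib algebra_simps)
  qed
  show "(\<lambda>n. \<bar>v\<bar> * (C + c) / sqrt (real n)) \<longlonglongrightarrow> 0" by (rule inverse_sqrt_tendsto)
qed

text \<open>Tannery's theorem over the lags: the squares at lag r + 1, counted on one side of the
  diagonal, tend to a^2 I(r)^2 and are dominated by c^2 / (r + 1)^2 through \<open>D_le\<close>. The
  diagonal contributes 4 a^2.\<close>

lemma D_diff_squares:
  shows "(\<lambda>n. \<Sum>i<n. \<Sum>j<n. (D n (i - j + (j - i)))\<^sup>2) \<longlonglongrightarrow> 4 * a\<^sup>2 + 2 * (\<Sum>r. a\<^sup>2 * (I_const r)\<^sup>2)"
    and "summable (\<lambda>r. a\<^sup>2 * (I_const r)\<^sup>2)"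
proof -
  let ?f = "\<lambda>r n. if r < n then real (n - Suc r) * (D n (Suc r))\<^sup>2 else 0"
  let ?M = "\<lambda>r. c\<^sup>2 * inverse ((real (Suc r))\<^sup>2)"
  have d0: "(\<lambda>n. real n * (D n 0)\<^sup>2) \<longlonglongrightarrow> 4 * a\<^sup>2"
  proof -
    have "(\<lambda>n. 4 * (sqrt (real n) * G (real 1 / real n))\<^sup>2) \<longlonglongrightarrow> 4 * (a * sqrt (real 1))\<^sup>2"
      by (intro tendsto_intros G_scaled_tendsto)
    moreover have "4 * (sqrt (real n) * G (real 1 / real n))\<^sup>2 = real n * (D n 0)\<^sup>2" for n
      by (simp add: D_0 power_mult_distrib)
    ultimately have "(\<lambda>n. real n * (D n 0)\<^sup>2) \<longlonglongrightarrow> 4 * (a * sqrt (real 1))\<^sup>2" by (simp only:)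
    then show ?thesis by simp
  qed
  have lim: "(\<lambda>n. ?f r n) \<longlonglongrightarrow> a\<^sup>2 * (I_const r)\<^sup>2" for r
  proof -
    have "(\<lambda>n. (1 - real (Suc r) / real n) * (sqrt (real n) * D n (Suc r))\<^sup>2) \<longlonglongrightarrow> 1 * (a * I_const r)\<^sup>2"
    proof (rule tendsto_mult[OF _ tendsto_power[OF D_scaled_tendsto]])
      show "(\<lambda>n. 1 - real (Suc r) / real n) \<longlonglongrightarrow> 1" by real_asymp
    qed
    then have 1: "(\<lambda>n. (1 - real (Suc r) / real n) * (sqrt (real n) * D n (Suc r))\<^sup>2) \<longlonglongrightarrow> a\<^sup>2 * (I_const r)\<^sup>2"
      by (simp add: power_mult_distrib)
    show ?thesis
    proof (rule Lim_transform_eventually[OF 1])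
      show "eventually (\<lambda>n. (1 - real (Suc r) / real n) * (sqrt (real n) * D n (Suc r))\<^sup>2 = ?f r n) sequentially"
        using eventually_gt_at_top[of r]
      proof eventually_elim
        case (elim n)
        then have "(1 - real (Suc r) / real n) * real n = real (n - Suc r)" by (simp add: of_nat_diff field_simps)
        then show ?case using elim by (simp add: power_mult_distrib mult.assoc[symmetric])
      qed
    qed
  qed
  have bound: "\<bar>?f r n\<bar> \<le> ?M r" if n: "real n > 1 / x0" "n \<ge> 1" for r n
  proof (cases "r < n")
    case True
    have "\<bar>D n (Suc r)\<bar>\<^sup>2 \<le> (c / (sqrt (real n) * real (Suc r)))\<^sup>2"
      using True by (intro power_mono D_le[OF n]) auto
    then have "real (n - Suc r) * (D n (Suc r))\<^sup>2 \<le> real n * (c / (sqrt (real n) * real (Suc r)))\<^sup>2"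
      by (intro mult_mono) auto
    also have "\<dots> = ?M r" using n by (simp add: power_divide power_mult_distrib inverse_eq_divide del: of_nat_Suc)
    finally show ?thesis using True by simp
  qed simp
  have "(\<lambda>n. \<Sum>r. ?f r n) \<longlonglongrightarrow> (\<Sum>r. a\<^sup>2 * (I_const r)\<^sup>2) \<and> summable (\<lambda>r. a\<^sup>2 * (I_const r)\<^sup>2)"
  proof -
    have ev: "eventually (\<lambda>(r, n). norm (?f r n) \<le> ?M r) (at_top \<times>\<^sub>F sequentially)"
      unfolding eventually_prod_filter
      by (intro exI[of _ "\<lambda>_. True"] exI[of _ "\<lambda>n. real n > 1 / x0 \<and> n \<ge> 1"])
        (use eventually_large bound in auto)
    have sM: "summable ?M"
    proof -
      have "summable (\<lambda>r. inverse ((real (Suc r))\<^sup>2))"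
        using inverse_power_summable[of 2, where 'a = real] by (subst summable_Suc_iff) simp
      then show ?thesis by (rule summable_mult)
    qed
    show ?thesis using tannerys_theorem[OF lim ev sM] by simp
  qed
  then have "(\<lambda>n. \<Sum>r. ?f r n) \<longlonglongrightarrow> (\<Sum>r. a\<^sup>2 * (I_const r)\<^sup>2)"
    and "summable (\<lambda>r. a\<^sup>2 * (I_const r)\<^sup>2)" by blast+
  then show "summable (\<lambda>r. a\<^sup>2 * (I_const r)\<^sup>2)" by simp
  have "(\<lambda>n. \<Sum>r. ?f r n) \<longlonglongrightarrow> (\<Sum>r. a\<^sup>2 * (I_const r)\<^sup>2)" by fact
  moreover have "(\<Sum>r. ?f r n) = (\<Sum>r<n. real (n - Suc r) * (D n (Suc r))\<^sup>2)" for n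
    by (subst suminf_finite[of "{..<n}"]) auto
  ultimately have "(\<lambda>n. \<Sum>r<n. real (n - Suc r) * (D n (Suc r))\<^sup>2) \<longlonglongrightarrow> (\<Sum>r. a\<^sup>2 * (I_const r)\<^sup>2)"
    by (simp only:)
  from tendsto_add[OF d0 tendsto_mult[OF tendsto_const[of 2] this]]
  show "(\<lambda>n. \<Sum>i<n. \<Sum>j<n. (D n (i - j + (j - i)))\<^sup>2) \<longlonglongrightarrow> 4 * a\<^sup>2 + 2 * (\<Sum>r. a\<^sup>2 * (I_const r)\<^sup>2)"
    by (simp add: sum_abs_diff_index[of "\<lambda>m. (D _ m)\<^sup>2"])
qed

text \<open>One factor of each square is estimated by \<open>D_le\<close>, the lag being at least i
  + 1; the other is summed over the row. This leaves c^2 / n times a harmonic sum, so the Hankel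
  part is negligible.\<close>

lemma D_sum_squares: "(\<lambda>n. \<Sum>i<n. \<Sum>j<n. (D n (i + j + 1))\<^sup>2) \<longlonglongrightarrow> 0"
proof (rule Lim_null_comparison)
  show "eventually (\<lambda>n. norm (\<Sum>i<n. \<Sum>j<n. (D n (i + j + 1))\<^sup>2) \<le> 2 * c\<^sup>2 / sqrt (real n)) sequentially"
    using eventually_large
  proof eventually_elim
    case (elim n)
    then have n: "real n > 1 / x0" "n \<ge> 1" by auto
    have "(\<Sum>j<n. (D n (i + j + 1))\<^sup>2) \<le> c\<^sup>2 / real n * (1 / real (i + 1))" if i: "i < n" for i
    proof -
      have "(\<Sum>j<n. (D n (i + j + 1))\<^sup>2) \<le> (\<Sum>j<n. c / (sqrt (real n) * real (i + 1)) * \<bar>D n (i + j + 1)\<bar>)"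
      proof (rule sum_mono)
        fix j assume "j \<in> {..<n}"
        then have "\<bar>D n (i + j + 1)\<bar> \<le> c / (sqrt (real n) * real (i + j + 1))"
          using i by (intro D_le[OF n]) auto
        also have "\<dots> \<le> c / (sqrt (real n) * real (i + 1))"
          using n c_nonneg by (intro divide_left_mono mult_left_mono mult_pos_pos) auto
        finally have "\<bar>D n (i + j + 1)\<bar> * \<bar>D n (i + j + 1)\<bar> \<le> c / (sqrt (real n) * real (i + 1)) * \<bar>D n (i + j + 1)\<bar>"
          by (intro mult_right_mono) auto
        then show "(D n (i + j + 1))\<^sup>2 \<le> c / (sqrt (real n) * real (i + 1)) * \<bar>D n (i + j + 1)\<bar>"
          by (simp add: power2_eq_square)
      qed
      also have "\<dots> = c / (sqrt (real n) * real (i + 1)) * (\<Sum>j<n. \<bar>D n (i + j + 1)\<bar>)"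
        by (simp only: sum_distrib_left)
      also have "\<dots> \<le> c / (sqrt (real n) * real (i + 1)) * (c / sqrt (real n))"
        using c_nonneg i by (intro mult_left_mono D_inj_sum[OF n]) (auto simp: inj_on_def)
      also have "\<dots> = c\<^sup>2 / real n * (1 / real (i + 1))"
        by (simp add: power2_eq_square)
      finally show ?thesis .
    qed
    then have "(\<Sum>i<n. \<Sum>j<n. (D n (i + j + 1))\<^sup>2) \<le> (\<Sum>i<n. c\<^sup>2 / real n * (1 / real (i + 1)))"
      by (intro sum_mono) auto
    also have "\<dots> = c\<^sup>2 / real n * (\<Sum>i<n. 1 / real (i + 1))" by (simp only: sum_distrib_left)
    also have "\<dots> \<le> c\<^sup>2 / real n * (2 * sqrt (real n))"
      by (intro mult_left_mono harmonic_le_sqrt) auto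
    also have "\<dots> = 2 * c\<^sup>2 * (sqrt (real n) / real n)" by simp
    also have "sqrt (real n) / real n = 1 / sqrt (real n)" using n by (simp add: field_simps)
    finally show ?case by (simp add: sum_nonneg)
  qed
  show "(\<lambda>n. 2 * c\<^sup>2 / sqrt (real n)) \<longlonglongrightarrow> 0" by (rule inverse_sqrt_tendsto)
qed

lemma cov_squares:
  "(\<lambda>n. \<Sum>i<n. \<Sum>j<n. (cov v n i j)\<^sup>2) \<longlonglongrightarrow> v\<^sup>2 * a\<^sup>2 * (1 + (\<Sum>r. (I_const r)\<^sup>2) / 2)"
proof -
  let ?A = "\<lambda>n i j. D n (i - j + (j - i))" and ?B = "\<lambda>n i j. D n (i + j + 1)"
  \<comment> \<open>Cauchy-Schwarz: the squared entries of the Hankel part sum to o(1), those of the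
    Toeplitz part stay bounded.\<close>
  have cross: "(\<lambda>n. \<Sum>i<n. \<Sum>j<n. ?A n i j * ?B n i j) \<longlonglongrightarrow> 0"
  proof (rule Lim_null_comparison)
    show "eventually (\<lambda>n. norm (\<Sum>i<n. \<Sum>j<n. ?A n i j * ?B n i j) \<le> sqrt ((\<Sum>i<n. \<Sum>j<n. (?A n i j)\<^sup>2) * (\<Sum>i<n. \<Sum>j<n. (?B n i j)\<^sup>2))) sequentially"
    proof (intro always_eventually allI)
      fix n
      have "(\<Sum>p\<in>{..<n}\<times>{..<n}. ?A n (fst p) (snd p) * ?B n (fst p) (snd p))\<^sup>2 \<le>
        (\<Sum>p\<in>{..<n}\<times>{..<n}. (?A n (fst p) (snd p))\<^sup>2) * (\<Sum>p\<in>{..<n}\<times>{..<n}. (?B n (fst p) (snd p))\<^sup>2)"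
        by (rule Cauchy_Schwarz_ineq_sum)
      then have "(\<Sum>i<n. \<Sum>j<n. ?A n i j * ?B n i j)\<^sup>2 \<le> (\<Sum>i<n. \<Sum>j<n. (?A n i j)\<^sup>2) * (\<Sum>i<n. \<Sum>j<n. (?B n i j)\<^sup>2)"
        by (simp add: sum.cartesian_product' case_prod_beta')
      then show "norm (\<Sum>i<n. \<Sum>j<n. ?A n i j * ?B n i j) \<le> sqrt ((\<Sum>i<n. \<Sum>j<n. (?A n i j)\<^sup>2) * (\<Sum>i<n. \<Sum>j<n. (?B n i j)\<^sup>2))"
        by (simp add: real_le_rsqrt)
    qed
    have "(\<lambda>n. sqrt ((\<Sum>i<n. \<Sum>j<n. (?A n i j)\<^sup>2) * (\<Sum>i<n. \<Sum>j<n. (?B n i j)\<^sup>2))) \<longlonglongrightarrow> sqrt ((4 * a\<^sup>2 + 2 * (\<Sum>r. a\<^sup>2 * (I_const r)\<^sup>2)) * 0)"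
      by (intro tendsto_intros D_diff_squares(1) D_sum_squares)
    then show "(\<lambda>n. sqrt ((\<Sum>i<n. \<Sum>j<n. (?A n i j)\<^sup>2) * (\<Sum>i<n. \<Sum>j<n. (?B n i j)\<^sup>2))) \<longlonglongrightarrow> 0" by simp
  qed
  have eq: "(\<Sum>i<n. \<Sum>j<n. (cov v n i j)\<^sup>2) = v\<^sup>2 / 4 * ((\<Sum>i<n. \<Sum>j<n. (?A n i j)\<^sup>2) + 2 * (\<Sum>i<n. \<Sum>j<n. ?A n i j * ?B n i j) + (\<Sum>i<n. \<Sum>j<n. (?B n i j)\<^sup>2))" for n
  proof -
    have "(cov v n i j)\<^sup>2 = v\<^sup>2 / 4 * ((?A n i j)\<^sup>2 + 2 * (?A n i j * ?B n i j) + (?B n i j)\<^sup>2)" for i j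
      unfolding cov_def by (simp add: power2_eq_square algebra_simps)
    then show ?thesis by (simp only: sum_distrib_left[symmetric] sum.distrib)
  qed
  have "(\<lambda>n. v\<^sup>2 / 4 * ((\<Sum>i<n. \<Sum>j<n. (?A n i j)\<^sup>2) + 2 * (\<Sum>i<n. \<Sum>j<n. ?A n i j * ?B n i j) + (\<Sum>i<n. \<Sum>j<n. (?B n i j)\<^sup>2))) \<longlonglongrightarrow>
    v\<^sup>2 / 4 * ((4 * a\<^sup>2 + 2 * (\<Sum>r. a\<^sup>2 * (I_const r)\<^sup>2)) + 2 * 0 + 0)"
    by (intro tendsto_intros D_diff_squares(1) D_sum_squares cross)
  moreover have "(\<Sum>r. a\<^sup>2 * (I_const r)\<^sup>2) = a\<^sup>2 * (\<Sum>r. (I_const r)\<^sup>2)"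
  proof (cases "a = 0")
    case False
    then show ?thesis
      using D_diff_squares(2) by (intro suminf_mult) (simp add: summable_cmult_iff)
  qed simp
  ultimately show ?thesis unfolding eq by (simp add: algebra_simps)
qed

end

section \<open>Influence of the initial value\<close>

lemma slutsky_char:
  fixes U V P R :: "nat \<Rightarrow> 'a \<Rightarrow> real"
  assumes "prob_space M"
    and [measurable]: "\<And>n. U n \<in> borel_measurable M" "\<And>n. V n \<in> borel_measurable M"
      "\<And>n. P n \<in> borel_measurable M" "\<And>n. R n \<in> borel_measurable M"
    and P: "\<And>n x. 0 \<le> P n x" "\<And>x. (\<lambda>n. P n x) \<longlonglongrightarrow> 0"
    and R: "\<And>n x. 0 \<le> R n x" "(\<lambda>n. \<integral>\<^sup>+x. ennreal (R n x) \<partial>M) \<longlonglongrightarrow> 0"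
    and bound: "eventually (\<lambda>n. AE x in M. \<bar>U n x - V n x\<bar> \<le> P n x + R n x) sequentially"
    and lim: "(\<lambda>n. CLINT x|M. iexp (t * V n x)) \<longlonglongrightarrow> l"
  shows "(\<lambda>n. CLINT x|M. iexp (t * U n x)) \<longlonglongrightarrow> l"
proof -
  interpret prob_space M by fact
  have int: "integrable M (\<lambda>x. iexp (f x))" if [measurable]: "f \<in> borel_measurable M" for f
    by (rule integrable_iexp) auto
  let ?d = "\<lambda>n. (CLINT x|M. iexp (t * U n x)) - (CLINT x|M. iexp (t * V n x))"
  \<comment> \<open>Truncation at 2, the largest distance between two points of the unit circle,
    allows dominated convergence.\<close>
  have Plim: "(\<lambda>n. \<integral>\<^sup>+x. ennreal (min 2 (\<bar>t\<bar> * P n x)) \<partial>M) \<longlonglongrightarrow> (\<integral>\<^sup>+x. 0 \<partial>M)"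
  proof (rule nn_integral_dominated_convergence[where w = "\<lambda>_. 2"])
    show "AE x in M. (\<lambda>n. ennreal (min 2 (\<bar>t\<bar> * P n x))) \<longlonglongrightarrow> 0"
    proof (intro AE_I2)
      fix x
      have "(\<lambda>n. min 2 (\<bar>t\<bar> * P n x)) \<longlonglongrightarrow> min 2 (\<bar>t\<bar> * 0)" by (intro tendsto_intros P)
      then have "(\<lambda>n. ennreal (min 2 (\<bar>t\<bar> * P n x))) \<longlonglongrightarrow> ennreal 0" by (intro tendsto_ennrealI) simp
      then show "(\<lambda>n. ennreal (min 2 (\<bar>t\<bar> * P n x))) \<longlonglongrightarrow> 0" by simp
    qed
    show "AE x in M. ennreal (min 2 (\<bar>t\<bar> * P n x)) \<le> 2" for n
      by (intro AE_I2) (metis ennreal_leI ennreal_numeral min.cobounded1 zero_le_numeral)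
  qed (auto simp: emeasure_space_1)
  have min_add_le: "c \<le> min 2 a + b" if "c \<le> 2" "c \<le> a + b" "0 \<le> b" for a b c :: real
    using that by (auto simp: min_def)
  have upper: "(\<lambda>n. (\<integral>\<^sup>+x. ennreal (min 2 (\<bar>t\<bar> * P n x)) \<partial>M) + ennreal \<bar>t\<bar> * (\<integral>\<^sup>+x. ennreal (R n x) \<partial>M)) \<longlonglongrightarrow> 0"
    using tendsto_add[OF Plim ennreal_tendsto_cmult[OF _ R(2), of "ennreal \<bar>t\<bar>"]] by simp
  have le: "eventually (\<lambda>n. ennreal (norm (?d n)) \<le> (\<integral>\<^sup>+x. ennreal (min 2 (\<bar>t\<bar> * P n x)) \<partial>M) + ennreal \<bar>t\<bar> * (\<integral>\<^sup>+x. ennreal (R n x) \<partial>M)) sequentially"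
    using bound
  proof eventually_elim
    case (elim n)
    have "ennreal (norm (?d n)) = ennreal (norm (CLINT x|M. iexp (t * U n x) - iexp (t * V n x)))"
      by (subst Bochner_Integration.integral_diff[OF int int]) auto
    also have "\<dots> \<le> (\<integral>\<^sup>+x. ennreal (norm (iexp (t * U n x) - iexp (t * V n x))) \<partial>M)"
      by (rule integral_norm_bound_ennreal, rule Bochner_Integration.integrable_diff[OF int int]) auto
    also have "\<dots> \<le> (\<integral>\<^sup>+x. ennreal (min 2 (\<bar>t\<bar> * P n x)) + ennreal \<bar>t\<bar> * ennreal (R n x) \<partial>M)"
    proof (rule nn_integral_mono_AE, use elim in eventually_elim)
      case (elim x)
      have "norm (iexp (t * U n x) - iexp (t * V n x)) \<le> norm (iexp (t * U n x)) + norm (iexp (t * V n x))"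
        by (rule norm_triangle_ineq4)
      then have 1: "norm (iexp (t * U n x) - iexp (t * V n x)) \<le> 2" by (simp only: norm_exp_i_times)
      have "norm (iexp (t * U n x) - iexp (t * V n x)) \<le> \<bar>t * U n x - t * V n x\<bar>" by (rule norm_iexp_diff_le)
      also have "\<dots> = \<bar>t\<bar> * \<bar>U n x - V n x\<bar>" by (simp only: right_diff_distrib[symmetric] abs_mult)
      also have "\<dots> \<le> \<bar>t\<bar> * (P n x + R n x)" by (rule mult_left_mono[OF elim]) simp
      finally have 2: "norm (iexp (t * U n x) - iexp (t * V n x)) \<le> \<bar>t\<bar> * P n x + \<bar>t\<bar> * R n x" by (simp only: distrib_left)
      have "0 \<le> \<bar>t\<bar> * R n x" using R(1) by simp
      with 1 2 have "norm (iexp (t * U n x) - iexp (t * V n x)) \<le> min 2 (\<bar>t\<bar> * P n x) + \<bar>t\<bar> * R n x"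
        using min_add_le by blast
      then have "ennreal (norm (iexp (t * U n x) - iexp (t * V n x))) \<le> ennreal (min 2 (\<bar>t\<bar> * P n x) + \<bar>t\<bar> * R n x)"
        by (rule ennreal_leI)
      also have "\<dots> = ennreal (min 2 (\<bar>t\<bar> * P n x)) + ennreal \<bar>t\<bar> * ennreal (R n x)"
        using P(1)[of n x] R(1)[of n x] by (simp add: ennreal_plus ennreal_mult)
      finally show "ennreal (norm (iexp (t * U n x) - iexp (t * V n x))) \<le> ennreal (min 2 (\<bar>t\<bar> * P n x)) + ennreal \<bar>t\<bar> * ennreal (R n x)" .
    qed
    also have "\<dots> = (\<integral>\<^sup>+x. ennreal (min 2 (\<bar>t\<bar> * P n x)) \<partial>M) + ennreal \<bar>t\<bar> * (\<integral>\<^sup>+x. ennreal (R n x) \<partial>M)"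
      by (simp add: nn_integral_add nn_integral_cmult)
    finally show ?case .
  qed
  have "(\<lambda>n. ennreal (norm (?d n))) \<longlonglongrightarrow> 0"
    by (rule tendsto_sandwich[OF _ le tendsto_const upper]) simp
  then have "(\<lambda>n. ennreal (norm (?d n))) \<longlonglongrightarrow> ennreal 0" by simp
  then have "(\<lambda>n. norm (?d n)) \<longlonglongrightarrow> 0" by (rule tendsto_ennrealD) auto
  then have "?d \<longlonglongrightarrow> 0" by (rule tendsto_norm_zero_cancel)
  from tendsto_add[OF this lim] show ?thesis by simp
qed

section \<open>Decay of the initial coefficients along the observation grid\<close>

definition expinc :: "real \<Rightarrow> nat \<Rightarrow> nat \<Rightarrow> real" where
  "expinc \<mu> n i = exp (- \<mu> * (real (i + 1) / real n)) - exp (- \<mu> * (real i / real n))"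

lemma expinc_eq:
  "expinc \<mu> n i = - (exp (- \<mu> * (1 / real n)) ^ i * (1 - exp (- \<mu> * (1 / real n))))"
proof -
  have 1: "exp (- \<mu> * (real i / real n)) = exp (- \<mu> * (1 / real n)) ^ i"
    by (simp add: exp_of_nat_mult[symmetric])
  have 2: "exp (- \<mu> * (real (i + 1) / real n)) = exp (- \<mu> * (real i / real n)) * exp (- \<mu> * (1 / real n))"
    by (simp add: add_divide_distrib algebra_simps flip: exp_add)
  show ?thesis unfolding expinc_def 2 1 by (simp add: algebra_simps)
qed

text \<open>1 - x is at most 1 - x^2, and with the latter factor the sum of x^(2 i)
  telescopes.\<close>

lemma sum_square_geometric_le:
  fixes x :: real
  assumes x: "0 \<le> x" "x \<le> 1"
  shows "(\<Sum>i<n. (x ^ i * (1 - x))\<^sup>2) \<le> 1 - x"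
proof -
  have "(\<Sum>i<n. (x ^ i * (1 - x))\<^sup>2) = (1 - x) * ((1 - x) * (\<Sum>i<n. (x\<^sup>2) ^ i))"
    by (simp add: sum_distrib_left power_mult_distrib power_mult[symmetric] power2_eq_square[of "1-x"] mult_ac)
  also have "\<dots> \<le> (1 - x) * 1"
  proof (rule mult_left_mono)
    have "(1 - x) * (\<Sum>i<n. (x\<^sup>2) ^ i) \<le> (1 - x\<^sup>2) * (\<Sum>i<n. (x\<^sup>2) ^ i)"
      using x by (intro mult_right_mono sum_nonneg) (auto simp: power2_eq_square mult_left_le)
    also have "\<dots> = 1 - (x\<^sup>2) ^ n" by (rule one_diff_power_eq[symmetric])
    also have "\<dots> \<le> 1" by simp
    finally show "(1 - x) * (\<Sum>i<n. (x\<^sup>2) ^ i) \<le> 1" .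
  qed (use x in simp)
  finally show ?thesis by simp
qed

text \<open>Leaving out i = 0 gains the factor exp(-\<mu> / n)^2, which is what makes the bounds
  summable over the modes.\<close>

lemma sum_expinc_square_le:
  assumes "\<mu> > 0"
  shows "(\<Sum>i<n. (expinc \<mu> n i)\<^sup>2) \<le> 1 - exp (- \<mu> * (1 / real n))"
    and "(\<Sum>i\<in>{1..<n}. (expinc \<mu> n i)\<^sup>2) \<le> (exp (- \<mu> * (1 / real n)))\<^sup>2 * (1 - exp (- \<mu> * (1 / real n)))"
proof -
  define x where "x = exp (- \<mu> * (1 / real n))"
  have x: "0 \<le> x" "x \<le> 1" using assms by (auto simp: x_def)
  have sq: "(expinc \<mu> n i)\<^sup>2 = (x ^ i * (1 - x))\<^sup>2" for i by (simp only: expinc_eq x_def power2_minus)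
  show "(\<Sum>i<n. (expinc \<mu> n i)\<^sup>2) \<le> 1 - exp (- \<mu> * (1 / real n))"
    unfolding sq using sum_square_geometric_le[OF x, of n] by (simp only: x_def)
  have "(\<Sum>i\<in>{1..<n}. (x ^ i * (1 - x))\<^sup>2) = (\<Sum>i<n - 1. (x ^ Suc i * (1 - x))\<^sup>2)"
    by (rule sum.reindex_bij_witness[of _ Suc "\<lambda>i. i - 1"]) auto
  also have "\<dots> = x\<^sup>2 * (\<Sum>i<n - 1. (x ^ i * (1 - x))\<^sup>2)"
    by (simp add: sum_distrib_left power_mult_distrib mult.assoc)
  also have "\<dots> \<le> x\<^sup>2 * (1 - x)"
    by (intro mult_left_mono sum_square_geometric_le x) simp
  finally show "(\<Sum>i\<in>{1..<n}. (expinc \<mu> n i)\<^sup>2) \<le> (exp (- \<mu> * (1 / real n)))\<^sup>2 * (1 - exp (- \<mu> * (1 / real n)))"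
    unfolding sq x_def .
qed

text \<open>For a fixed rate of either sign the increments are O(1 / n); this serves the low
  modes.\<close>

lemma expinc_abs_le:
  assumes "n \<ge> 1" "i < n"
  shows "\<bar>expinc \<mu> n i\<bar> \<le> \<bar>\<mu>\<bar> * exp \<bar>\<mu>\<bar> / real n"
proof -
  have d: "((\<lambda>t. exp (- \<mu> * t)) has_real_derivative - \<mu> * exp (- \<mu> * t)) (at t)" for t
    by (auto intro!: derivative_eq_intros)
  have lt: "real i / real n < real (i + 1) / real n" using assms by (intro divide_strict_right_mono) auto
  obtain z where z: "real i / real n < z" "z < real (i + 1) / real n"
    "expinc \<mu> n i = (real (i + 1) / real n - real i / real n) * (- \<mu> * exp (- \<mu> * z))"
    using MVT2[OF lt, of "\<lambda>t. exp (- \<mu> * t)" "\<lambda>t. - \<mu> * exp (- \<mu> * t)"] d unfolding expinc_def by auto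
  have "0 \<le> real i / real n" by simp
  then have "0 \<le> z" using z(1) by linarith
  moreover have "z \<le> 1"
  proof -
    have "real (i + 1) / real n \<le> 1" using assms by (simp add: divide_le_eq)
    then show ?thesis using z(2) by linarith
  qed
  ultimately have "\<bar>\<mu> * z\<bar> \<le> \<bar>\<mu>\<bar>" by (simp add: abs_mult mult_left_le)
  then have e: "exp (- \<mu> * z) \<le> exp \<bar>\<mu>\<bar>" by (simp add: abs_le_iff)
  have "\<bar>expinc \<mu> n i\<bar> = 1 / real n * (\<bar>\<mu>\<bar> * exp (- \<mu> * z))"
    unfolding z(3) by (simp add: abs_mult add_divide_distrib)
  also have "\<dots> \<le> 1 / real n * (\<bar>\<mu>\<bar> * exp \<bar>\<mu>\<bar>)" using e by (intro mult_left_mono) auto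
  finally show ?thesis by simp
qed

text \<open>Only modes with rate up to order n count, and there are about sqrt n of them since the
  rates grow quadratically.\<close>

lemma sum_exp_modes_le:
  fixes \<mu> :: "nat \<Rightarrow> real"
  assumes m0: "0 < m0" and \<mu>: "\<And>k. K0 \<le> k \<Longrightarrow> m0 * (real (Suc k))\<^sup>2 \<le> \<mu> k" and n: "n \<ge> 1"
  shows "(\<Sum>k\<in>{K0..<N}. exp (- \<mu> k * (1 / real n))) \<le> (1 + sqrt (pi / m0)) * sqrt (real n)"
proof -
  define s where "s = m0 / real n"
  have s: "s > 0" using m0 n by (simp add: s_def)
  have "(\<Sum>k\<in>{K0..<N}. exp (- \<mu> k * (1 / real n))) \<le> (\<Sum>k\<in>{K0..<N}. exp (- s * (real (Suc k))\<^sup>2))"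
  proof (rule sum_mono)
    fix k assume "k \<in> {K0..<N}"
    then have "m0 * (real (Suc k))\<^sup>2 * (1 / real n) \<le> \<mu> k * (1 / real n)"
      by (intro mult_right_mono \<mu>) auto
    then show "exp (- \<mu> k * (1 / real n)) \<le> exp (- s * (real (Suc k))\<^sup>2)" by (simp add: s_def)
  qed
  also have "\<dots> \<le> (\<Sum>k<N. exp (- s * (real (Suc k))\<^sup>2))" by (intro sum_mono2) auto
  also have "\<dots> \<le> (\<Sum>k<N. exp (- s * (real k)\<^sup>2))"
    using s by (intro sum_mono) (simp add: mult_left_mono power_mono)
  also have "\<dots> \<le> 1 + sqrt (pi / s) / 2" by (rule sum_gauss_le[OF s])
  also have "\<dots> \<le> 1 * sqrt (real n) + sqrt (pi / m0) * sqrt (real n)"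
  proof (rule add_mono)
    show "1 \<le> 1 * sqrt (real n)" using n by simp
    have "sqrt (pi / s) = sqrt (pi / m0) * sqrt (real n)" by (simp add: s_def flip: real_sqrt_mult)
    then show "sqrt (pi / s) / 2 \<le> sqrt (pi / m0) * sqrt (real n)" using m0 by simp
  qed
  finally show ?thesis by (simp only: distrib_right)
qed

text \<open>Fatou's lemma in the form used to pass from truncated mode sums to the full
  series.\<close>

lemma nn_integral_le_of_AE_tendsto:
  fixes F :: "nat \<Rightarrow> 'a \<Rightarrow> ennreal"
  assumes [measurable]: "\<And>N. F N \<in> borel_measurable M"
    and lim: "AE x in M. (\<lambda>N. F N x) \<longlonglongrightarrow> f x"
    and le: "\<And>N. (\<integral>\<^sup>+x. F N x \<partial>M) \<le> B"
  shows "(\<integral>\<^sup>+x. f x \<partial>M) \<le> B"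
proof -
  have "(\<integral>\<^sup>+x. f x \<partial>M) = (\<integral>\<^sup>+x. liminf (\<lambda>N. F N x) \<partial>M)"
    by (rule nn_integral_cong_AE, use lim in eventually_elim) (simp add: lim_imp_Liminf)
  also have "\<dots> \<le> liminf (\<lambda>N. \<integral>\<^sup>+x. F N x \<partial>M)" by (rule nn_integral_liminf) measurable
  also have "\<dots> \<le> limsup (\<lambda>N. \<integral>\<^sup>+x. F N x \<partial>M)" by (rule Liminf_le_Limsup) simp
  also have "\<dots> \<le> B" by (rule Limsup_bounded) (use le in auto)
  finally show ?thesis .
qed

text \<open>\<open>star\<close> controls only the modes from \<open>K0\<close> on, whereas the low
  coefficients are merely finite. So A is split into a low part \<open>l\<close> and a high part
  \<open>h\<close>; what involves the low coefficients alone goes to \<open>P\<close>, everything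
  with a moment bound goes to \<open>R\<close>.\<close>

lemma initial_error:
  fixes \<mu> ev :: "nat \<Rightarrow> real" and cof :: "nat \<Rightarrow> 'a \<Rightarrow> real" and Z A :: "nat \<Rightarrow> nat \<Rightarrow> 'a \<Rightarrow> real"
    and S \<rho>0 g m0 :: real and K0 N0 :: nat
  assumes "prob_space M"
    and cof [measurable]: "\<And>k. cof k \<in> borel_measurable M"
    and Z [measurable]: "\<And>n i. i < n \<Longrightarrow> Z n i \<in> borel_measurable M"
    and A [measurable]: "\<And>n i. i < n \<Longrightarrow> A n i \<in> borel_measurable M"
    and ev: "\<And>k. \<bar>ev k\<bar> \<le> 2"
    and m0: "0 < m0" and \<mu>: "\<And>k. K0 \<le> k \<Longrightarrow> m0 * (real (Suc k))\<^sup>2 \<le> \<mu> k"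
    and S: "0 \<le> S" and \<rho>0: "0 \<le> \<rho>0" and g0: "0 \<le> g" and N0: "1 \<le> N0"
    and star: "\<And>F v. finite F \<Longrightarrow> F \<subseteq> {K0..} \<Longrightarrow>
        (\<integral>\<^sup>+x. ennreal ((\<Sum>k\<in>F. v k * cof k x)\<^sup>2) \<partial>M) \<le> ennreal (S * (\<Sum>k\<in>F. (v k)\<^sup>2 / \<mu> k))"
    and cov: "\<And>n b. N0 \<le> n \<Longrightarrow> (\<integral>\<^sup>+x. ennreal ((\<Sum>i<n. b i * Z n i x)\<^sup>2) \<partial>M) \<le> ennreal (\<rho>0 / sqrt (real n) * (\<Sum>i<n. (b i)\<^sup>2))"
    and lim: "\<And>n. N0 \<le> n \<Longrightarrow> AE x in M. \<forall>i<n. (\<lambda>N. \<Sum>k<N. ev k * expinc (\<mu> k) n i * cof k x) \<longlonglongrightarrow> A n i x"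
    and g: "\<And>n N. N0 \<le> n \<Longrightarrow> (\<Sum>k\<in>{K0..<N}. (ev k)\<^sup>2 * expint (\<mu> k) (1 / real n)) \<le> g / sqrt (real n)"
  shows "\<exists>P R. (\<forall>n. P n \<in> borel_measurable M) \<and> (\<forall>n. R n \<in> borel_measurable M) \<and>
     (\<forall>n x. 0 \<le> P n x) \<and> (\<forall>x. (\<lambda>n. P n x) \<longlonglongrightarrow> 0) \<and>
     (\<forall>n x. 0 \<le> R n x) \<and> (\<lambda>n. \<integral>\<^sup>+x. ennreal (R n x) \<partial>M) \<longlonglongrightarrow> (0::ennreal) \<and>
     (\<forall>n\<ge>N0. \<forall>x. \<bar>(\<Sum>i<n. (Z n i x + A n i x)\<^sup>2) - (\<Sum>i<n. (Z n i x)\<^sup>2)\<bar> \<le> P n x + R n x)"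
proof -
  interpret prob_space M by fact
  define q where "q n i k = expinc (\<mu> k) n i" for n i k
  define l where "l n i x = (\<Sum>k<K0. ev k * q n i k * cof k x)" for n i x
  define h where "h n i x = A n i x - l n i x" for n i x
  \<comment> \<open>Exchanging the sums over increments and modes pairs each initial coefficient
    with a linear functional of Z, whose second moment \<open>cov\<close> controls.\<close>
  define \<beta> where "\<beta> n k x = (\<Sum>i<n. q n i k * Z n i x)" for n k x
  define \<beta>' where "\<beta>' n k x = (\<Sum>i\<in>{1..<n}. q n i k * Z n i x)" for n k x
  define mm where "mm k = \<bar>\<mu> k\<bar> * exp \<bar>\<mu> k\<bar>" for k
  define \<Lambda> where "\<Lambda> x = (\<Sum>k<K0. 2 * mm k * \<bar>cof k x\<bar>)" for x
  define T5 where "T5 n x = (\<Sum>i\<in>{1..<n}. h n i x * Z n i x)" for n x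
  define P where "P n x = 2 * (\<Lambda> x)\<^sup>2 / real n + 2 * (\<Sum>k<K0. (cof k x)\<^sup>2) / sqrt (real n)" for n x
  define Rr where "Rr n x = 2 * (\<Sum>i<n. (h n i x)\<^sup>2) + 2 * sqrt (real n) * (\<Sum>k<K0. (\<beta> n k x)\<^sup>2) + ((h n 0 x)\<^sup>2 + (Z n 0 x)\<^sup>2) + 2 * \<bar>T5 n x\<bar>" for n x
  define R where "R n x = (if N0 \<le> n then Rr n x else 0)" for n x
  have [measurable]: "l n i \<in> borel_measurable M" for n i unfolding l_def by measurable
  have hm [measurable]: "h n i \<in> borel_measurable M" if "i < n" for n i
    unfolding h_def using that by measurable
  have [measurable]: "\<beta> n k \<in> borel_measurable M" "\<beta>' n k \<in> borel_measurable M" for n k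
    unfolding \<beta>_def \<beta>'_def by measurable
  have [measurable]: "T5 n \<in> borel_measurable M" for n unfolding T5_def by measurable
  have [measurable]: "P n \<in> borel_measurable M" for n unfolding P_def \<Lambda>_def by measurable
  have n1: "1 \<le> n" "0 < n" if "N0 \<le> n" for n using that N0 by auto
  have Rm: "R n \<in> borel_measurable M" for n
  proof (cases "N0 \<le> n")
    case True
    have "Rr n \<in> borel_measurable M" unfolding Rr_def using n1[OF True] by measurable
    then show ?thesis using True by (simp add: R_def[abs_def])
  qed (simp add: R_def[abs_def])
  have Plim: "(\<lambda>n. P n x) \<longlonglongrightarrow> 0" for x
  proof -
    have "(\<lambda>n. c1 / real n + c2 / sqrt (real n)) \<longlonglongrightarrow> 0" for c1 c2 :: real by real_asymp
    then show ?thesis unfolding P_def .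
  qed
  have \<mu>p: "0 < \<mu> k" if "K0 \<le> k" for k
  proof -
    have "0 < m0 * (real (Suc k))\<^sup>2" using m0 by simp
    then show ?thesis using \<mu>[OF that] by linarith
  qed
  have bound: "\<bar>(\<Sum>i<n. (Z n i x + A n i x)\<^sup>2) - (\<Sum>i<n. (Z n i x)\<^sup>2)\<bar> \<le> P n x + Rr n x" if n: "N0 \<le> n" for n x
  proof -
    have n': "1 \<le> n" "real n > 0" using n1[OF n] by auto
    have A: "A n i x = l n i x + h n i x" for i by (simp add: h_def)
    have eq: "(\<Sum>i<n. (Z n i x + A n i x)\<^sup>2) - (\<Sum>i<n. (Z n i x)\<^sup>2) =
      (\<Sum>i<n. (A n i x)\<^sup>2) + 2 * (\<Sum>i<n. l n i x * Z n i x) + 2 * (\<Sum>i<n. h n i x * Z n i x)"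
      unfolding sum_subtractf[symmetric] sum_distrib_left sum.distrib[symmetric]
      by (intro sum.cong refl) (simp add: A power2_eq_square algebra_simps)
    have 1: "\<bar>\<Sum>i<n. (A n i x)\<^sup>2\<bar> \<le> 2 * (\<Lambda> x)\<^sup>2 / real n + 2 * (\<Sum>i<n. (h n i x)\<^sup>2)"
    proof -
      have lb: "(l n i x)\<^sup>2 \<le> (\<Lambda> x)\<^sup>2 / (real n)\<^sup>2" if "i < n" for i
      proof -
        have "\<bar>l n i x\<bar> \<le> (\<Sum>k<K0. \<bar>ev k * q n i k * cof k x\<bar>)" unfolding l_def by (rule sum_abs)
        also have "\<dots> \<le> (\<Sum>k<K0. 2 * (mm k / real n) * \<bar>cof k x\<bar>)"
          unfolding abs_mult using expinc_abs_le[OF n'(1) that] ev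
          by (intro sum_mono mult_right_mono mult_mono) (auto simp: q_def mm_def)
        also have "\<dots> = \<Lambda> x / real n" by (simp add: \<Lambda>_def sum_divide_distrib)
        finally have "\<bar>l n i x\<bar>\<^sup>2 \<le> (\<Lambda> x / real n)\<^sup>2" by (rule power_mono) simp
        then show ?thesis by (simp add: power_divide)
      qed
      have "(A n i x)\<^sup>2 \<le> 2 * (l n i x)\<^sup>2 + 2 * (h n i x)\<^sup>2" for i
        using zero_le_power2[of "l n i x - h n i x"] unfolding A by (simp add: power2_diff power2_sum)
      then have "(\<Sum>i<n. (A n i x)\<^sup>2) \<le> (\<Sum>i<n. 2 * (l n i x)\<^sup>2 + 2 * (h n i x)\<^sup>2)" by (rule sum_mono)
      also have "\<dots> \<le> (\<Sum>i<n. 2 * ((\<Lambda> x)\<^sup>2 / (real n)\<^sup>2) + 2 * (h n i x)\<^sup>2)"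
        using lb by (intro sum_mono add_right_mono mult_left_mono) auto
      also have "\<dots> = 2 * (\<Lambda> x)\<^sup>2 / real n + 2 * (\<Sum>i<n. (h n i x)\<^sup>2)"
        using n' by (simp add: sum.distrib sum_distrib_left power2_eq_square[of "real n"])
      finally show ?thesis by (simp add: sum_nonneg)
    qed
    \<comment> \<open>Young's inequality with weight 1 / sqrt n: the squared coefficients then
      vanish pointwise, and the squares of \<open>\<beta> n k\<close>, of order n^(-3/2) in mean,
      can afford the factor sqrt n.\<close>
    have 2: "\<bar>2 * (\<Sum>i<n. l n i x * Z n i x)\<bar> \<le> 2 * (\<Sum>k<K0. (cof k x)\<^sup>2) / sqrt (real n) + 2 * sqrt (real n) * (\<Sum>k<K0. (\<beta> n k x)\<^sup>2)"
    proof -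
      have "(\<Sum>i<n. l n i x * Z n i x) = (\<Sum>i<n. \<Sum>k<K0. ev k * cof k x * (q n i k * Z n i x))"
        unfolding l_def sum_distrib_right by (simp only: mult_ac)
      also have "\<dots> = (\<Sum>k<K0. ev k * cof k x * \<beta> n k x)"
        by (subst sum.swap) (simp only: \<beta>_def sum_distrib_left)
      finally have "\<bar>2 * (\<Sum>i<n. l n i x * Z n i x)\<bar> = 2 * \<bar>\<Sum>k<K0. ev k * cof k x * \<beta> n k x\<bar>" by simp
      also have "\<dots> \<le> 2 * (\<Sum>k<K0. (1 / sqrt (real n)) * (cof k x)\<^sup>2 + sqrt (real n) * (\<beta> n k x)\<^sup>2)"
      proof (intro mult_left_mono order_trans[OF sum_abs] sum_mono)
        fix k
        have "\<bar>ev k * cof k x * \<beta> n k x\<bar> \<le> 2 * \<bar>cof k x\<bar> * \<bar>\<beta> n k x\<bar>"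
          unfolding abs_mult using ev[of k] by (intro mult_right_mono) auto
        also have "\<dots> \<le> 1 / sqrt (real n) * (cof k x)\<^sup>2 + (\<beta> n k x)\<^sup>2 / (1 / sqrt (real n))"
          by (rule two_mult_le_weighted) (use n' in simp)
        finally show "\<bar>ev k * cof k x * \<beta> n k x\<bar> \<le> 1 / sqrt (real n) * (cof k x)\<^sup>2 + sqrt (real n) * (\<beta> n k x)\<^sup>2"
          by (simp add: mult.commute)
      qed simp
      also have "\<dots> = 2 * (\<Sum>k<K0. (cof k x)\<^sup>2) / sqrt (real n) + 2 * sqrt (real n) * (\<Sum>k<K0. (\<beta> n k x)\<^sup>2)"
        by (simp only: sum.distrib sum_distrib_left[symmetric]) (simp add: algebra_simps)
      finally show ?thesis .
    qed
    \<comment> \<open>For i = 0 the factor \<open>q n 0 k\<close> approaches -1 as k grows, and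
      mode-by-mode bounds would not be summable. The squares of \<open>h n 0\<close> and
      \<open>Z n 0\<close> are each O(n^(-1/2)) in mean, so the product is small directly.\<close>
    have 3: "\<bar>2 * (\<Sum>i<n. h n i x * Z n i x)\<bar> \<le> ((h n 0 x)\<^sup>2 + (Z n 0 x)\<^sup>2) + 2 * \<bar>T5 n x\<bar>"
    proof -
      have "(\<Sum>i<n. h n i x * Z n i x) = h n 0 x * Z n 0 x + T5 n x"
        using sum.atLeast_Suc_lessThan[of 0 n "\<lambda>i. h n i x * Z n i x"] n'
        by (simp add: T5_def lessThan_atLeast0)
      moreover have "2 * \<bar>h n 0 x\<bar> * \<bar>Z n 0 x\<bar> \<le> (h n 0 x)\<^sup>2 + (Z n 0 x)\<^sup>2"
        using two_mult_le_weighted[of 1 "h n 0 x" "Z n 0 x"] by simp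
      moreover have "\<bar>2 * (u * v + t)\<bar> \<le> s + 2 * \<bar>t\<bar>" if "2 * \<bar>u\<bar> * \<bar>v\<bar> \<le> s" for u v t s :: real
        using that abs_triangle_ineq[of "u * v" t] by (simp add: abs_mult)
      ultimately show ?thesis by simp
    qed
    have "\<bar>a + b + c\<bar> \<le> (p1 + p2) + (r1 + r2 + r3 + r4)" if "\<bar>a\<bar> \<le> p1 + r1" "\<bar>b\<bar> \<le> p2 + r2" "\<bar>c\<bar> \<le> r3 + r4"
      for a b c p1 p2 r1 r2 r3 r4 :: real using that by linarith
    from this[OF 1 2 3] show ?thesis unfolding eq P_def Rr_def .
  qed
  have H_lim: "AE x in M. \<forall>i<n. (\<lambda>N. \<Sum>k\<in>{K0..<N}. ev k * q n i k * cof k x) \<longlonglongrightarrow> h n i x" if n: "N0 \<le> n" for n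
    using lim[OF n]
  proof eventually_elim
    case (elim x)
    show ?case
    proof (intro allI impI)
      fix i assume "i < n"
      then have "(\<lambda>N. (\<Sum>k<N. ev k * q n i k * cof k x) - l n i x) \<longlonglongrightarrow> A n i x - l n i x"
        using elim unfolding q_def by (intro tendsto_diff tendsto_const) auto
      moreover have "eventually (\<lambda>N. (\<Sum>k<N. ev k * q n i k * cof k x) - l n i x = (\<Sum>k\<in>{K0..<N}. ev k * q n i k * cof k x)) sequentially"
        using eventually_ge_at_top[of K0]
      proof eventually_elim
        case (elim N)
        then show ?case
          using sum.atLeastLessThan_concat[of 0 K0 N "\<lambda>k. ev k * q n i k * cof k x"]
          by (simp add: l_def lessThan_atLeast0)
      qed
      ultimately show "(\<lambda>N. \<Sum>k\<in>{K0..<N}. ev k * q n i k * cof k x) \<longlonglongrightarrow> h n i x"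
        unfolding h_def by (rule Lim_transform_eventually)
    qed
  qed
  have E2: "(\<integral>\<^sup>+x. ennreal (\<Sum>i<n. (h n i x)\<^sup>2) \<partial>M) \<le> ennreal (S * (g / sqrt (real n)))" if n: "N0 \<le> n" for n
  proof (rule nn_integral_le_of_AE_tendsto[where F = "\<lambda>N x. ennreal (\<Sum>i<n. (\<Sum>k\<in>{K0..<N}. ev k * q n i k * cof k x)\<^sup>2)"])
    show "AE x in M. (\<lambda>N. ennreal (\<Sum>i<n. (\<Sum>k\<in>{K0..<N}. ev k * q n i k * cof k x)\<^sup>2)) \<longlonglongrightarrow> ennreal (\<Sum>i<n. (h n i x)\<^sup>2)"
      using H_lim[OF n] by eventually_elim (intro tendsto_ennrealI tendsto_sum tendsto_power, simp)
    fix N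
    have "(\<integral>\<^sup>+x. ennreal (\<Sum>i<n. (\<Sum>k\<in>{K0..<N}. ev k * q n i k * cof k x)\<^sup>2) \<partial>M) =
      (\<Sum>i<n. \<integral>\<^sup>+x. ennreal ((\<Sum>k\<in>{K0..<N}. ev k * q n i k * cof k x)\<^sup>2) \<partial>M)"
      by (subst nn_integral_sum[symmetric]) (auto intro!: nn_integral_cong simp: sum_ennreal)
    also have "\<dots> \<le> (\<Sum>i<n. ennreal (S * (\<Sum>k\<in>{K0..<N}. (ev k * q n i k)\<^sup>2 / \<mu> k)))"
      by (intro sum_mono star) auto
    also have "\<dots> = ennreal (\<Sum>i<n. S * (\<Sum>k\<in>{K0..<N}. (ev k * q n i k)\<^sup>2 / \<mu> k))"
      by (rule sum_ennreal) (auto intro!: mult_nonneg_nonneg S sum_nonneg divide_nonneg_pos \<mu>p)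
    also have "\<dots> \<le> ennreal (S * (g / sqrt (real n)))"
    proof (rule ennreal_leI)
      have "(\<Sum>i<n. S * (\<Sum>k\<in>{K0..<N}. (ev k * q n i k)\<^sup>2 / \<mu> k)) = S * (\<Sum>k\<in>{K0..<N}. (ev k)\<^sup>2 / \<mu> k * (\<Sum>i<n. (q n i k)\<^sup>2))"
        unfolding sum_distrib_left[symmetric] by (subst sum.swap) (simp add: power_mult_distrib sum_distrib_left)
      also have "\<dots> \<le> S * (\<Sum>k\<in>{K0..<N}. (ev k)\<^sup>2 * expint (\<mu> k) (1 / real n))"
      proof (intro mult_left_mono[OF _ S] sum_mono)
        fix k assume "k \<in> {K0..<N}"
        then have p: "0 < \<mu> k" using \<mu>p by auto
        have "(ev k)\<^sup>2 / \<mu> k * (\<Sum>i<n. (q n i k)\<^sup>2) \<le> (ev k)\<^sup>2 / \<mu> k * (1 - exp (- \<mu> k * (1 / real n)))"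
          using sum_expinc_square_le(1)[OF p, of n] p unfolding q_def by (intro mult_left_mono) auto
        then show "(ev k)\<^sup>2 / \<mu> k * (\<Sum>i<n. (q n i k)\<^sup>2) \<le> (ev k)\<^sup>2 * expint (\<mu> k) (1 / real n)"
          using p by (simp add: expint_def)
      qed
      also have "\<dots> \<le> S * (g / sqrt (real n))" by (intro mult_left_mono g n S)
      finally show "(\<Sum>i<n. S * (\<Sum>k\<in>{K0..<N}. (ev k * q n i k)\<^sup>2 / \<mu> k)) \<le> S * (g / sqrt (real n))" .
    qed
    finally show "(\<integral>\<^sup>+x. ennreal (\<Sum>i<n. (\<Sum>k\<in>{K0..<N}. ev k * q n i k * cof k x)\<^sup>2) \<partial>M) \<le> ennreal (S * (g / sqrt (real n)))" .
  qed measurable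
  have E2': "(\<integral>\<^sup>+x. ennreal ((h n 0 x)\<^sup>2) \<partial>M) \<le> ennreal (S * (g / sqrt (real n)))" if n: "N0 \<le> n" for n
  proof (rule order_trans[OF nn_integral_mono E2[OF n]])
    fix x
    show "ennreal ((h n 0 x)\<^sup>2) \<le> ennreal (\<Sum>i<n. (h n i x)\<^sup>2)"
      using n1[OF n] by (intro ennreal_leI member_le_sum[of 0 "{..<n}" "\<lambda>i. (h n i x)\<^sup>2"]) auto
  qed
  have E3: "(\<integral>\<^sup>+x. ennreal ((\<beta> n k x)\<^sup>2) \<partial>M) \<le> ennreal (\<rho>0 * (mm k)\<^sup>2 / (real n * sqrt (real n)))" if n: "N0 \<le> n" for n k
  proof -
    have "(\<Sum>i<n. (q n i k)\<^sup>2) \<le> (\<Sum>i<n. (mm k / real n)\<^sup>2)"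
    proof (rule sum_mono)
      fix i assume "i \<in> {..<n}"
      then have "\<bar>q n i k\<bar>\<^sup>2 \<le> (mm k / real n)\<^sup>2"
        using expinc_abs_le[OF n1(1)[OF n], of i "\<mu> k"] by (intro power_mono) (auto simp: q_def mm_def)
      then show "(q n i k)\<^sup>2 \<le> (mm k / real n)\<^sup>2" by simp
    qed
    also have "\<dots> = (mm k)\<^sup>2 / real n" using n1[OF n] by (simp add: power_divide power2_eq_square[of "real n"])
    finally have "\<rho>0 / sqrt (real n) * (\<Sum>i<n. (q n i k)\<^sup>2) \<le> \<rho>0 / sqrt (real n) * ((mm k)\<^sup>2 / real n)"
      using \<rho>0 by (intro mult_left_mono) auto
    also have "\<dots> = \<rho>0 * (mm k)\<^sup>2 / (real n * sqrt (real n))" by simp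
    finally show ?thesis unfolding \<beta>_def by (intro order_trans[OF cov[OF n] ennreal_leI])
  qed
  have E4: "(\<integral>\<^sup>+x. ennreal ((Z n 0 x)\<^sup>2) \<partial>M) \<le> ennreal (\<rho>0 / sqrt (real n))" if n: "N0 \<le> n" for n
  proof -
    have d: "(\<Sum>i<n. (if i = 0 then 1 else 0) * f i) = f 0" for f :: "nat \<Rightarrow> real"
      using n1[OF n] by (subst sum.remove[of _ 0]) (auto intro!: sum.neutral)
    have d2: "(\<Sum>i<n. (if i = 0 then 1 else (0::real))\<^sup>2) = 1"
      using d[of "\<lambda>i. if i = 0 then 1 else 0"] by (simp add: power2_eq_square)
    show ?thesis using cov[OF n, of "\<lambda>i. if i = 0 then 1 else 0"] unfolding d d2 by simp
  qed
  define B where "B = (S + \<rho>0) * (1 + sqrt (pi / m0))"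
  have E5: "(\<integral>\<^sup>+x. ennreal \<bar>T5 n x\<bar> \<partial>M) \<le> ennreal (B / sqrt (sqrt (real n)))" if n: "N0 \<le> n" for n
  proof (rule nn_integral_le_of_AE_tendsto[where F = "\<lambda>N x. ennreal \<bar>\<Sum>k\<in>{K0..<N}. ev k * cof k x * \<beta>' n k x\<bar>"])
    show "AE x in M. (\<lambda>N. ennreal \<bar>\<Sum>k\<in>{K0..<N}. ev k * cof k x * \<beta>' n k x\<bar>) \<longlonglongrightarrow> ennreal \<bar>T5 n x\<bar>"
      using H_lim[OF n]
    proof eventually_elim
      case (elim x)
      have "(\<lambda>N. \<Sum>i\<in>{1..<n}. (\<Sum>k\<in>{K0..<N}. ev k * q n i k * cof k x) * Z n i x) \<longlonglongrightarrow> T5 n x"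
        unfolding T5_def using elim by (intro tendsto_sum tendsto_mult tendsto_const) auto
      moreover have "(\<Sum>i\<in>{1..<n}. (\<Sum>k\<in>{K0..<N}. ev k * q n i k * cof k x) * Z n i x) = (\<Sum>k\<in>{K0..<N}. ev k * cof k x * \<beta>' n k x)" for N
        unfolding sum_distrib_right \<beta>'_def sum_distrib_left by (subst sum.swap) (simp only: mult_ac)
      ultimately show ?case by (intro tendsto_ennrealI tendsto_rabs) simp
    qed
    fix N
    define u where "u = sqrt (sqrt (real n))"
    have u: "0 < u" "sqrt (real n) = u * u" "real n = u * u * (u * u)"
      using n1[OF n] by (simp_all add: u_def)
    \<comment> \<open>u is n^(1/4), and r = n^(-3/4) is the size of the contribution of one mode
      before its factor \<open>X k\<close>.\<close>
    define r where "r = 1 / (u * u * u)"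
    have r: "0 < r" using u by (simp add: r_def)
    define X where "X k = exp (- \<mu> k * (1 / real n))" for k
    have X: "0 < X k" for k by (simp add: X_def)
    have mode_bound: "(\<integral>\<^sup>+x. ennreal \<bar>ev k * cof k x * \<beta>' n k x\<bar> \<partial>M) \<le> ennreal ((S + \<rho>0) * r * X k)" if k: "K0 \<le> k" for k
    proof -
      \<comment> \<open>The weight that balances the two second moments, S / \<mu>_k for the
        coefficient and \<rho>0 X_k^2 \<mu>_k n^(-3/2) for \<open>\<beta>'\<close>: either term of
        Young's inequality becomes a multiple of r X_k.\<close>
      define \<epsilon> where "\<epsilon> = \<mu> k * X k * r"
      have p: "0 < \<mu> k" by (rule \<mu>p[OF k])
      have \<epsilon>: "0 < \<epsilon>" using p X[of k] r by (simp add: \<epsilon>_def)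
      have c2: "(\<integral>\<^sup>+x. ennreal ((cof k x)\<^sup>2) \<partial>M) \<le> ennreal (S / \<mu> k)"
        using star[of "{k}" "\<lambda>_. 1"] k by simp
      have b2: "(\<integral>\<^sup>+x. ennreal ((\<beta>' n k x)\<^sup>2) \<partial>M) \<le> ennreal (\<rho>0 / (u * u) * ((X k)\<^sup>2 * (\<mu> k / real n)))"
      proof -
        have e: "(\<Sum>i<n. (if i = 0 then 0 else q n i k) * f i) = (\<Sum>i\<in>{1..<n}. q n i k * f i)" for f :: "nat \<Rightarrow> real"
          by (rule sum.mono_neutral_cong_right) auto
        have e2: "(\<Sum>i<n. (if i = 0 then 0 else q n i k)\<^sup>2) = (\<Sum>i\<in>{1..<n}. (q n i k)\<^sup>2)"
          by (rule sum.mono_neutral_cong_right) auto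
        have "(\<Sum>i\<in>{1..<n}. (q n i k)\<^sup>2) \<le> (X k)\<^sup>2 * (1 - X k)"
          unfolding q_def X_def by (rule sum_expinc_square_le(2)[OF p])
        also have "\<dots> \<le> (X k)\<^sup>2 * (\<mu> k / real n)"
        proof (rule mult_left_mono)
          have "1 - exp z \<le> - z" for z :: real using exp_ge_add_one_self[of z] by linarith
          from this[of "- \<mu> k * (1 / real n)"] show "1 - X k \<le> \<mu> k / real n" by (simp add: X_def)
        qed simp
        finally have le: "\<rho>0 / sqrt (real n) * (\<Sum>i\<in>{1..<n}. (q n i k)\<^sup>2) \<le> \<rho>0 / (u * u) * ((X k)\<^sup>2 * (\<mu> k / real n))"
          unfolding u(2) using \<rho>0 u(1) by (intro mult_left_mono) auto
        show ?thesis
          unfolding \<beta>'_def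
          by (rule order_trans[OF cov[OF n, of "\<lambda>i. if i = 0 then 0 else q n i k", unfolded e e2] ennreal_leI[OF le]])
      qed
      have "(\<integral>\<^sup>+x. ennreal \<bar>ev k * cof k x * \<beta>' n k x\<bar> \<partial>M) \<le> (\<integral>\<^sup>+x. ennreal \<epsilon> * ennreal ((cof k x)\<^sup>2) + ennreal (1 / \<epsilon>) * ennreal ((\<beta>' n k x)\<^sup>2) \<partial>M)"
      proof (rule nn_integral_mono)
        fix x
        have "\<bar>ev k * cof k x * \<beta>' n k x\<bar> \<le> 2 * \<bar>cof k x\<bar> * \<bar>\<beta>' n k x\<bar>"
          unfolding abs_mult using ev[of k] by (intro mult_right_mono) auto
        also have "\<dots> \<le> \<epsilon> * (cof k x)\<^sup>2 + (\<beta>' n k x)\<^sup>2 / \<epsilon>" by (rule two_mult_le_weighted[OF \<epsilon>])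
        finally have "ennreal \<bar>ev k * cof k x * \<beta>' n k x\<bar> \<le> ennreal (\<epsilon> * (cof k x)\<^sup>2 + 1 / \<epsilon> * (\<beta>' n k x)\<^sup>2)"
          by (intro ennreal_leI) simp
        also have "\<dots> = ennreal \<epsilon> * ennreal ((cof k x)\<^sup>2) + ennreal (1 / \<epsilon>) * ennreal ((\<beta>' n k x)\<^sup>2)"
          using \<epsilon> by (simp add: ennreal_plus ennreal_mult[symmetric])
        finally show "ennreal \<bar>ev k * cof k x * \<beta>' n k x\<bar> \<le> ennreal \<epsilon> * ennreal ((cof k x)\<^sup>2) + ennreal (1 / \<epsilon>) * ennreal ((\<beta>' n k x)\<^sup>2)" .
      qed
      also have "\<dots> = ennreal \<epsilon> * (\<integral>\<^sup>+x. ennreal ((cof k x)\<^sup>2) \<partial>M) + ennreal (1 / \<epsilon>) * (\<integral>\<^sup>+x. ennreal ((\<beta>' n k x)\<^sup>2) \<partial>M)"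
        by (simp add: nn_integral_add nn_integral_cmult)
      also have "\<dots> \<le> ennreal \<epsilon> * ennreal (S / \<mu> k) + ennreal (1 / \<epsilon>) * ennreal (\<rho>0 / (u * u) * ((X k)\<^sup>2 * (\<mu> k / real n)))"
        by (intro add_mono mult_left_mono c2 b2) auto
      also have "\<dots> = ennreal (\<epsilon> * (S / \<mu> k) + 1 / \<epsilon> * (\<rho>0 / (u * u) * ((X k)\<^sup>2 * (\<mu> k / real n))))"
        using \<epsilon> S \<rho>0 p u by (simp add: ennreal_plus ennreal_mult[symmetric])
      also have "\<epsilon> * (S / \<mu> k) + 1 / \<epsilon> * (\<rho>0 / (u * u) * ((X k)\<^sup>2 * (\<mu> k / real n))) = (S + \<rho>0) * r * X k"
        unfolding \<epsilon>_def r_def u(3) using p X[of k] u(1) by (simp add: field_simps power2_eq_square)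
      finally show ?thesis .
    qed
    have "(\<integral>\<^sup>+x. ennreal \<bar>\<Sum>k\<in>{K0..<N}. ev k * cof k x * \<beta>' n k x\<bar> \<partial>M) \<le> (\<integral>\<^sup>+x. (\<Sum>k\<in>{K0..<N}. ennreal \<bar>ev k * cof k x * \<beta>' n k x\<bar>) \<partial>M)"
      by (intro nn_integral_mono) (simp add: sum_ennreal ennreal_leI)
    also have "\<dots> = (\<Sum>k\<in>{K0..<N}. \<integral>\<^sup>+x. ennreal \<bar>ev k * cof k x * \<beta>' n k x\<bar> \<partial>M)"
      by (rule nn_integral_sum) measurable
    also have "\<dots> \<le> (\<Sum>k\<in>{K0..<N}. ennreal ((S + \<rho>0) * r * X k))"
      by (intro sum_mono mode_bound) auto
    also have "\<dots> = ennreal (\<Sum>k\<in>{K0..<N}. (S + \<rho>0) * r * X k)"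
      using S \<rho>0 r X by (intro sum_ennreal) (auto intro!: mult_nonneg_nonneg simp: less_imp_le)
    also have "\<dots> \<le> ennreal (B / sqrt (sqrt (real n)))"
    proof (rule ennreal_leI)
      \<comment> \<open>The factors \<open>X k\<close> sum to order sqrt n = u^2; multiplied by r =
        u^(-3) this leaves 1 / u.\<close>
      have "(\<Sum>k\<in>{K0..<N}. (S + \<rho>0) * r * X k) = (S + \<rho>0) * r * (\<Sum>k\<in>{K0..<N}. X k)" by (simp only: sum_distrib_left)
      also have "\<dots> \<le> (S + \<rho>0) * r * ((1 + sqrt (pi / m0)) * sqrt (real n))"
        unfolding X_def using S \<rho>0 r by (intro mult_left_mono sum_exp_modes_le[OF m0 \<mu> n1(1)[OF n]]) auto
      also have "\<dots> = B / u" unfolding B_def r_def u(2) using u(1) by (simp add: field_simps)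
      finally show "(\<Sum>k\<in>{K0..<N}. (S + \<rho>0) * r * X k) \<le> B / sqrt (sqrt (real n))" by (simp only: u_def)
    qed
    finally show "(\<integral>\<^sup>+x. ennreal \<bar>\<Sum>k\<in>{K0..<N}. ev k * cof k x * \<beta>' n k x\<bar> \<partial>M) \<le> ennreal (B / sqrt (sqrt (real n)))" .
  qed measurable
  have B0: "0 \<le> B" using S \<rho>0 m0 by (simp add: B_def)
  define W where "W n = 2 * (S * (g / sqrt (real n))) + 2 * sqrt (real n) * (\<Sum>k<K0. \<rho>0 * (mm k)\<^sup>2 / (real n * sqrt (real n))) +
     (S * (g / sqrt (real n)) + \<rho>0 / sqrt (real n)) + 2 * (B / sqrt (sqrt (real n)))" for n
  have Wle: "(\<integral>\<^sup>+x. ennreal (R n x) \<partial>M) \<le> ennreal (W n)" if n: "N0 \<le> n" for n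
  proof -
    have "(\<integral>\<^sup>+x. ennreal (R n x) \<partial>M) = (\<integral>\<^sup>+x. 2 * ennreal (\<Sum>i<n. (h n i x)\<^sup>2) + ennreal (2 * sqrt (real n)) * (\<Sum>k<K0. ennreal ((\<beta> n k x)\<^sup>2)) +
        (ennreal ((h n 0 x)\<^sup>2) + ennreal ((Z n 0 x)\<^sup>2)) + 2 * ennreal \<bar>T5 n x\<bar> \<partial>M)"
      using n by (intro nn_integral_cong)
        (simp add: R_def Rr_def ennreal_plus ennreal_mult sum_nonneg sum_ennreal add_nonneg_nonneg)
    also have "\<dots> = 2 * (\<integral>\<^sup>+x. ennreal (\<Sum>i<n. (h n i x)\<^sup>2) \<partial>M) + ennreal (2 * sqrt (real n)) * (\<Sum>k<K0. \<integral>\<^sup>+x. ennreal ((\<beta> n k x)\<^sup>2) \<partial>M) +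
        ((\<integral>\<^sup>+x. ennreal ((h n 0 x)\<^sup>2) \<partial>M) + (\<integral>\<^sup>+x. ennreal ((Z n 0 x)\<^sup>2) \<partial>M)) + 2 * (\<integral>\<^sup>+x. ennreal \<bar>T5 n x\<bar> \<partial>M)"
      using n1[OF n] by (simp add: nn_integral_add nn_integral_cmult nn_integral_sum del: sum_ennreal)
    also have "\<dots> \<le> 2 * ennreal (S * (g / sqrt (real n))) + ennreal (2 * sqrt (real n)) * (\<Sum>k<K0. ennreal (\<rho>0 * (mm k)\<^sup>2 / (real n * sqrt (real n)))) +
        (ennreal (S * (g / sqrt (real n))) + ennreal (\<rho>0 / sqrt (real n))) + 2 * ennreal (B / sqrt (sqrt (real n)))"
      by (intro add_mono mult_left_mono sum_mono E2 E2' E3 E4 E5 n) auto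
    also have "\<dots> = ennreal (W n)"
    proof -
      have e: "2 * ennreal a + ennreal s * ennreal q + (ennreal a' + ennreal b) + 2 * ennreal c = ennreal (2 * a + s * q + (a' + b) + 2 * c)"
        if "0 \<le> a" "0 \<le> s" "0 \<le> q" "0 \<le> a'" "0 \<le> b" "0 \<le> c" for a s q a' b c :: real
        using that by (simp add: ennreal_plus ennreal_mult)
      have q: "(\<Sum>k<K0. ennreal (\<rho>0 * (mm k)\<^sup>2 / (real n * sqrt (real n)))) = ennreal (\<Sum>k<K0. \<rho>0 * (mm k)\<^sup>2 / (real n * sqrt (real n)))"
        using \<rho>0 by (intro sum_ennreal) simp
      show ?thesis unfolding q W_def
        using S \<rho>0 g0 B0 by (intro e) (auto intro!: sum_nonneg)
    qed
    finally show ?thesis .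
  qed
  have "W \<longlonglongrightarrow> 0"
  proof -
    have "(\<lambda>n. 2 * (S * (g / sqrt (real n))) + 2 * sqrt (real n) * (Q / (real n * sqrt (real n))) +
     (S * (g / sqrt (real n)) + \<rho>0 / sqrt (real n)) + 2 * (B / sqrt (sqrt (real n)))) \<longlonglongrightarrow> 0"
      for Q by real_asymp
    then show ?thesis unfolding W_def sum_divide_distrib[symmetric] .
  qed
  then have W0: "(\<lambda>n. ennreal (W n)) \<longlonglongrightarrow> 0" using tendsto_ennrealI by fastforce
  have Rlim: "(\<lambda>n. \<integral>\<^sup>+x. ennreal (R n x) \<partial>M) \<longlonglongrightarrow> 0"
  proof (rule tendsto_sandwich[OF _ _ tendsto_const W0])
    show "eventually (\<lambda>n. (\<integral>\<^sup>+x. ennreal (R n x) \<partial>M) \<le> ennreal (W n)) sequentially"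
      using eventually_ge_at_top[of N0] by eventually_elim (rule Wle)
  qed simp
  have P0: "0 \<le> P n x" for n x unfolding P_def by (auto intro!: add_nonneg_nonneg divide_nonneg_nonneg mult_nonneg_nonneg sum_nonneg)
  have R0: "0 \<le> R n x" for n x
    unfolding R_def Rr_def by (auto intro!: add_nonneg_nonneg mult_nonneg_nonneg sum_nonneg)
  show ?thesis
    by (intro exI[of _ P] exI[of _ R]) (use Rm Plim P0 R0 Rlim bound in \<open>auto simp: R_def\<close>)
qed

text \<open>Brings both alternatives of the initial condition into one form. In the centred case
  independence makes the coefficients orthogonal, so only the diagonal remains. In the energy case
  Cauchy-Schwarz with weights sqrt \<mu>_k bounds the square path by path by the sum of v_k^2 /
  \<mu>_k times the energy.\<close>

lemma initial_condition_second_moments: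
  assumes M: "prob_space M" and init: "initial_condition M \<theta>0 \<theta>1 \<theta>2 \<xi>"
    and pos: "\<And>k. K0 \<le> k \<Longrightarrow> 0 < eigval \<theta>0 \<theta>1 \<theta>2 (Suc k)"
  defines "\<mu> \<equiv> \<lambda>k. eigval \<theta>0 \<theta>1 \<theta>2 (Suc k)"
    and "cof \<equiv> \<lambda>k \<omega>. H_coeff \<theta>1 \<theta>2 (\<xi> \<omega>) (Suc k)"
  shows "\<exists>S\<ge>0. \<forall>F v. finite F \<longrightarrow> F \<subseteq> {K0..} \<longrightarrow>
    (\<integral>\<^sup>+x. ennreal ((\<Sum>k\<in>F. v k * cof k x)\<^sup>2) \<partial>M) \<le> ennreal (S * (\<Sum>k\<in>F. (v k)\<^sup>2 / \<mu> k))"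
proof -
  interpret prob_space M by fact
  have ind: "indep_vars (\<lambda>_. borel) (\<lambda>k \<omega>. H_coeff \<theta>1 \<theta>2 (\<xi> \<omega>) k) {1..}"
    using init unfolding initial_condition_def by blast
  have cofm [measurable]: "cof k \<in> borel_measurable M" for k
    using ind unfolding indep_vars_def cof_def by auto
  have \<mu>p: "0 < \<mu> k" if "k \<in> F" "F \<subseteq> {K0..}" for k F
    using that pos unfolding \<mu>_def by auto
  consider (centred) "\<And>k. integrable M (cof k)" "\<And>k. (\<integral>\<omega>. cof k \<omega> \<partial>M) = 0"
      "(SUP k\<in>{1..}. ennreal (eigval \<theta>0 \<theta>1 \<theta>2 k) * (\<integral>\<^sup>+\<omega>. ennreal ((H_coeff \<theta>1 \<theta>2 (\<xi> \<omega>) k)\<^sup>2) \<partial>M)) < \<infinity>"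
    | (energy) "(\<integral>\<^sup>+\<omega>. (\<Sum>j. ennreal (\<mu> j * (cof j \<omega>)\<^sup>2)) \<partial>M) < \<infinity>"
    using init unfolding initial_condition_def cof_def \<mu>_def by auto
  then show ?thesis
  proof cases
    case energy
    define Q where "Q = (\<integral>\<^sup>+\<omega>. (\<Sum>j. ennreal (\<mu> j * (cof j \<omega>)\<^sup>2)) \<partial>M)"
    have Q: "Q = ennreal (enn2real Q)" using energy by (simp add: Q_def)
    show ?thesis
    proof (intro exI[of _ "enn2real Q"] conjI allI impI)
      fix F v assume F: "finite F" "F \<subseteq> {K0..}"
      have V: "0 \<le> (\<Sum>k\<in>F. (v k)\<^sup>2 / \<mu> k)" using \<mu>p F by (intro sum_nonneg) (auto intro: divide_nonneg_pos)
      have "(\<integral>\<^sup>+x. ennreal ((\<Sum>k\<in>F. v k * cof k x)\<^sup>2) \<partial>M) \<le>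
        (\<integral>\<^sup>+x. ennreal (\<Sum>k\<in>F. (v k)\<^sup>2 / \<mu> k) * (\<Sum>j. ennreal (\<mu> j * (cof j x)\<^sup>2)) \<partial>M)"
      proof (rule nn_integral_mono)
        fix x
        have "(\<Sum>k\<in>F. v k * cof k x) = (\<Sum>k\<in>F. (v k / sqrt (\<mu> k)) * (sqrt (\<mu> k) * cof k x))"
          using \<mu>p[OF _ F(2)] by (intro sum.cong) (auto simp: less_imp_neq[symmetric])
        then have "(\<Sum>k\<in>F. v k * cof k x)\<^sup>2 \<le> (\<Sum>k\<in>F. (v k / sqrt (\<mu> k))\<^sup>2) * (\<Sum>k\<in>F. (sqrt (\<mu> k) * cof k x)\<^sup>2)"
          by (simp only: Cauchy_Schwarz_ineq_sum)
        also have "(\<Sum>k\<in>F. (v k / sqrt (\<mu> k))\<^sup>2) = (\<Sum>k\<in>F. (v k)\<^sup>2 / \<mu> k)"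
          using \<mu>p[OF _ F(2)] by (intro sum.cong) (auto simp: power_divide less_imp_le)
        also have "(\<Sum>k\<in>F. (sqrt (\<mu> k) * cof k x)\<^sup>2) = (\<Sum>k\<in>F. \<mu> k * (cof k x)\<^sup>2)"
          using \<mu>p[OF _ F(2)] by (intro sum.cong) (auto simp: power_mult_distrib less_imp_le)
        finally have "ennreal ((\<Sum>k\<in>F. v k * cof k x)\<^sup>2) \<le> ennreal ((\<Sum>k\<in>F. (v k)\<^sup>2 / \<mu> k) * (\<Sum>k\<in>F. \<mu> k * (cof k x)\<^sup>2))"
          by (rule ennreal_leI)
        also have "\<dots> = ennreal (\<Sum>k\<in>F. (v k)\<^sup>2 / \<mu> k) * ennreal (\<Sum>k\<in>F. \<mu> k * (cof k x)\<^sup>2)"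
          using V \<mu>p[OF _ F(2)] by (intro ennreal_mult sum_nonneg) (auto simp: less_imp_le)
        also have "ennreal (\<Sum>k\<in>F. \<mu> k * (cof k x)\<^sup>2) = (\<Sum>k\<in>F. ennreal (\<mu> k * (cof k x)\<^sup>2))"
          using \<mu>p[OF _ F(2)] by (intro sum_ennreal[symmetric]) (auto simp: less_imp_le)
        also have "ennreal (\<Sum>k\<in>F. (v k)\<^sup>2 / \<mu> k) * (\<Sum>k\<in>F. ennreal (\<mu> k * (cof k x)\<^sup>2)) \<le> ennreal (\<Sum>k\<in>F. (v k)\<^sup>2 / \<mu> k) * (\<Sum>j. ennreal (\<mu> j * (cof j x)\<^sup>2))"
          using F(1) by (intro mult_left_mono sum_le_suminf) auto
        finally show "ennreal ((\<Sum>k\<in>F. v k * cof k x)\<^sup>2) \<le> ennreal (\<Sum>k\<in>F. (v k)\<^sup>2 / \<mu> k) * (\<Sum>j. ennreal (\<mu> j * (cof j x)\<^sup>2))" .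
      qed
      also have "\<dots> = ennreal (\<Sum>k\<in>F. (v k)\<^sup>2 / \<mu> k) * Q"
        unfolding Q_def by (rule nn_integral_cmult) measurable
      also have "\<dots> = ennreal (enn2real Q * (\<Sum>k\<in>F. (v k)\<^sup>2 / \<mu> k))"
        using V by (subst Q) (simp add: ennreal_mult mult.commute)
      finally show "(\<integral>\<^sup>+x. ennreal ((\<Sum>k\<in>F. v k * cof k x)\<^sup>2) \<partial>M) \<le> ennreal (enn2real Q * (\<Sum>k\<in>F. (v k)\<^sup>2 / \<mu> k))" .
    qed simp
  next
    case centred
    define Q where "Q = (SUP k\<in>{1..}. ennreal (eigval \<theta>0 \<theta>1 \<theta>2 k) * (\<integral>\<^sup>+\<omega>. ennreal ((H_coeff \<theta>1 \<theta>2 (\<xi> \<omega>) k)\<^sup>2) \<partial>M))"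
    have Q: "Q = ennreal (enn2real Q)" using centred(3) by (simp add: Q_def)
    have sq: "integrable M (\<lambda>\<omega>. (cof k \<omega>)\<^sup>2)" "(\<integral>\<omega>. (cof k \<omega>)\<^sup>2 \<partial>M) \<le> enn2real Q / \<mu> k" if "K0 \<le> k" for k
    proof -
      have p: "0 < \<mu> k" using pos[OF that] by (simp add: \<mu>_def)
      have "ennreal (\<mu> k) * (\<integral>\<^sup>+\<omega>. ennreal ((cof k \<omega>)\<^sup>2) \<partial>M) \<le> Q"
        unfolding Q_def \<mu>_def cof_def by (rule SUP_upper) simp
      then have "ennreal (1 / \<mu> k) * (ennreal (\<mu> k) * (\<integral>\<^sup>+\<omega>. ennreal ((cof k \<omega>)\<^sup>2) \<partial>M)) \<le> ennreal (1 / \<mu> k) * ennreal (enn2real Q)"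
        unfolding Q[symmetric] by (rule mult_left_mono) simp
      then have le: "(\<integral>\<^sup>+\<omega>. ennreal ((cof k \<omega>)\<^sup>2) \<partial>M) \<le> ennreal (enn2real Q / \<mu> k)"
        using p by (simp add: mult.assoc[symmetric] ennreal_mult[symmetric])
      then show "integrable M (\<lambda>\<omega>. (cof k \<omega>)\<^sup>2)"
        by (intro integrableI_nonneg) (auto simp: le_less_trans)
      then show "(\<integral>\<omega>. (cof k \<omega>)\<^sup>2 \<partial>M) \<le> enn2real Q / \<mu> k"
        using le p by (simp add: nn_integral_eq_integral)
    qed
    have cross: "integrable M (\<lambda>\<omega>. cof k \<omega> * cof l \<omega>)" "(\<integral>\<omega>. cof k \<omega> * cof l \<omega> \<partial>M) = 0" if "k \<noteq> l" for k l
    proof -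
      have i2: "indep_vars (\<lambda>_. borel) (\<lambda>k \<omega>. H_coeff \<theta>1 \<theta>2 (\<xi> \<omega>) k) {Suc k, Suc l}"
        by (rule indep_vars_subset[OF ind]) auto
      have int: "integrable M (\<lambda>\<omega>. H_coeff \<theta>1 \<theta>2 (\<xi> \<omega>) i)" if "i \<in> {Suc k, Suc l}" for i
        using centred(1) that unfolding cof_def by auto
      show "integrable M (\<lambda>\<omega>. cof k \<omega> * cof l \<omega>)"
        using indep_vars_integrable[OF _ i2 int] that unfolding cof_def by simp
      show "(\<integral>\<omega>. cof k \<omega> * cof l \<omega> \<partial>M) = 0"
        using indep_vars_lebesgue_integral[OF _ i2 int] that centred(2) unfolding cof_def by simp
    qed
    show ?thesis
    proof (intro exI[of _ "enn2real Q"] conjI allI impI)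
      fix F v assume F: "finite F" "F \<subseteq> {K0..}"
      have int: "integrable M (\<lambda>x. cof k x * cof l x)" if "k \<in> F" "l \<in> F" for k l
        using cross(1)[of k l] sq(1)[of k] that F by (cases "k = l") (auto simp: power2_eq_square)
      have eq: "(\<Sum>k\<in>F. v k * cof k x)\<^sup>2 = (\<Sum>k\<in>F. \<Sum>l\<in>F. v k * v l * (cof k x * cof l x))" for x
        unfolding power2_eq_square sum_product by (simp only: mult_ac)
      have I: "integrable M (\<lambda>x. (\<Sum>k\<in>F. v k * cof k x)\<^sup>2)"
        unfolding eq by (intro Bochner_Integration.integrable_sum integrable_mult_right int)
      have "(\<integral>x. (\<Sum>k\<in>F. v k * cof k x)\<^sup>2 \<partial>M) = (\<Sum>k\<in>F. \<Sum>l\<in>F. v k * v l * (\<integral>x. cof k x * cof l x \<partial>M))"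
        unfolding eq using int by (simp add: Bochner_Integration.integral_sum)
      also have "\<dots> = (\<Sum>k\<in>F. \<Sum>l\<in>F. (if k = l then (v k)\<^sup>2 * (\<integral>x. (cof k x)\<^sup>2 \<partial>M) else 0))"
        by (intro sum.cong refl) (auto simp: cross(2) power2_eq_square)
      also have "\<dots> = (\<Sum>k\<in>F. (v k)\<^sup>2 * (\<integral>x. (cof k x)\<^sup>2 \<partial>M))" using F(1) by simp
      also have "\<dots> \<le> (\<Sum>k\<in>F. (v k)\<^sup>2 * (enn2real Q / \<mu> k))"
        using F by (intro sum_mono mult_left_mono sq) auto
      also have "\<dots> = enn2real Q * (\<Sum>k\<in>F. (v k)\<^sup>2 / \<mu> k)" by (simp add: sum_distrib_left mult_ac)
      finally show "(\<integral>\<^sup>+x. ennreal ((\<Sum>k\<in>F. v k * cof k x)\<^sup>2) \<partial>M) \<le> ennreal (enn2real Q * (\<Sum>k\<in>F. (v k)\<^sup>2 / \<mu> k))"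
        using I by (simp add: nn_integral_eq_integral ennreal_leI)
    qed simp
  qed
qed

text \<open>From |f| <= 1 + f^2 and the uniform boundedness of the eigenfunctions. A bound uniform
  in k is enough at positive times, where exp(-\<lambda>_k t) makes the initial series
  converge.\<close>

lemma H_coeff_bounded:
  assumes "f \<in> H_space \<theta>1 \<theta>2"
  shows "\<exists>B. \<forall>k. \<bar>H_coeff \<theta>1 \<theta>2 f k\<bar> \<le> B"
proof -
  define c where "c = sqrt 2 * exp \<bar>\<theta>1 / (2 * \<theta>2)\<bar>"
  define g where "g y = c * (indicator {0..1} y * exp (y * \<theta>1 / \<theta>2)) + c * (indicator {0..1} y * (exp (y * \<theta>1 / \<theta>2) * (f y)\<^sup>2))" for y :: real
  have "set_integrable lborel {0..1} (\<lambda>y. exp (y * \<theta>1 / \<theta>2))"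
    by (rule borel_integrable_atLeastAtMost') (auto intro!: continuous_intros simp: divide_inverse)
  then have gi: "integrable lborel g"
    using assms unfolding g_def H_space_def set_integrable_def
    by (intro Bochner_Integration.integrable_add integrable_mult_right) auto
  have e: "\<bar>eigfun \<theta>1 \<theta>2 k y\<bar> \<le> c" if "y \<in> {0..1}" for k y
  proof -
    have "- (\<theta>1 / (2 * \<theta>2)) * y \<le> \<bar>\<theta>1 / (2 * \<theta>2)\<bar> * y"
      by (rule mult_right_mono[OF abs_ge_minus_self]) (use that in auto)
    also have "\<dots> \<le> \<bar>\<theta>1 / (2 * \<theta>2)\<bar> * 1"
      by (rule mult_left_mono[OF _ abs_ge_zero]) (use that in auto)
    finally have "exp (- (\<theta>1 / (2 * \<theta>2)) * y) \<le> exp \<bar>\<theta>1 / (2 * \<theta>2)\<bar>" by simp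
    moreover have "\<bar>sqrt 2 * sin (pi * real k * y)\<bar> \<le> sqrt 2" by (simp add: abs_mult)
    ultimately show ?thesis
      unfolding eigfun_def c_def abs_mult[of _ "exp _"] abs_exp_cancel by (intro mult_mono) auto
  qed
  have "\<bar>H_coeff \<theta>1 \<theta>2 f k\<bar> \<le> integral\<^sup>L lborel g" for k
    unfolding H_coeff_def H_inner_def set_lebesgue_integral_def real_norm_def[symmetric]
  proof (rule norm_integral_le[OF gi])
    fix y :: real
    show "norm (indicator {0..1} y *\<^sub>R (exp (y * \<theta>1 / \<theta>2) * f y * eigfun \<theta>1 \<theta>2 k y)) \<le> g y"
    proof (cases "y \<in> {0..1}")
      case True
      have "\<bar>f y\<bar> \<le> 1 + (f y)\<^sup>2"
        using two_mult_le_weighted[of 1 1 "f y"] zero_le_power2[of "f y"] by simp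
      then have "exp (y * \<theta>1 / \<theta>2) * \<bar>f y\<bar> * \<bar>eigfun \<theta>1 \<theta>2 k y\<bar> \<le> exp (y * \<theta>1 / \<theta>2) * (1 + (f y)\<^sup>2) * c"
        using e[OF True, of k] by (intro mult_mono) auto
      then show ?thesis using True by (simp add: g_def abs_mult algebra_simps)
    qed (simp add: g_def)
  qed
  then show ?thesis by blast
qed

section \<open>The central limit theorem\<close>

definition second_diff :: "real \<Rightarrow> nat \<Rightarrow> nat \<Rightarrow> real" where
  "second_diff \<mu> n m = 2 * expint \<mu> (real m / real n) - expint \<mu> (real (m + 1) / real n) - expint \<mu> (\<bar>real m - 1\<bar> / real n)"

definition inccov :: "real \<Rightarrow> nat \<Rightarrow> nat \<Rightarrow> nat \<Rightarrow> real" where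
  "inccov \<mu> n i j = - (second_diff \<mu> n (i - j + (j - i)) + second_diff \<mu> n (i + j + 1))"

text \<open>The mixed difference of a function of s + t, or of |s - t|, is an ordinary second
  difference in that single variable.\<close>

lemma expcov_increments:
  "expcov \<mu> (real (i + 1) / real n) (real (j + 1) / real n) - expcov \<mu> (real (i + 1) / real n) (real j / real n)
    - expcov \<mu> (real i / real n) (real (j + 1) / real n) + expcov \<mu> (real i / real n) (real j / real n) = inccov \<mu> n i j"
proof -
  define m where "m = i - j + (j - i)"
  have d: "\<bar>a / real n - b / real n\<bar> = \<bar>a - b\<bar> / real n" for a b
    by (simp add: diff_divide_distrib[symmetric])
  have s: "a / real n + b / real n = (a + b) / real n" for a b
    by (simp add: add_divide_distrib)
  have sums: "real (i + 1) + real (j + 1) = real (i + j + 1 + 1)" "real (i + 1) + real j = real (i + j + 1)"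
    "real i + real (j + 1) = real (i + j + 1)" "real i + real j = \<bar>real (i + j + 1) - 1\<bar>" by auto
  have e: "\<bar>real (i + 1) - real (j + 1)\<bar> = real m" "\<bar>real i - real j\<bar> = real m"
    by (auto simp: m_def)
  \<comment> \<open>The two off-diagonal terms belong to the lags m + 1 and m - 1; which is which
    depends on the side of the diagonal.\<close>
  have "expint \<mu> (\<bar>real (i + 1) - real j\<bar> / real n) + expint \<mu> (\<bar>real i - real (j + 1)\<bar> / real n) =
    expint \<mu> (real (m + 1) / real n) + expint \<mu> (\<bar>real m - 1\<bar> / real n)"
  proof (cases "j \<le> i")
    case True
    then have "\<bar>real (i + 1) - real j\<bar> = real (m + 1)" "\<bar>real i - real (j + 1)\<bar> = \<bar>real m - 1\<bar>"
      by (auto simp: m_def of_nat_diff)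
    then show ?thesis by (simp only:)
  next
    case False
    then have "\<bar>real (i + 1) - real j\<bar> = \<bar>real m - 1\<bar>" "\<bar>real i - real (j + 1)\<bar> = real (m + 1)"
      by (auto simp: m_def of_nat_diff)
    then show ?thesis by (simp only: add.commute)
  qed
  then show ?thesis
    unfolding expcov_def inccov_def second_diff_def d s sums e m_def[symmetric] by linarith
qed

lemma coordinate_increments_char:
  fixes \<mu> ev b :: "nat \<Rightarrow> real"
  assumes M: "prob_space M" and noise: "driving_noise M \<theta>1 \<theta>2 W \<xi>"
    and J: "\<And>k t. k \<ge> 1 \<Longrightarrow> t \<ge> 0 \<Longrightarrow> is_wiener_integral M (W k) t (\<lambda>s. exp (- \<mu> k * (t - s)) * \<sigma>) (J k t)"
  shows "(CLINT \<omega>|M. iexp (\<Sum>i<n. b i * (\<Sum>k<N. ev k * (J (Suc k) (real (i + 1) / real n) \<omega> - J (Suc k) (real i / real n) \<omega>)))) =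
    of_real (exp (- (\<Sum>k<N. (ev k)\<^sup>2 * (\<sigma>\<^sup>2 / 2 * (\<Sum>i<n. \<Sum>j<n. b i * b j * inccov (\<mu> (Suc k)) n i j))) / 2))"
proof -
  \<comment> \<open>An increment is encoded by its two end points: (i, 1) with weight b_i and (i, 0)
    with weight -b_i. This reduces increments to values at finitely many times.\<close>
  define L where "L = {..<n} \<times> {0, 1::nat}"
  define b' where "b' l = (if snd l = 1 then b (fst l) else - b (fst l))" for l :: "nat \<times> nat"
  define \<tau> where "\<tau> l = real (fst l + snd l) / real n" for l :: "nat \<times> nat"
  have sumL: "(\<Sum>l\<in>L. b' l * f (\<tau> l)) = (\<Sum>i<n. b i * (f (real (i + 1) / real n) - f (real i / real n)))" for f :: "real \<Rightarrow> real"
    unfolding L_def sum.cartesian_product' by (simp add: b'_def \<tau>_def algebra_simps)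
  have cov: "(\<Sum>l\<in>L. \<Sum>m\<in>L. b' l * b' m * expcov \<nu> (\<tau> l) (\<tau> m)) = (\<Sum>i<n. \<Sum>j<n. b i * b j * inccov \<nu> n i j)" for \<nu>
  proof -
    have "(\<Sum>l\<in>L. \<Sum>m\<in>L. b' l * b' m * expcov \<nu> (\<tau> l) (\<tau> m)) = (\<Sum>l\<in>L. b' l * (\<Sum>m\<in>L. b' m * expcov \<nu> (\<tau> l) (\<tau> m)))"
      by (simp only: sum_distrib_left mult.assoc)
    also have "\<dots> = (\<Sum>l\<in>L. b' l * (\<Sum>j<n. b j * (expcov \<nu> (\<tau> l) (real (j + 1) / real n) - expcov \<nu> (\<tau> l) (real j / real n))))"
      unfolding sumL[of "expcov \<nu> (\<tau> l)" for l] ..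
    also have "\<dots> = (\<Sum>i<n. b i * ((\<Sum>j<n. b j * (expcov \<nu> (real (i + 1) / real n) (real (j + 1) / real n) - expcov \<nu> (real (i + 1) / real n) (real j / real n))) -
        (\<Sum>j<n. b j * (expcov \<nu> (real i / real n) (real (j + 1) / real n) - expcov \<nu> (real i / real n) (real j / real n)))))"
      by (rule sumL)
    also have "\<dots> = (\<Sum>i<n. \<Sum>j<n. b i * b j * inccov \<nu> n i j)"
      unfolding sum_subtractf[symmetric] sum_distrib_left expcov_increments[symmetric]
      by (intro sum.cong refl) (simp add: algebra_simps)
    finally show ?thesis .
  qed
  have K: "(\<Sum>k\<in>Suc ` {..<N}. f k) = (\<Sum>k<N. f (Suc k))" for f :: "nat \<Rightarrow> real"
    by (simp add: sum.reindex)
  \<comment> \<open>The modes in \<open>J\<close> are numbered from 1, the weights \<open>ev\<close>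
    from 0.\<close>
  have c1: "(CLINT \<omega>|M. iexp (\<Sum>k\<in>Suc ` {..<N}. ev (k - 1) * (\<Sum>l\<in>L. b' l * J k (\<tau> l) \<omega>))) =
    of_real (exp (- (\<Sum>k\<in>Suc ` {..<N}. (ev (k - 1))\<^sup>2 * (\<sigma>\<^sup>2 / 2 * (\<Sum>l\<in>L. \<Sum>m\<in>L. b' l * b' m * expcov (\<mu> k) (\<tau> l) (\<tau> m)))) / 2))"
    by (rule coordinates_char[OF M noise J]) (auto simp: L_def \<tau>_def)
  have c2: "(\<Sum>k\<in>Suc ` {..<N}. ev (k - 1) * (\<Sum>l\<in>L. b' l * J k (\<tau> l) \<omega>)) =
    (\<Sum>i<n. b i * (\<Sum>k<N. ev k * (J (Suc k) (real (i + 1) / real n) \<omega> - J (Suc k) (real i / real n) \<omega>)))" for \<omega>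
  proof -
    have "(\<Sum>k\<in>Suc ` {..<N}. ev (k - 1) * (\<Sum>l\<in>L. b' l * J k (\<tau> l) \<omega>)) =
      (\<Sum>k<N. ev k * (\<Sum>i<n. b i * (J (Suc k) (real (i + 1) / real n) \<omega> - J (Suc k) (real i / real n) \<omega>)))"
      unfolding K sumL[of "\<lambda>t. J k t \<omega>" for k] by simp
    also have "\<dots> = (\<Sum>i<n. b i * (\<Sum>k<N. ev k * (J (Suc k) (real (i + 1) / real n) \<omega> - J (Suc k) (real i / real n) \<omega>)))"
      unfolding sum_distrib_left by (subst sum.swap) (simp only: mult.left_commute)
    finally show ?thesis .
  qed
  show ?thesis using c1 unfolding c2 unfolding K cov diff_Suc_1 .
qed

text \<open>The integral at time 0 is given only up to null sets, but its variance is 0. This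
  isolates the series of the initial value at time 0, where no exponential factor helps it to
  converge.\<close>

lemma wiener_integral_at_0:
  assumes M: "prob_space M" and noise: "driving_noise M \<theta>1 \<theta>2 W \<xi>"
    and J: "\<And>k t. k \<ge> 1 \<Longrightarrow> t \<ge> 0 \<Longrightarrow> is_wiener_integral M (W k) t (\<lambda>s. exp (- \<mu> k * (t - s)) * \<sigma>) (J k t)"
    and k: "k \<ge> 1"
  shows "AE \<omega> in M. J k 0 \<omega> = (0::real)"
proof -
  have [measurable]: "J k 0 \<in> borel_measurable M"
    using J[OF k order_refl] by (simp add: is_wiener_integral_def)
  have c: "(CLINT \<omega>|M. iexp (t * J k 0 \<omega>)) = of_real (exp (- t\<^sup>2 * 0 / 2))" for t
    using coordinates_char[OF M noise J, of "{k}" "{()}" "\<lambda>_. 0" "\<lambda>_. 1" "\<lambda>_. t"] k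
    by (simp add: expcov_def)
  have "(\<integral>\<^sup>+\<omega>. ennreal ((J k 0 \<omega>)\<^sup>2) \<partial>M) \<le> ennreal 0"
    by (rule nn_integral_square_le_of_char[OF M _ c]) measurable
  then have "(\<integral>\<^sup>+\<omega>. ennreal ((J k 0 \<omega>)\<^sup>2) \<partial>M) = 0" by simp
  then have "AE \<omega> in M. ennreal ((J k 0 \<omega>)\<^sup>2) = 0"
    by (subst (asm) nn_integral_0_iff_AE) auto
  then show ?thesis by eventually_elim simp
qed

section \<open>Summation over the modes\<close>

context heat_modes
begin

lemma D_sums: "(\<lambda>N. \<Sum>k<N. w k * second_diff (\<mu> k) n m) \<longlonglongrightarrow> D n m"
proof -
  have s: "(\<lambda>k. w k * expint (\<mu> k) x) sums G x" if "0 \<le> x" for x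
    unfolding G_def by (rule summable_sums[OF summable_G[OF that]])
  have "(\<lambda>k. 2 * (w k * expint (\<mu> k) (real m / real n)) - w k * expint (\<mu> k) (real (m + 1) / real n) - w k * expint (\<mu> k) (\<bar>real m - 1\<bar> / real n)) sums D n m"
    unfolding D_def by (intro sums_diff sums_mult s) auto
  then show ?thesis
    unfolding sums_def second_diff_def by (simp add: algebra_simps)
qed

lemma cov_sums:
  "(\<lambda>N. \<Sum>k<N. w k * (v / 2 * (\<Sum>i<n. \<Sum>j<n. b i * b j * inccov (\<mu> k) n i j))) \<longlonglongrightarrow> quad_form {..<n} (cov v n) b"
proof -
  have eq: "(\<Sum>k<N. w k * (v / 2 * (\<Sum>i<n. \<Sum>j<n. b i * b j * inccov (\<mu> k) n i j))) =
    (\<Sum>i<n. \<Sum>j<n. - (v / 2) * ((\<Sum>k<N. w k * second_diff (\<mu> k) n (i - j + (j - i))) + (\<Sum>k<N. w k * second_diff (\<mu> k) n (i + j + 1))) * b i * b j)" for N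
  proof -
    have "(\<Sum>k<N. w k * (v / 2 * (\<Sum>i<n. \<Sum>j<n. b i * b j * inccov (\<mu> k) n i j))) =
      (\<Sum>k<N. \<Sum>i<n. \<Sum>j<n. w k * (v / 2 * (b i * b j * inccov (\<mu> k) n i j)))"
      by (simp only: sum_distrib_left)
    also have "\<dots> = (\<Sum>i<n. \<Sum>j<n. \<Sum>k<N. w k * (v / 2 * (b i * b j * inccov (\<mu> k) n i j)))"
      by (subst sum.swap) (intro sum.cong refl sum.swap)
    also have "\<dots> = (\<Sum>i<n. \<Sum>j<n. - (v / 2) * ((\<Sum>k<N. w k * second_diff (\<mu> k) n (i - j + (j - i))) + (\<Sum>k<N. w k * second_diff (\<mu> k) n (i + j + 1))) * b i * b j)"
      unfolding sum.distrib[symmetric] sum_distrib_left sum_distrib_right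
      by (intro sum.cong refl) (simp add: inccov_def algebra_simps)
    finally show ?thesis .
  qed
  show ?thesis
    unfolding eq quad_form_def cov_def
    by (intro tendsto_sum tendsto_mult tendsto_add tendsto_const D_sums)
qed

text \<open>Schur's test: a symmetric quadratic form is bounded by the largest absolute row
  sum.\<close>

lemma quad_form_cov_le:
  assumes n: "real n > 1 / x0" "n \<ge> 1" and v: "0 \<le> v"
  shows "quad_form {..<n} (cov v n) b \<le> v * (a + C + 2 * c) / sqrt (real n) * (\<Sum>i<n. (b i)\<^sup>2)"
proof -
  let ?C = "cov v n"
  have "quad_form {..<n} ?C b \<le> (\<Sum>i<n. \<Sum>j<n. \<bar>?C i j\<bar> * (b i)\<^sup>2 / 2 + \<bar>?C i j\<bar> * (b j)\<^sup>2 / 2)"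
    unfolding quad_form_def
  proof (intro sum_mono)
    fix i j
    have "?C i j * b i * b j \<le> \<bar>?C i j\<bar> * (\<bar>b i\<bar> * \<bar>b j\<bar>)"
      by (simp add: abs_mult[symmetric] mult.assoc)
    also have "\<dots> \<le> \<bar>?C i j\<bar> * (((b i)\<^sup>2 + (b j)\<^sup>2) / 2)"
      using two_mult_le_weighted[of 1 "b i" "b j"] by (intro mult_left_mono) auto
    finally show "?C i j * b i * b j \<le> \<bar>?C i j\<bar> * (b i)\<^sup>2 / 2 + \<bar>?C i j\<bar> * (b j)\<^sup>2 / 2"
      by (simp add: algebra_simps)
  qed
  also have "\<dots> = (\<Sum>i<n. \<Sum>j<n. \<bar>?C i j\<bar> * (b i)\<^sup>2 / 2) + (\<Sum>i<n. \<Sum>j<n. \<bar>?C i j\<bar> * (b j)\<^sup>2 / 2)"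
    by (simp only: sum.distrib)
  also have "(\<Sum>i<n. \<Sum>j<n. \<bar>?C i j\<bar> * (b j)\<^sup>2 / 2) = (\<Sum>i<n. \<Sum>j<n. \<bar>?C i j\<bar> * (b i)\<^sup>2 / 2)"
    by (subst sum.swap) (simp only: cov_sym)
  also have "(\<Sum>i<n. \<Sum>j<n. \<bar>?C i j\<bar> * (b i)\<^sup>2 / 2) + (\<Sum>i<n. \<Sum>j<n. \<bar>?C i j\<bar> * (b i)\<^sup>2 / 2) = (\<Sum>i<n. (\<Sum>j<n. \<bar>?C i j\<bar>) * (b i)\<^sup>2)"
    by (simp add: sum_distrib_right sum_divide_distrib[symmetric])
  also have "\<dots> \<le> (\<Sum>i<n. v * (a + C + 2 * c) / sqrt (real n) * (b i)\<^sup>2)"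
    by (intro sum_mono mult_right_mono cov_row n v) auto
  finally show ?thesis by (simp only: sum_distrib_left)
qed

end

text \<open>The point mass is the limit law for \<sigma> = 0; the other laws are rescaled standard
  normal laws.\<close>

lemma char_normal_law:
  assumes "0 \<le> v"
  shows "real_distribution (normal_law 0 v)" and "char (normal_law 0 v) t = of_real (exp (- v * t\<^sup>2 / 2))"
proof -
  have "real_distribution (normal_law 0 v) \<and> char (normal_law 0 v) t = of_real (exp (- v * t\<^sup>2 / 2))"
  proof (cases "v = 0")
    case True
    interpret prob_space "return borel (0::real)" by (rule prob_space_return) simp
    have "real_distribution (return borel (0::real))" by standard auto
    moreover have "char (return borel 0) t = 1"
      unfolding char_def by (subst integral_return) auto
    ultimately show ?thesis using True by (simp add: normal_law_def)
  next
    case False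
    then have s: "sqrt v > 0" using assms by simp
    interpret N: prob_space std_normal_distribution by (rule prob_space_std_normal)
    interpret L: prob_space "density lborel (normal_density 0 (sqrt v))" by (rule prob_space_normal_density[OF s])
    have rd: "real_distribution (density lborel (normal_density 0 (sqrt v)))" by standard auto
    have "distributed std_normal_distribution lborel (\<lambda>x. x) std_normal_density"
      unfolding distributed_def by (auto simp: distr_id2)
    from N.normal_density_affine[OF this, of "sqrt v" 0]
    have "distributed std_normal_distribution lborel (\<lambda>x. 0 + sqrt v * x) (normal_density (0 + sqrt v * 0) (\<bar>sqrt v\<bar> * 1))"
      using False assms by simp
    then have D: "distr std_normal_distribution lborel (\<lambda>x. sqrt v * x) = density lborel (normal_density 0 (sqrt v))"
      using s by (simp add: distributed_def)
    have "char (density lborel (normal_density 0 (sqrt v))) t = char std_normal_distribution (t * sqrt v)"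
      unfolding D[symmetric] char_def by (subst integral_distr) (auto simp: mult_ac)
    also have "\<dots> = of_real (exp (- v * t\<^sup>2 / 2))"
      using assms by (simp add: char_std_normal_distribution power_mult_distrib mult_ac)
    finally show ?thesis using rd False by (simp add: normal_law_def)
  qed
  then show "real_distribution (normal_law 0 v)" "char (normal_law 0 v) t = of_real (exp (- v * t\<^sup>2 / 2))" by auto
qed

theorem theorem3p3:
  fixes M :: "'w measure"
    and \<theta>0 \<theta>1 \<theta>2 \<sigma> \<delta> y :: real
    and W :: "nat \<Rightarrow> real \<Rightarrow> 'w \<Rightarrow> real"
    and \<xi> :: "'w \<Rightarrow> real \<Rightarrow> real"
    and X :: "real \<Rightarrow> real \<Rightarrow> 'w \<Rightarrow> real"
  assumes "prob_space M"
    and "\<theta>2 > 0"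
    and "driving_noise M \<theta>1 \<theta>2 W \<xi>"
    and "mild_solution M \<theta>0 \<theta>1 \<theta>2 \<sigma> W \<xi> X"
    and "initial_condition M \<theta>0 \<theta>1 \<theta>2 \<xi>"
    and "\<delta> > 0"
    and "y \<in> {\<delta>..1 - \<delta>}"
  shows "weak_conv_m
    (\<lambda>n. distr M borel (\<lambda>\<omega>. sqrt (real n) * (sigma2_hat \<theta>1 \<theta>2 X n y \<omega> - \<sigma>\<^sup>2)))
    (normal_law 0 (pi * Gamma_const * \<sigma> ^ 4))"
proof -
  interpret prob_space M by fact
  note \<theta>2 = \<open>\<theta>2 > 0\<close> and noise = \<open>driving_noise M \<theta>1 \<theta>2 W \<xi>\<close>
  have y: "0 < y" "y < 1" using assms(6,7) by auto
  define \<mu>0 where "\<mu>0 = - \<theta>0 + \<theta>1\<^sup>2 / (4 * \<theta>2)"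
  define \<mu> where "\<mu> k = \<mu>0 + pi\<^sup>2 * (real (Suc k))\<^sup>2 * \<theta>2" for k
  define w where "w k = 2 * (sin (pi * real (Suc k) * y))\<^sup>2" for k
  define ev where "ev k = sqrt 2 * sin (pi * real (Suc k) * y)" for k
  define a where "a = 1 / sqrt (pi * \<theta>2)"
  define s where "s = sqrt (pi * \<theta>2)"
  have s0: "0 < s" and sa: "s * a = 1" using \<theta>2 by (simp_all add: s_def a_def)
  have ev_sq: "(ev k)\<^sup>2 = w k" for k by (simp add: ev_def w_def power_mult_distrib)
  have ev2: "\<bar>ev k\<bar> \<le> 2" for k
  proof -
    have "\<bar>ev k\<bar> \<le> sqrt 2 * 1" unfolding ev_def abs_mult by (intro mult_mono) auto
    also have "\<dots> \<le> 2" using real_sqrt_le_mono[of 2 4] by simp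
    finally show ?thesis .
  qed
  have eigval: "eigval \<theta>0 \<theta>1 \<theta>2 (Suc k) = \<mu> k" for k by (simp add: eigval_def \<mu>_def \<mu>0_def)

  \<comment> \<open>Half of the leading coefficient of the rates; from \<open>K0\<close> on the
    other half absorbs the offset \<open>\<mu>0\<close>.\<close>
  define m0 where "m0 = pi\<^sup>2 * \<theta>2 / 2"
  define K0 where "K0 = nat \<lceil>\<bar>\<mu>0\<bar> / m0\<rceil>"
  have m0: "0 < m0" using \<theta>2 by (simp add: m0_def)
  have \<mu>_ge: "m0 * (real (Suc k))\<^sup>2 \<le> \<mu> k" if "K0 \<le> k" for k
  proof -
    have "\<bar>\<mu>0\<bar> / m0 \<le> real (Suc k)" using that unfolding K0_def by linarith
    also have "\<dots> \<le> (real (Suc k))\<^sup>2" by (simp add: power2_eq_square)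
    finally have "\<bar>\<mu>0\<bar> \<le> m0 * (real (Suc k))\<^sup>2" using m0 by (simp add: pos_divide_le_eq mult.commute)
    moreover have "\<mu> k = \<mu>0 + 2 * (m0 * (real (Suc k))\<^sup>2)" by (simp add: \<mu>_def m0_def)
    ultimately show ?thesis by linarith
  qed
  have \<mu>_pos: "0 < \<mu> k" if "K0 \<le> k" for k
  proof -
    have "0 < m0 * (real (Suc k))\<^sup>2" using m0 by simp
    then show ?thesis using \<mu>_ge[OF that] by linarith
  qed
  obtain C x0 where asymp: "0 < x0" "0 \<le> C"
    "\<And>x. 0 < x \<Longrightarrow> x < x0 \<Longrightarrow> \<bar>(\<Sum>k. w k * expint (\<mu> k) x) - a * sqrt x\<bar> \<le> C * (x * sqrt x)"
  proof -
    obtain C x0 where "0 < x0" "0 \<le> C"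
      "\<And>x. 0 < x \<Longrightarrow> x < x0 \<Longrightarrow> \<bar>(\<Sum>k. 2 * (sin (pi * real (Suc k) * y))\<^sup>2 * expint (\<mu>0 + pi\<^sup>2 * (real (Suc k))\<^sup>2 * \<theta>2) x) - sqrt x / sqrt (pi * \<theta>2)\<bar> \<le> C * (x * sqrt x)"
      by (rule heat_trace_asymp[OF \<theta>2 y, of \<mu>0]) blast
    then show ?thesis using that[of x0 C] by (simp add: w_def \<mu>_def a_def)
  qed
  interpret H: heat_modes \<mu> w K0 a C x0
  proof
    show "summable (\<lambda>k. w (k + K0) / \<mu> (k + K0))"
    proof (rule summable_comparison_test')
      have "summable (\<lambda>k. inverse ((real (k + Suc K0))\<^sup>2))"
        using inverse_power_summable[of 2, where 'a = real] by (subst summable_iff_shift) simp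
      then show "summable (\<lambda>k. 2 / m0 * inverse ((real (k + Suc K0))\<^sup>2))" by (rule summable_mult)
      fix k
      have w2: "0 \<le> w (k + K0)" "w (k + K0) \<le> 2"
        using abs_square_le_1[of "sin (pi * real (Suc (k + K0)) * y)"] by (auto simp: w_def)
      have "w (k + K0) / \<mu> (k + K0) \<le> 2 / (m0 * (real (Suc (k + K0)))\<^sup>2)"
        using w2 \<mu>_ge[of "k + K0"] m0 by (intro frac_le) auto
      then show "norm (w (k + K0) / \<mu> (k + K0)) \<le> 2 / m0 * inverse ((real (k + Suc K0))\<^sup>2)"
        using w2 \<mu>_pos[of "k + K0"] by (simp add: inverse_eq_divide)
    qed
  qed (use asymp \<mu>_pos \<theta>2 in \<open>auto simp: w_def a_def\<close>)
  obtain N0 where N0: "\<And>n. N0 \<le> n \<Longrightarrow> real n > 1 / x0" "\<And>n. N0 \<le> n \<Longrightarrow> n \<ge> 1"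
    using H.eventually_large unfolding eventually_sequentially by blast

  \<comment> \<open>\<open>\<eta>\<close> cancels the exponential factor of the eigenfunctions, and
    its square is the weight exp(y \<theta>1 / \<theta>2) in the estimator.\<close>
  define \<eta> where "\<eta> = exp (\<theta>1 / (2 * \<theta>2) * y)"
  have \<eta>e: "\<eta> * eigfun \<theta>1 \<theta>2 (Suc k) y = ev k" for k
    by (simp add: \<eta>_def eigfun_def ev_def exp_minus field_simps)
  define cof where "cof k \<omega> = H_coeff \<theta>1 \<theta>2 (\<xi> \<omega>) (Suc k)" for k \<omega>
  have cofm [measurable]: "cof k \<in> borel_measurable M" for k
  proof -
    have "indep_vars (\<lambda>_. borel) (\<lambda>k \<omega>. H_coeff \<theta>1 \<theta>2 (\<xi> \<omega>) k) {1..}"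
      using assms(5) unfolding initial_condition_def by blast
    then show ?thesis unfolding indep_vars_def cof_def[abs_def] by auto
  qed
  have Xm [measurable]: "X t y \<in> borel_measurable M" if "0 \<le> t" for t
    using assms(4) that y unfolding mild_solution_def by auto
  obtain J where J: "\<And>k t. k \<ge> 1 \<Longrightarrow> t \<ge> 0 \<Longrightarrow> is_wiener_integral M (W k) t (\<lambda>s. exp (- eigval \<theta>0 \<theta>1 \<theta>2 k * (t - s)) * \<sigma>) (J k t)"
    and Xsums: "\<And>t. t \<ge> 0 \<Longrightarrow> AE \<omega> in M. (\<lambda>j. (exp (- \<mu> j * t) * cof j \<omega> + J (Suc j) t \<omega>) * eigfun \<theta>1 \<theta>2 (Suc j) y) sums X t y \<omega>"
    using assms(4) y unfolding mild_solution_def Let_def eigval cof_def by force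
  have Jm [measurable]: "J (Suc k) t \<in> borel_measurable M" if "0 \<le> t" for k t
    using J[of "Suc k" t] that by (simp add: is_wiener_integral_def)
  have Xlim: "AE \<omega> in M. (\<lambda>N. \<Sum>k<N. ev k * exp (- \<mu> k * t) * cof k \<omega> + ev k * J (Suc k) t \<omega>) \<longlonglongrightarrow> \<eta> * X t y \<omega>" if "0 \<le> t" for t
    using Xsums[OF that]
  proof eventually_elim
    case (elim \<omega>)
    from sums_mult[OF this, of \<eta>]
    have "(\<lambda>j. (\<eta> * eigfun \<theta>1 \<theta>2 (Suc j) y) * (exp (- \<mu> j * t) * cof j \<omega> + J (Suc j) t \<omega>)) sums (\<eta> * X t y \<omega>)"
      by (simp only: mult_ac)
    then show ?case unfolding \<eta>e sums_def by (simp only: distrib_left mult.assoc)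
  qed
  \<comment> \<open>The solution provides convergence only for the sum of initial and stochastic
    series. The initial series converges on its own: at time 0 because the stochastic terms vanish
    there, at positive times by the decay of exp(-\<mu>_k t).\<close>
  have conv: "AE \<omega> in M. convergent (\<lambda>N. \<Sum>k<N. ev k * exp (- \<mu> k * t) * cof k \<omega>)" if "0 \<le> t" for t
  proof (cases "t = 0")
    case True
    have "AE \<omega> in M. \<forall>k. J (Suc k) 0 \<omega> = 0"
      by (subst AE_all_countable) (intro allI wiener_integral_at_0[OF assms(1) noise J], auto)
    with Xlim[OF that] show ?thesis
      by eventually_elim (auto simp: True convergent_def)
  next
    case False
    show ?thesis
    proof (rule AE_I2)
      fix \<omega> assume "\<omega> \<in> space M"
      moreover have "\<xi> \<in> measurable M (H_borel \<theta>1 \<theta>2)" using noise by (simp add: driving_noise_def)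
      ultimately have "\<xi> \<omega> \<in> space (H_borel \<theta>1 \<theta>2)" by (rule measurable_space[rotated])
      then have "\<xi> \<omega> \<in> H_space \<theta>1 \<theta>2" by (simp add: H_borel_def space_measure_of_conv)
      then obtain B where B: "\<And>k. \<bar>cof k \<omega>\<bar> \<le> B" using H_coeff_bounded unfolding cof_def by blast
      have B0: "0 \<le> B" using B[of 0] by linarith
      have t: "0 < m0 * t" using m0 that False by simp
      have "summable (\<lambda>k. ev k * exp (- \<mu> k * t) * cof k \<omega>)"
      proof (rule summable_comparison_test')
        have "summable (\<lambda>k. exp (- (m0 * t) * (real (Suc k))\<^sup>2))"
          using summable_gauss[OF t] by (subst summable_Suc_iff)
        then show "summable (\<lambda>k. 2 * B * exp (- (m0 * t) * (real (Suc k))\<^sup>2))" by (rule summable_mult)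
        fix k assume k: "K0 \<le> k"
        have "m0 * (real (Suc k))\<^sup>2 * t \<le> \<mu> k * t" using \<mu>_ge[OF k] that by (rule mult_right_mono)
        then have e: "exp (- \<mu> k * t) \<le> exp (- (m0 * t) * (real (Suc k))\<^sup>2)" by (simp add: mult_ac)
        have "\<bar>ev k\<bar> * exp (- \<mu> k * t) * \<bar>cof k \<omega>\<bar> \<le> 2 * exp (- (m0 * t) * (real (Suc k))\<^sup>2) * B"
          using e ev2[of k] B[of k] by (intro mult_mono) auto
        then show "norm (ev k * exp (- \<mu> k * t) * cof k \<omega>) \<le> 2 * B * exp (- (m0 * t) * (real (Suc k))\<^sup>2)"
          by (simp add: abs_mult mult_ac)
      qed
      then show "convergent (\<lambda>N. \<Sum>k<N. ev k * exp (- \<mu> k * t) * cof k \<omega>)"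
        by (simp add: summable_iff_convergent)
    qed
  qed

  \<comment> \<open>\<open>Z\<close> is defined as the remainder, so that Z + A is the normalised
    increment at every point of the probability space; that \<open>Z\<close> is the stochastic
    series holds almost surely.\<close>
  define A where "A n i \<omega> = lim (\<lambda>N. \<Sum>k<N. ev k * expinc (\<mu> k) n i * cof k \<omega>)" for n i \<omega>
  define Z where "Z n i \<omega> = \<eta> * (X (real (i + 1) / real n) y \<omega> - X (real i / real n) y \<omega>) - A n i \<omega>" for n i \<omega>
  have Am [measurable]: "A n i \<in> borel_measurable M" for n i
    unfolding A_def[abs_def] by measurable
  have Zm [measurable]: "Z n i \<in> borel_measurable M" for n i
    unfolding Z_def[abs_def] by measurable
  have limA: "AE \<omega> in M. \<forall>i. (\<lambda>N. \<Sum>k<N. ev k * expinc (\<mu> k) n i * cof k \<omega>) \<longlonglongrightarrow> A n i \<omega>" for n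
  proof (subst AE_all_countable, intro allI)
    fix i
    show "AE \<omega> in M. (\<lambda>N. \<Sum>k<N. ev k * expinc (\<mu> k) n i * cof k \<omega>) \<longlonglongrightarrow> A n i \<omega>"
      using conv[of "real (i + 1) / real n", simplified] conv[of "real i / real n", simplified]
    proof eventually_elim
      case (elim \<omega>)
      then have "convergent (\<lambda>N. (\<Sum>k<N. ev k * exp (- \<mu> k * (real (i + 1) / real n)) * cof k \<omega>) - (\<Sum>k<N. ev k * exp (- \<mu> k * (real i / real n)) * cof k \<omega>))"
        by (intro convergent_diff) (simp_all add: add.commute)
      moreover have "(\<Sum>k<N. ev k * exp (- \<mu> k * (real (i + 1) / real n)) * cof k \<omega>) - (\<Sum>k<N. ev k * exp (- \<mu> k * (real i / real n)) * cof k \<omega>) =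
        (\<Sum>k<N. ev k * expinc (\<mu> k) n i * cof k \<omega>)" for N
        unfolding sum_subtractf[symmetric] expinc_def by (intro sum.cong refl) (simp only: left_diff_distrib right_diff_distrib)
      ultimately show ?case by (simp only: convergent_LIMSEQ_iff A_def)
    qed
  qed
  have limZ: "AE \<omega> in M. \<forall>i. (\<lambda>N. \<Sum>k<N. ev k * (J (Suc k) (real (i + 1) / real n) \<omega> - J (Suc k) (real i / real n) \<omega>)) \<longlonglongrightarrow> Z n i \<omega>" for n
  proof (subst AE_all_countable, intro allI)
    fix i
    have t: "0 \<le> real (i + 1) / real n" "0 \<le> real i / real n" by simp_all
    show "AE \<omega> in M. (\<lambda>N. \<Sum>k<N. ev k * (J (Suc k) (real (i + 1) / real n) \<omega> - J (Suc k) (real i / real n) \<omega>)) \<longlonglongrightarrow> Z n i \<omega>"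
      using Xlim[OF t(1)] Xlim[OF t(2)] limA[of n]
    proof eventually_elim
      case (elim \<omega>)
      from tendsto_diff[OF tendsto_diff[OF elim(1,2)] elim(3)[rule_format, of i]]
      have "(\<lambda>N. \<Sum>k<N. (ev k * exp (- \<mu> k * (real (i + 1) / real n)) * cof k \<omega> + ev k * J (Suc k) (real (i + 1) / real n) \<omega>) -
        (ev k * exp (- \<mu> k * (real i / real n)) * cof k \<omega> + ev k * J (Suc k) (real i / real n) \<omega>) - ev k * expinc (\<mu> k) n i * cof k \<omega>) \<longlonglongrightarrow> Z n i \<omega>"
        unfolding sum_subtractf[symmetric] Z_def by (simp only: right_diff_distrib)
      moreover have "(u * e1 * c' + u * j1) - (u * e2 * c' + u * j2) - u * (e1 - e2) * c' = u * (j1 - j2)" for u e1 e2 c' j1 j2 :: real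
        by (simp add: algebra_simps)
      ultimately show ?case unfolding expinc_def by (simp only:)
    qed
  qed

  \<comment> \<open>The law of the limit is found from the characteristic functions of the
    truncations to N modes, whose exponents converge by \<open>H.cov_sums\<close>.\<close>
  have gauss: "(CLINT \<omega>|M. iexp (\<Sum>i<n. b i * Z n i \<omega>)) = of_real (exp (- quad_form {..<n} (H.cov (\<sigma>\<^sup>2) n) b / 2))" for n b
  proof (rule LIMSEQ_unique)
    let ?T = "\<lambda>N \<omega>. \<Sum>i<n. b i * (\<Sum>k<N. ev k * (J (Suc k) (real (i + 1) / real n) \<omega> - J (Suc k) (real i / real n) \<omega>))"
    show "(\<lambda>N. CLINT \<omega>|M. iexp (?T N \<omega>)) \<longlonglongrightarrow> (CLINT \<omega>|M. iexp (\<Sum>i<n. b i * Z n i \<omega>))"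
    proof (rule integral_dominated_convergence[where w = "\<lambda>_. 1"])
      show "AE \<omega> in M. (\<lambda>N. iexp (?T N \<omega>)) \<longlonglongrightarrow> iexp (\<Sum>i<n. b i * Z n i \<omega>)"
        using limZ[of n]
      proof eventually_elim
        case (elim \<omega>)
        then have "(\<lambda>N. ?T N \<omega>) \<longlonglongrightarrow> (\<Sum>i<n. b i * Z n i \<omega>)" by (intro tendsto_sum tendsto_mult tendsto_const) auto
        then show ?case by (rule isCont_tendsto_compose[OF isCont_iexp])
      qed
    qed (simp_all only: norm_exp_i_times, auto)
    have "(CLINT \<omega>|M. iexp (?T N \<omega>)) = of_real (exp (- (\<Sum>k<N. w k * (\<sigma>\<^sup>2 / 2 * (\<Sum>i<n. \<Sum>j<n. b i * b j * inccov (\<mu> k) n i j))) / 2))" for N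
      using coordinate_increments_char[OF assms(1) noise J, where n = n and b = b and N = N and ev = ev] unfolding eigval ev_sq .
    moreover have "(\<lambda>N. complex_of_real (exp (- (\<Sum>k<N. w k * (\<sigma>\<^sup>2 / 2 * (\<Sum>i<n. \<Sum>j<n. b i * b j * inccov (\<mu> k) n i j))) / 2))) \<longlonglongrightarrow>
      of_real (exp (- quad_form {..<n} (H.cov (\<sigma>\<^sup>2) n) b / 2))"
      by (intro tendsto_of_real tendsto_exp tendsto_divide tendsto_minus H.cov_sums tendsto_const) simp
    ultimately show "(\<lambda>N. CLINT \<omega>|M. iexp (?T N \<omega>)) \<longlonglongrightarrow> of_real (exp (- quad_form {..<n} (H.cov (\<sigma>\<^sup>2) n) b / 2))"
      by (simp only:)
  qed
  \<comment> \<open>The row-sum constant of \<open>H.cov_row\<close>; by Schur's test it also bounds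
    second moments of linear functionals of \<open>Z\<close>.\<close>
  define \<rho>0 where "\<rho>0 = \<sigma>\<^sup>2 * (a + C + 2 * H.c)"
  have \<rho>0: "0 \<le> \<rho>0" using H.a H.C H.c_nonneg by (simp add: \<rho>0_def)
  have second: "(\<integral>\<^sup>+\<omega>. ennreal ((\<Sum>i<n. b i * Z n i \<omega>)\<^sup>2) \<partial>M) \<le> ennreal (\<rho>0 / sqrt (real n) * (\<Sum>i<n. (b i)\<^sup>2))" if n: "N0 \<le> n" for n b
  proof -
    have "(CLINT \<omega>|M. iexp (t * (\<Sum>i<n. b i * Z n i \<omega>))) = of_real (exp (- t\<^sup>2 * quad_form {..<n} (H.cov (\<sigma>\<^sup>2) n) b / 2))" for t
    proof -
      have g1: "(CLINT \<omega>|M. iexp (\<Sum>i<n. (t * b i) * Z n i \<omega>)) = of_real (exp (- quad_form {..<n} (H.cov (\<sigma>\<^sup>2) n) (\<lambda>i. t * b i) / 2))"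
        by (rule gauss)
      have "quad_form {..<n} (H.cov (\<sigma>\<^sup>2) n) (\<lambda>i. t * b i) = t\<^sup>2 * quad_form {..<n} (H.cov (\<sigma>\<^sup>2) n) b"
        by (simp add: quad_form_def sum_distrib_left power2_eq_square mult_ac)
      moreover have "(\<Sum>i<n. (t * b i) * Z n i \<omega>) = t * (\<Sum>i<n. b i * Z n i \<omega>)" for \<omega>
        by (simp only: sum_distrib_left mult.assoc)
      ultimately show ?thesis using g1 by (simp only: mult_minus_left)
    qed
    then have "(\<integral>\<^sup>+\<omega>. ennreal ((\<Sum>i<n. b i * Z n i \<omega>)\<^sup>2) \<partial>M) \<le> ennreal (quad_form {..<n} (H.cov (\<sigma>\<^sup>2) n) b)"
      by (intro nn_integral_square_le_of_char[OF assms(1)]) auto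
    also have "\<dots> \<le> ennreal (\<rho>0 / sqrt (real n) * (\<Sum>i<n. (b i)\<^sup>2))"
      unfolding \<rho>0_def by (intro ennreal_leI H.quad_form_cov_le N0 n) simp
    finally show ?thesis .
  qed

  obtain S where S: "0 \<le> S" "\<And>F v. finite F \<Longrightarrow> F \<subseteq> {K0..} \<Longrightarrow>
    (\<integral>\<^sup>+x. ennreal ((\<Sum>k\<in>F. v k * cof k x)\<^sup>2) \<partial>M) \<le> ennreal (S * (\<Sum>k\<in>F. (v k)\<^sup>2 / \<mu> k))"
    using initial_condition_second_moments[OF assms(1,5), of K0] \<mu>_pos unfolding eigval cof_def by blast
  have g: "(\<Sum>k\<in>{K0..<N}. (ev k)\<^sup>2 * expint (\<mu> k) (1 / real n)) \<le> (a + C) / sqrt (real n)" if n: "N0 \<le> n" for n N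
  proof -
    have "(\<Sum>k\<in>{K0..<N}. (ev k)\<^sup>2 * expint (\<mu> k) (1 / real n)) \<le> H.G (1 / real n)"
      unfolding ev_sq H.G_def
      by (intro sum_le_suminf H.summable_G) (auto intro!: mult_nonneg_nonneg H.w expint_nonneg)
    also have "\<dots> \<le> (a + C) / sqrt (real n)" by (rule H.G_bound(3)[OF N0[OF n]])
    finally show ?thesis .
  qed
  have limA': "AE \<omega> in M. \<forall>i<n. (\<lambda>N. \<Sum>k<N. ev k * expinc (\<mu> k) n i * cof k \<omega>) \<longlonglongrightarrow> A n i \<omega>" for n
    using limA[of n] by eventually_elim simp
  have aC: "0 \<le> a + C" using H.a H.C by simp
  have N01: "1 \<le> N0" by (rule N0(2)) simp
  obtain P R where PR: "\<And>n. P n \<in> borel_measurable M" "\<And>n. R n \<in> borel_measurable M"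
    "\<And>n x. 0 \<le> P n x" "\<And>x. (\<lambda>n. P n x) \<longlonglongrightarrow> 0" "\<And>n x. 0 \<le> R n x" "(\<lambda>n. \<integral>\<^sup>+x. ennreal (R n x) \<partial>M) \<longlonglongrightarrow> 0"
    "\<And>n x. N0 \<le> n \<Longrightarrow> \<bar>(\<Sum>i<n. (Z n i x + A n i x)\<^sup>2) - (\<Sum>i<n. (Z n i x)\<^sup>2)\<bar> \<le> P n x + R n x"
    using initial_error[OF assms(1) cofm Zm Am ev2 m0 \<mu>_ge S(1) \<rho>0 aC N01 S(2) second limA' g] by blast

  define tr where "tr n = (\<Sum>i<n. H.cov (\<sigma>\<^sup>2) n i i)" for n
  define U where "U n \<omega> = sqrt (real n) * (sigma2_hat \<theta>1 \<theta>2 X n y \<omega> - \<sigma>\<^sup>2)" for n \<omega>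
  define V where "V n \<omega> = s * ((\<Sum>i<n. (Z n i \<omega>)\<^sup>2) - tr n)" for n \<omega>
  have Um [measurable]: "U n \<in> borel_measurable M" for n
  proof -
    have "(\<lambda>\<omega>. increment X n i y \<omega>) \<in> borel_measurable M" if "i \<in> {1..n}" for i
      unfolding increment_def mesh_def using that by (intro borel_measurable_diff Xm) auto
    then show ?thesis
      unfolding U_def[abs_def] sigma2_hat_def[abs_def]
      by (intro borel_measurable_times borel_measurable_diff borel_measurable_const borel_measurable_sum borel_measurable_power)
  qed
  have Vm [measurable]: "V n \<in> borel_measurable M" for n
    unfolding V_def[abs_def] by measurable
  have U_eq: "U n \<omega> = s * (\<Sum>i<n. (Z n i \<omega> + A n i \<omega>)\<^sup>2) - sqrt (real n) * \<sigma>\<^sup>2" if n: "1 \<le> n" for n \<omega>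
  proof -
    have "(\<Sum>i=1..n. (increment X n i y \<omega>)\<^sup>2 * exp (y * \<theta>1 / \<theta>2)) = (\<Sum>i<n. (increment X n (Suc i) y \<omega>)\<^sup>2 * exp (y * \<theta>1 / \<theta>2))"
      by (rule sum.reindex_bij_witness[of _ Suc "\<lambda>i. i - 1"]) auto
    also have "\<dots> = (\<Sum>i<n. (Z n i \<omega> + A n i \<omega>)\<^sup>2)"
    proof (rule sum.cong[OF refl])
      fix i
      have "\<eta>\<^sup>2 = exp (y * \<theta>1 / \<theta>2)" using \<theta>2 by (simp add: \<eta>_def power2_eq_square mult.commute flip: exp_add)
      moreover have "increment X n (Suc i) y \<omega> = X (real (i + 1) / real n) y \<omega> - X (real i / real n) y \<omega>"
        by (simp add: increment_def mesh_def add.commute)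
      ultimately show "(increment X n (Suc i) y \<omega>)\<^sup>2 * exp (y * \<theta>1 / \<theta>2) = (Z n i \<omega> + A n i \<omega>)\<^sup>2"
        by (simp add: Z_def power_mult_distrib mult.commute)
    qed
    finally have 1: "sigma2_hat \<theta>1 \<theta>2 X n y \<omega> = s / (real n * sqrt (mesh n)) * (\<Sum>i<n. (Z n i \<omega> + A n i \<omega>)\<^sup>2)"
      unfolding sigma2_hat_def s_def by simp
    have "sqrt (real n) / (real n * sqrt (mesh n)) = 1"
      using n by (simp add: mesh_def real_sqrt_divide)
    then have "sqrt (real n) * (s / (real n * sqrt (mesh n)) * Q) = s * Q" for Q
      by (metis (no_types, opaque_lifting) mult.assoc mult.commute mult.left_neutral times_divide_eq_right)
    then show ?thesis unfolding U_def 1 by (simp add: right_diff_distrib)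
  qed
  \<comment> \<open>The deterministic bias, trace against \<sigma>^2, joins the pointwise
    error.\<close>
  define P' where "P' n \<omega> = s * P n \<omega> + \<bar>s * tr n - sqrt (real n) * \<sigma>\<^sup>2\<bar>" for n \<omega>
  define R' where "R' n \<omega> = s * R n \<omega>" for n \<omega>
  have bias: "(\<lambda>n. s * tr n - sqrt (real n) * \<sigma>\<^sup>2) \<longlonglongrightarrow> 0"
  proof -
    have "(\<lambda>n. s * (tr n - \<sigma>\<^sup>2 * a * sqrt (real n))) \<longlonglongrightarrow> s * 0"
      unfolding tr_def by (intro tendsto_mult tendsto_const H.cov_trace)
    moreover have "s * (tr n - \<sigma>\<^sup>2 * a * sqrt (real n)) = s * tr n - (s * a) * (sqrt (real n) * \<sigma>\<^sup>2)" for n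
      by (simp add: algebra_simps)
    ultimately show ?thesis unfolding sa by simp
  qed
  \<comment> \<open>With s a = 1 the exponent (t s)^2 tr(C^2) tends to t^2 \<sigma>^4 (1 + sum
    I(r)^2 / 2), which is v t^2 / 2.\<close>
  define v where "v = \<sigma>^4 * ((\<Sum>r. (I_const r)\<^sup>2) + 2)"
  have v_eq: "pi * Gamma_const * \<sigma>^4 = v"
    by (simp add: Gamma_const_def v_def field_simps)
  have Vlim: "(\<lambda>n. CLINT \<omega>|M. iexp (t * V n \<omega>)) \<longlonglongrightarrow> of_real (exp (- v * t\<^sup>2 / 2))" for t
  proof -
    define q where "q n = (\<Sum>i<n. \<Sum>j<n. (H.cov (\<sigma>\<^sup>2) n i j)\<^sup>2)" for n
    have q: "q \<longlonglongrightarrow> (\<sigma>\<^sup>2)\<^sup>2 * a\<^sup>2 * (1 + (\<Sum>r. (I_const r)\<^sup>2) / 2)"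
      unfolding q_def by (rule H.cov_squares)
    have d: "(\<lambda>n. (CLINT \<omega>|M. iexp (t * V n \<omega>)) - of_real (exp (- (t * s)\<^sup>2 * q n))) \<longlonglongrightarrow> 0"
    proof (rule Lim_null_comparison)
      show "eventually (\<lambda>n. norm ((CLINT \<omega>|M. iexp (t * V n \<omega>)) - of_real (exp (- (t * s)\<^sup>2 * q n))) \<le> 4 * \<bar>t * s\<bar>^3 * (\<rho>0 / sqrt (real n) * q n)) sequentially"
        using eventually_ge_at_top[of N0]
      proof eventually_elim
        case (elim n)
        have row: "(\<Sum>j\<in>{..<n}. \<bar>H.cov (\<sigma>\<^sup>2) n i j\<bar>) \<le> \<rho>0 / sqrt (real n)" if "i \<in> {..<n}" for i
          unfolding \<rho>0_def using that by (intro H.cov_row N0 elim) auto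
        have "(CLINT \<omega>|M. iexp (t * V n \<omega>)) = (CLINT \<omega>|M. iexp ((t * s) * ((\<Sum>i<n. (Z n i \<omega>)\<^sup>2) - tr n)))"
          unfolding V_def by (simp only: mult.assoc)
        then show ?case
          using gaussian_squared_norm_char[OF assms(1) _ Zm gauss H.cov_sym row, where t = "t * s"] unfolding q_def tr_def by simp
      qed
      have "(\<lambda>n. 4 * \<bar>t * s\<bar>^3 * (\<rho>0 / sqrt (real n) * q n)) \<longlonglongrightarrow> 4 * \<bar>t * s\<bar>^3 * (0 * ((\<sigma>\<^sup>2)\<^sup>2 * a\<^sup>2 * (1 + (\<Sum>r. (I_const r)\<^sup>2) / 2)))"
        by (intro tendsto_mult tendsto_const H.inverse_sqrt_tendsto q)
      then show "(\<lambda>n. 4 * \<bar>t * s\<bar>^3 * (\<rho>0 / sqrt (real n) * q n)) \<longlonglongrightarrow> 0" by simp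
    qed
    have e: "(\<lambda>n. complex_of_real (exp (- (t * s)\<^sup>2 * q n))) \<longlonglongrightarrow> of_real (exp (- (t * s)\<^sup>2 * ((\<sigma>\<^sup>2)\<^sup>2 * a\<^sup>2 * (1 + (\<Sum>r. (I_const r)\<^sup>2) / 2))))"
      by (intro tendsto_of_real tendsto_exp tendsto_mult tendsto_const q)
    have f: "- (t * s)\<^sup>2 * ((\<sigma>\<^sup>2)\<^sup>2 * a\<^sup>2 * (1 + (\<Sum>r. (I_const r)\<^sup>2) / 2)) = - v * t\<^sup>2 / 2"
    proof -
      have "(t * s)\<^sup>2 * ((\<sigma>\<^sup>2)\<^sup>2 * a\<^sup>2 * k) = (s * a)\<^sup>2 * (\<sigma>^4 * k * t\<^sup>2)" for k
        by (simp add: power_mult_distrib power_mult[symmetric])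
      from this[of "1 + (\<Sum>r. (I_const r)\<^sup>2) / 2"] show ?thesis
        unfolding sa v_def by (simp add: algebra_simps)
    qed
    from tendsto_add[OF d e] show ?thesis unfolding f by (simp only: diff_add_cancel add_0_left)
  qed
  have Ulim: "(\<lambda>n. CLINT \<omega>|M. iexp (t * U n \<omega>)) \<longlonglongrightarrow> of_real (exp (- v * t\<^sup>2 / 2))" for t
  proof (rule slutsky_char[OF assms(1) Um Vm, where P = P' and R = R'])
    show "P' n \<in> borel_measurable M" "R' n \<in> borel_measurable M" for n
      using PR(1,2)[of n] unfolding P'_def[abs_def] R'_def[abs_def] by auto
    show "0 \<le> P' n \<omega>" "0 \<le> R' n \<omega>" for n \<omega> using PR(3,5) s0 by (simp_all add: P'_def R'_def)
    show "(\<lambda>n. P' n \<omega>) \<longlonglongrightarrow> 0" for \<omega>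
      using tendsto_add[OF tendsto_mult[OF tendsto_const[of s] PR(4)[of \<omega>]] tendsto_rabs[OF bias]] by (simp add: P'_def)
    have "(\<integral>\<^sup>+\<omega>. ennreal (R' n \<omega>) \<partial>M) = ennreal s * (\<integral>\<^sup>+\<omega>. ennreal (R n \<omega>) \<partial>M)" for n
      using PR(2)[of n] PR(5) s0 unfolding R'_def by (subst nn_integral_cmult[symmetric]) (auto simp: ennreal_mult)
    then show "(\<lambda>n. \<integral>\<^sup>+\<omega>. ennreal (R' n \<omega>) \<partial>M) \<longlonglongrightarrow> 0"
      using ennreal_tendsto_cmult[OF _ PR(6), of "ennreal s"] by simp
    show "eventually (\<lambda>n. AE \<omega> in M. \<bar>U n \<omega> - V n \<omega>\<bar> \<le> P' n \<omega> + R' n \<omega>) sequentially"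
      using eventually_ge_at_top[of N0]
    proof eventually_elim
      case (elim n)
      show ?case
      proof (rule AE_I2)
        fix \<omega>
        have "U n \<omega> - V n \<omega> = s * ((\<Sum>i<n. (Z n i \<omega> + A n i \<omega>)\<^sup>2) - (\<Sum>i<n. (Z n i \<omega>)\<^sup>2)) + (s * tr n - sqrt (real n) * \<sigma>\<^sup>2)"
          unfolding U_eq[OF N0(2)[OF elim]] V_def by (simp add: algebra_simps)
        also have "\<bar>\<dots>\<bar> \<le> s * \<bar>(\<Sum>i<n. (Z n i \<omega> + A n i \<omega>)\<^sup>2) - (\<Sum>i<n. (Z n i \<omega>)\<^sup>2)\<bar> + \<bar>s * tr n - sqrt (real n) * \<sigma>\<^sup>2\<bar>"
          by (rule order_trans[OF abs_triangle_ineq]) (use s0 in \<open>simp add: abs_mult\<close>)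
        also have "\<dots> \<le> s * (P n \<omega> + R n \<omega>) + \<bar>s * tr n - sqrt (real n) * \<sigma>\<^sup>2\<bar>"
          using PR(7)[OF elim] s0 by (intro add_right_mono mult_left_mono) auto
        finally show "\<bar>U n \<omega> - V n \<omega>\<bar> \<le> P' n \<omega> + R' n \<omega>" by (simp add: P'_def R'_def distrib_left)
      qed
    qed
  qed (rule Vlim)
  \<comment> \<open>The value of \<open>suminf\<close> is meaningful only for a summable series;
    summability comes from Tannery's theorem in \<open>H.D_diff_squares\<close>, where a is
    nonzero.\<close>
  have v0: "0 \<le> v"
  proof -
    have "0 \<le> (\<Sum>r. (I_const r)\<^sup>2)"
    proof (cases "summable (\<lambda>r. (I_const r)\<^sup>2)")
      case True then show ?thesis by (intro suminf_nonneg) auto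
    next
      case False
      have "summable (\<lambda>r. a\<^sup>2 * (I_const r)\<^sup>2)" by (rule H.D_diff_squares(2))
      then show ?thesis using False \<theta>2 by (simp add: summable_cmult_iff a_def)
    qed
    then show ?thesis by (simp add: v_def)
  qed
  have "weak_conv_m (\<lambda>n. distr M borel (U n)) (normal_law 0 v)"
  proof (rule levy_continuity)
    show "real_distribution (distr M borel (U n))" for n by (rule real_distribution_distr[OF Um])
    show "real_distribution (normal_law 0 v)" by (rule char_normal_law(1)[OF v0])
    fix t
    have "char (distr M borel (U n)) t = (CLINT \<omega>|M. iexp (t * U n \<omega>))" for n
      unfolding char_def by (subst integral_distr) auto
    then show "(\<lambda>n. char (distr M borel (U n)) t) \<longlonglongrightarrow> char (normal_law 0 v) t"
      using Ulim[of t] by (simp only: char_normal_law(2)[OF v0])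
  qed
  then show ?thesis unfolding U_def v_eq .
qed

end
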